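(* Let $n\ge 1$ be an integer, $p>2$, $t_0<0$ and \[ \Theta=\{(x,t)\in\mathbf{R}^{n}\times\mathbf{R}: |x|<\zeta(t) \text{ and } t_0<t<0\}, \] where $\zeta$ is a positive continuous function on $(t_0,0)$ such that $\Theta$ is bounded and \[ \lim_{t\to 0^-}(-t)^{-1/p}\zeta(t)=0. \] Then the origin $(0,0)$ is regular with respect to $\Theta$ (for the $p$-parabolic equation $\partial_t u-\operatorname{div}(|\nabla u|^{p-2}\nabla u)=0$).
   Context: The $p$-parabolic equation is $\partial_t u-\Delta_p u:=\partial_t u-\operatorname{div}(|\nabla u|^{p-2}\nabla u)=0$; gradient and divergence are taken with respect to $x\in\mathbf{R}^n$ only. Let $\Theta\subset\mathbf{R}^{n+1}$ be a nonempty bounded open set, $\partial\Theta$ its (topological) boundary in $\mathbf{R}^{n+1}$. For open $U\subset\mathbf{R}^n$ and $t_1<t_2$, put $U_{t_1,t_2}=U\times(t_1,t_2)$, with parabolic boundary $\partial_p U_{t_1,t_2}=(\overline U\times\{t_1\})\cup(\partial U\times(t_1,t_2])$. The space $L^p(t_1,t_2;W^{1,p}(U))$ consists of functions $u(x,t)$ with $u(\cdot,t)\in W^{1,p}(U)$ for a.e. $t\in(t_1,t_2)$ and $\int_{t_1}^{t_2}\int_U(|u|^p+|\nabla u|^p)\,dx\,dt<\infty$. The space $C([t_1,t_2];L^2(U))$ consists of functions $u(x,t)$ such that $t\mapsto\int_U|u(x,t)|^2\,dx$ is continuous on $[t_1,t_2]$. Weak solution: $u:\Theta\to[-\infty,\infty]$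 is a weak solution if for every open cylinder $U_{t_1,t_2}\Subset\Theta$ we have $u\in C([t_1,t_2];L^2(U))\cap L^p(t_1,t_2;W^{1,p}(U))$ and $\int_{t_1}^{t_2}\int_U|\nabla u|^{p-2}\nabla u\cdot\nabla\varphi\,dx\,dt-\int_{t_1}^{t_2}\int_U u\,\partial_t\varphi\,dx\,dt=0$ for all $\varphi\in C_0^\infty(U_{t_1,t_2})$. A $p$-parabolic function is a continuous weak solution. A function $u:\Theta\to(-\infty,\infty]$ is $p$-superparabolic if (i) $u$ is lower semicontinuous; (ii) $u$ is finite in a dense subset of $\Theta$; (iii) for every space-time box $Q_{t_1,t_2}=Q\times(t_1,t_2)\Subset\Theta$, with $Q=(a_1,b_1)\times\cdots\times(a_n,b_n)$, if $h$ is $p$-parabolic in $Q_{t_1,t_2}$, continuous on $\overline{Q}_{t_1,t_2}$ and $h\le u$ on $\partial_pQ_{t_1,t_2}$, then $h\le u$ in $Q_{t_1,t_2}$. Upper Perron solution: for bounded $f:\partial\Theta\to\mathbf{R}$, let $\mathcal{U}_f(\Theta)$ be the set of all $p$-superparabolic functions $u$ on $\Theta$ that are bounded below and satisfy $\liminf_{\Theta\ni\eta\to\xi}u(\eta)\ge f(\xi)$ for all $\xi\in\partial\Theta$; put $\overline{H}f(\xi)=\inf_{u\in\mathcal{U}_f(\Theta)}u(\xi)$ for $\xi\in\Theta$. A boundary point $\xi_0\in\partial\Theta$ is regular with respect to $\Theta$ if $\lim_{\Theta\ni\xi\to\xi_0}\overline{H}f(\xi)=f(\xi_0)$ for every continuous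 $f:\partial\Theta\to\mathbf{R}$; otherwise it is irregular. *)

theory Defs
  imports "HOL-Analysis.Analysis"
begin

section \<open>Test functions\<close>

fun Ck_fun :: "nat \<Rightarrow> ('a::euclidean_space \<Rightarrow> real) \<Rightarrow> bool" where
  "Ck_fun 0 f \<longleftrightarrow> continuous_on UNIV f"
| "Ck_fun (Suc k) f \<longleftrightarrow>
     (\<forall>x. f differentiable (at x)) \<and> (\<forall>v. Ck_fun k (\<lambda>x. frechet_derivative f (at x) v))"

text \<open>The elements of \<open>C\<^sub>0\<^sup>\<infinity>(S)\<close> are represented by their extension by zero to the whole space.\<close>

definition test_fun :: "'a::euclidean_space set \<Rightarrow> ('a \<Rightarrow> real) \<Rightarrow> bool" where
  "test_fun S \<phi> \<longleftrightarrow> (\<forall>k. Ck_fun k \<phi>) \<and>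
     compact (closure {x. \<phi> x \<noteq> 0}) \<and> closure {x. \<phi> x \<noteq> 0} \<subseteq> S"

definition grad :: "(real^'n \<Rightarrow> real) \<Rightarrow> real^'n \<Rightarrow> real^'n" where
  "grad \<phi> x = (\<chi> i. frechet_derivative \<phi> (at x) (axis i 1))"

definition grad_x :: "((real^'n) \<times> real \<Rightarrow> real) \<Rightarrow> (real^'n) \<times> real \<Rightarrow> real^'n" where
  "grad_x \<phi> z = (\<chi> i. frechet_derivative \<phi> (at z) (axis i 1, 0))"

definition deriv_t :: "((real^'n) \<times> real \<Rightarrow> real) \<Rightarrow> (real^'n) \<times> real \<Rightarrow> real" where
  "deriv_t \<phi> z = frechet_derivative \<phi> (at z) (0, 1)"

section \<open>Function spaces\<close>

text \<open>Functions take values in the extended reals. Membership in a Lebesgue space forces them to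
  be finite almost everywhere, so that \<open>real_of_ereal\<close> loses no information in the integrals.\<close>

definition in_Lq :: "real \<Rightarrow> 'a::euclidean_space set \<Rightarrow> ('a \<Rightarrow> ereal) \<Rightarrow> bool" where
  "in_Lq q S f \<longleftrightarrow> f \<in> borel_measurable (lebesgue_on S) \<and>
     (AE x in lebesgue. x \<in> S \<longrightarrow> \<bar>f x\<bar> \<noteq> \<infinity>) \<and>
     set_integrable lebesgue S (\<lambda>x. \<bar>real_of_ereal (f x)\<bar> powr q)"

definition weak_gradient ::
    "(real^'n) set \<Rightarrow> (real^'n \<Rightarrow> ereal) \<Rightarrow> (real^'n \<Rightarrow> real^'n) \<Rightarrow> bool" where
  "weak_gradient U f g \<longleftrightarrow>
     (AE x in lebesgue. x \<in> U \<longrightarrow> \<bar>f x\<bar> \<noteq> \<infinity>) \<and>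
     (\<forall>K. compact K \<and> K \<subseteq> U \<longrightarrow>
        set_integrable lebesgue K (\<lambda>x. real_of_ereal (f x)) \<and> set_integrable lebesgue K g) \<and>
     (\<forall>\<phi>. test_fun U \<phi> \<longrightarrow>
        (LINT x:U|lebesgue. real_of_ereal (f x) *\<^sub>R grad \<phi> x) = - (LINT x:U|lebesgue. \<phi> x *\<^sub>R g x))"

definition in_W1p :: "real \<Rightarrow> (real^'n) set \<Rightarrow> (real^'n \<Rightarrow> ereal) \<Rightarrow> bool" where
  "in_W1p p U f \<longleftrightarrow> in_Lq p U f \<and>
     (\<exists>g. weak_gradient U f g \<and> set_integrable lebesgue U (\<lambda>x. norm (g x) powr p))"

definition cylinder :: "(real^'n) set \<Rightarrow> real \<Rightarrow> real \<Rightarrow> ((real^'n) \<times> real) set" where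
  "cylinder U t1 t2 = U \<times> {t1<..<t2}"

text \<open>\<open>u \<in> L\<^sup>p(t\<^sub>1,t\<^sub>2;W\<^sup>1\<^sup>,\<^sup>p(U))\<close>, together with a jointly measurable version \<open>G\<close> of its spatial weak
  gradient. Such a \<open>G\<close> is determined by \<open>u\<close> up to a null set.\<close>

definition in_Lp_W1p_with_gradient ::
    "real \<Rightarrow> real \<Rightarrow> real \<Rightarrow> (real^'n) set \<Rightarrow> ((real^'n) \<times> real \<Rightarrow> ereal) \<Rightarrow>
     ((real^'n) \<times> real \<Rightarrow> real^'n) \<Rightarrow> bool" where
  "in_Lp_W1p_with_gradient p t1 t2 U u G \<longleftrightarrow>
     (AE t in lebesgue. t \<in> {t1<..<t2} \<longrightarrow>
        in_W1p p U (\<lambda>x. u (x, t)) \<and> weak_gradient U (\<lambda>x. u (x, t)) (\<lambda>x. G (x, t))) \<and>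
     G \<in> borel_measurable (lebesgue_on (cylinder U t1 t2)) \<and>
     in_Lq p (cylinder U t1 t2) u \<and>
     set_integrable lebesgue (cylinder U t1 t2) (\<lambda>z. norm (G z) powr p)"

text \<open>As a convention, \<open>C([t\<^sub>1,t\<^sub>2];L\<^sup>2(U))\<close> asks for continuity of the squared norm
  \<open>t \<mapsto> \<integral>\<^sub>U |u(x,t)|\<^sup>2 dx\<close> only, not for continuity of \<open>t \<mapsto> u(\<cdot>,t)\<close> as a map into \<open>L\<^sup>2(U)\<close>.\<close>

definition in_C_L2 ::
    "real \<Rightarrow> real \<Rightarrow> (real^'n) set \<Rightarrow> ((real^'n) \<times> real \<Rightarrow> ereal) \<Rightarrow> bool" where
  "in_C_L2 t1 t2 U u \<longleftrightarrow>
     (\<forall>t\<in>{t1..t2}. in_Lq 2 U (\<lambda>x. u (x, t))) \<and>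
     continuous_on {t1..t2} (\<lambda>t. LINT x:U|lebesgue. \<bar>real_of_ereal (u (x, t))\<bar>\<^sup>2)"

section \<open>Parabolic and superparabolic functions\<close>

definition compactly_inside :: "'a::topological_space set \<Rightarrow> 'a set \<Rightarrow> bool" where
  "compactly_inside S T \<longleftrightarrow> compact (closure S) \<and> closure S \<subseteq> T"

definition parabolic_boundary :: "(real^'n) set \<Rightarrow> real \<Rightarrow> real \<Rightarrow> ((real^'n) \<times> real) set" where
  "parabolic_boundary U t1 t2 = (closure U \<times> {t1}) \<union> (frontier U \<times> {t1<..t2})"

definition weak_solution ::
    "real \<Rightarrow> ((real^'n) \<times> real) set \<Rightarrow> ((real^'n) \<times> real \<Rightarrow> ereal) \<Rightarrow> bool" where
  "weak_solution p \<Theta> u \<longleftrightarrow>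
     (\<forall>U t1 t2. open U \<and> t1 < t2 \<and> compactly_inside (cylinder U t1 t2) \<Theta> \<longrightarrow>
        in_C_L2 t1 t2 U u \<and>
        (\<exists>G. in_Lp_W1p_with_gradient p t1 t2 U u G \<and>
          (\<forall>\<phi>. test_fun (cylinder U t1 t2) \<phi> \<longrightarrow>
             (LINT z:cylinder U t1 t2|lebesgue. (norm (G z) powr (p - 2) *\<^sub>R G z) \<bullet> grad_x \<phi> z)
             - (LINT z:cylinder U t1 t2|lebesgue. real_of_ereal (u z) * deriv_t \<phi> z) = 0)))"

text \<open>Continuous functions are understood to be real-valued.\<close>

definition p_parabolic ::
    "real \<Rightarrow> ((real^'n) \<times> real) set \<Rightarrow> ((real^'n) \<times> real \<Rightarrow> real) \<Rightarrow> bool" where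
  "p_parabolic p \<Theta> h \<longleftrightarrow> continuous_on \<Theta> h \<and> weak_solution p \<Theta> (\<lambda>z. ereal (h z))"

definition p_superparabolic ::
    "real \<Rightarrow> ((real^'n) \<times> real) set \<Rightarrow> ((real^'n) \<times> real \<Rightarrow> ereal) \<Rightarrow> bool" where
  "p_superparabolic p \<Theta> u \<longleftrightarrow>
     (\<forall>z\<in>\<Theta>. u z \<noteq> -\<infinity>) \<and>
     (\<forall>c. openin (top_of_set \<Theta>) {z \<in> \<Theta>. c < u z}) \<and>
     \<Theta> \<subseteq> closure {z \<in> \<Theta>. \<bar>u z\<bar> \<noteq> \<infinity>} \<and>
     (\<forall>a b t1 t2 h.
        t1 < t2 \<and> compactly_inside (cylinder (box a b) t1 t2) \<Theta> \<and>
        p_parabolic p (cylinder (box a b) t1 t2) h \<and>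
        continuous_on (closure (cylinder (box a b) t1 t2)) h \<and>
        (\<forall>z\<in>parabolic_boundary (box a b) t1 t2. ereal (h z) \<le> u z) \<longrightarrow>
        (\<forall>z\<in>cylinder (box a b) t1 t2. ereal (h z) \<le> u z))"

section \<open>Perron solutions and boundary regularity\<close>

definition upper_class ::
    "real \<Rightarrow> ((real^'n) \<times> real) set \<Rightarrow> ((real^'n) \<times> real \<Rightarrow> real) \<Rightarrow>
     ((real^'n) \<times> real \<Rightarrow> ereal) set" where
  "upper_class p \<Theta> f = {u. p_superparabolic p \<Theta> u \<and>
     (\<exists>m::real. \<forall>z\<in>\<Theta>. ereal m \<le> u z) \<and>
     (\<forall>\<xi>\<in>frontier \<Theta>. ereal (f \<xi>) \<le> Liminf (at \<xi> within \<Theta>) u)}"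

definition upper_Perron ::
    "real \<Rightarrow> ((real^'n) \<times> real) set \<Rightarrow> ((real^'n) \<times> real \<Rightarrow> real) \<Rightarrow> (real^'n) \<times> real \<Rightarrow> ereal" where
  "upper_Perron p \<Theta> f \<xi> = (INF u\<in>upper_class p \<Theta> f. u \<xi>)"

definition regular_point ::
    "real \<Rightarrow> ((real^'n) \<times> real) set \<Rightarrow> (real^'n) \<times> real \<Rightarrow> bool" where
  "regular_point p \<Theta> \<xi>0 \<longleftrightarrow> \<xi>0 \<in> frontier \<Theta> \<and>
     (\<forall>f. continuous_on (frontier \<Theta>) f \<longrightarrow>
        (upper_Perron p \<Theta> f \<longlongrightarrow> ereal (f \<xi>0)) (at \<xi>0 within \<Theta>))"

end

theory Submission
  imports Defs
begin

text \<open>Put \<open>q = p / (p - 1)\<close>. The functions \<open>c \<bar>x - y\<bar>\<^sup>q + n (c q)\<^sup>p\<^sup>-\<^sup>1 t + d\<close> with \<open>c \<ge> 0\<close> are p-parabolic,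
  because their flux \<open>(c q)\<^sup>p\<^sup>-\<^sup>1 (x - y)\<close> is linear in \<open>x\<close>. A smaller speed in \<open>t\<close> gives a subsolution, and
  changing the sign gives supersolutions. These explicit functions are the barriers.

  Suppose that near the origin the domain lies in \<open>\<bar>x\<bar> \<le> \<epsilon> (-t)\<^sup>1\<^sup>/\<^sup>p\<close>, and that the deviation of the Perron solution
  from \<open>f(0)\<close> to one side is at most \<open>M\<close> after the time \<open>-\<sigma>\<close>. Between the times \<open>-\<sigma>\<close> and \<open>-\<sigma>/2\<close> a barrier can move by \<open>M/2\<close> in time
  while it varies by at most \<open>M/4\<close> in \<open>x\<close>, provided that \<open>\<epsilon>\<^sup>p\<close> is below a constant times \<open>M\<^sup>p\<^sup>-\<^sup>2\<close>
  (\<open>barrier_coefficient\<close>). The deviation then drops to \<open>3M/4\<close>. As \<open>p > 2\<close>, one \<open>\<epsilon>\<close> serves all \<open>M\<close> above a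
  given \<open>\<eta>\<close>, so finitely many steps push the deviation below \<open>\<eta>\<close>; this is where the thinness of the domain
  at the origin enters. The argument is run twice: for every member of the upper class from below
  (\<open>upper_class_bound_step\<close>), and from above by constructing one member of the upper class out of explicit
  supersolutions that are pasted in time (\<open>superparabolic_paste\<close>, \<open>upper_function_step\<close>).

  Two comparison principles are behind these steps, and neither uses the solvability of a boundary value
  problem. A superparabolic function lies above an explicit strict subsolution, because near a point
  of contact another explicit solution, with a slightly smaller \<open>c\<close> and a shifted centre, would violate
  the comparison property (\<open>superparabolic_no_touching\<close>, \<open>superparabolic_comparison\<close>). And explicit
  supersolutions are superparabolic, that is, they dominate every continuous weak solution \<open>h\<close> with
  smaller boundary values (\<open>explicit_supersolution_comparison\<close>). For the latter the equation of
  \<open>g = h - w\<close> is tested with a truncation of \<open>g\<close>, and the monotonicity of the flux gives the sign.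
  Since \<open>g\<close> has no time derivative, the equation is mollified in space-time; the error is controlled by the
  continuity of translations in Lebesgue spaces (\<open>monotone_flux_comparison\<close>).\<close>

section \<open>Smooth bump functions\<close>

lemma Ck_fun_SucI:
  assumes "\<And>x. (f has_derivative f' x) (at x)" "\<And>v. Ck_fun k (\<lambda>x. f' x v)"
  shows "Ck_fun (Suc k) f"
proof -
  have "frechet_derivative f (at x) = f' x" for x
    using frechet_derivative_at[OF assms(1)] by simp
  with assms show ?thesis by (auto simp: differentiable_def)
qed

lemma Ck_fun_SucD:
  "Ck_fun (Suc k) f \<Longrightarrow> (f has_derivative frechet_derivative f (at x)) (at x)"
  by (simp add: frechet_derivative_works)

lemma Ck_fun_const: "Ck_fun k (\<lambda>x. c)"
proof (induction k arbitrary: c)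
  case (Suc k)
  show ?case by (rule Ck_fun_SucI[where f' = "\<lambda>x v. 0"]) (auto simp: Suc)
qed simp

lemma Ck_fun_Suc_imp: "Ck_fun (Suc k) f \<Longrightarrow> Ck_fun k f"
proof (induction k arbitrary: f)
  case 0
  then show ?case
    by (auto intro!: continuous_at_imp_continuous_on differentiable_imp_continuous_within)
qed auto

lemma Ck_fun_add: "Ck_fun k f \<Longrightarrow> Ck_fun k g \<Longrightarrow> Ck_fun k (\<lambda>x. f x + g x)"
proof (induction k arbitrary: f g)
  case (Suc k)
  show ?case
    by (rule Ck_fun_SucI[where f' = "\<lambda>x v. frechet_derivative f (at x) v + frechet_derivative g (at x) v"])
       (use Suc in \<open>auto intro!: has_derivative_add Ck_fun_SucD[of k] simp del: Ck_fun.simps(2), auto\<close>)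
qed (auto intro: continuous_intros)

lemma Ck_fun_mult: "Ck_fun k f \<Longrightarrow> Ck_fun k g \<Longrightarrow> Ck_fun k (\<lambda>x. f x * g x)"
proof (induction k arbitrary: f g)
  case (Suc k)
  have "Ck_fun k f" "Ck_fun k g" using Suc.prems by (blast intro: Ck_fun_Suc_imp)+
  moreover have "Ck_fun k (\<lambda>x. frechet_derivative f (at x) v)" "Ck_fun k (\<lambda>x. frechet_derivative g (at x) v)" for v
    using Suc.prems by auto
  ultimately show ?case
    by (intro Ck_fun_SucI[where f' = "\<lambda>x v. f x * frechet_derivative g (at x) v + frechet_derivative f (at x) v * g x"]
          has_derivative_mult Ck_fun_SucD[of k] Suc.prems Ck_fun_add Suc.IH)
qed (auto intro: continuous_intros)

lemma Ck_fun_bounded_linear: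
  assumes "bounded_linear f" shows "Ck_fun k f"
proof (cases k)
  case 0
  then show ?thesis using assms by (auto intro: linear_continuous_on)
next
  case (Suc m)
  then show ?thesis
    using assms by (auto intro!: Ck_fun_SucI[where f' = "\<lambda>x. f"] Ck_fun_const bounded_linear_imp_has_derivative
        simp del: Ck_fun.simps)
qed

text \<open>Differentiation raises the power of \<open>1/x\<close> and does not leave this family. Since every member
  vanishes to all orders at \<open>0\<close>, smoothness is an induction over the order of differentiation,
  uniformly in \<open>k\<close>.\<close>

definition flat_exp :: "nat \<Rightarrow> real \<Rightarrow> real" where
  "flat_exp k x = (if x > 0 then (1/x)^k * exp (-1/x) else 0)"

lemma flat_exp_tendsto_0: "(flat_exp k \<longlongrightarrow> 0) (at 0)"
proof -
  have "((\<lambda>y::real. y^k / exp y) \<longlongrightarrow> 0) at_top"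
    by (rule tendsto_power_div_exp_0)
  hence "((\<lambda>x::real. (inverse x)^k / exp (inverse x)) \<longlongrightarrow> 0) (at_right 0)"
    by (rule filterlim_compose[OF _ filterlim_inverse_at_top_right])
  hence "((\<lambda>x. flat_exp k x) \<longlongrightarrow> 0) (at_right 0)"
    by (rule Lim_transform_eventually)
       (auto simp: eventually_at_filter flat_exp_def exp_minus field_simps intro!: eventuallyI)
  moreover have "((\<lambda>x. flat_exp k x) \<longlongrightarrow> 0) (at_left 0)"
    by (rule tendsto_eventually)
       (auto simp: eventually_at_filter flat_exp_def intro!: eventuallyI)
  ultimately show ?thesis by (rule filterlim_split_at[rotated])
qed

lemma flat_exp_has_real_derivative:
  "(flat_exp k has_real_derivative (flat_exp (k+2) x - real k * flat_exp (k+1) x)) (at x)"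
proof -
  consider "x > 0" | "x < 0" | "x = 0" by linarith
  then show ?thesis
  proof cases
    case 1
    have "((\<lambda>x. (1/x)^k * exp (-1/x)) has_real_derivative (flat_exp (k+2) x - real k * flat_exp (k+1) x)) (at x)"
    proof (cases k)
      case 0
      show ?thesis using 1 unfolding 0
        by (auto intro!: derivative_eq_intros simp: flat_exp_def power2_eq_square field_simps)
    next
      case (Suc m)
      have "m = 0 \<or> x * x ^ (m - Suc 0) = x ^ m" by (cases m) auto
      then show ?thesis using 1 unfolding Suc
        by (auto intro!: derivative_eq_intros simp: flat_exp_def power2_eq_square field_simps)
    qed
    then show ?thesis
      by (rule has_field_derivative_transform_within_open[where S = "{0<..}"])
         (use 1 in \<open>auto simp: flat_exp_def\<close>)
  next
    case 2
    have "((\<lambda>x. 0) has_real_derivative (flat_exp (k+2) x - real k * flat_exp (k+1) x)) (at x)"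
      using 2 by (auto simp: flat_exp_def)
    then show ?thesis
      by (rule has_field_derivative_transform_within_open[where S = "{..<0}"])
         (use 2 in \<open>auto simp: flat_exp_def\<close>)
  next
    case 3
    have "((\<lambda>h. (flat_exp k (0 + h) - flat_exp k 0) / h) \<longlongrightarrow> 0) (at 0)"
      by (rule Lim_transform_eventually[OF flat_exp_tendsto_0[of "Suc k"]])
         (auto simp: flat_exp_def eventually_at_filter intro!: eventuallyI)
    then show ?thesis using 3 by (simp add: DERIV_def flat_exp_def)
  qed
qed

lemma flat_exp_nonneg: "flat_exp k x \<ge> 0" by (simp add: flat_exp_def)

lemma continuous_on_flat_exp [continuous_intros]:
  "continuous_on S f \<Longrightarrow> continuous_on S (\<lambda>x. flat_exp k (f x))"
  using continuous_on_compose2[of UNIV "flat_exp k" S f] DERIV_isCont[OF flat_exp_has_real_derivative]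
  by (auto simp: continuous_at_imp_continuous_on)

text \<open>A function of \<open>\<bar>a - z\<bar>\<close>, hence symmetric in \<open>a\<close> and \<open>z\<close>: a derivative with respect to the variable of a test
  function is minus the derivative with respect to its centre.\<close>

definition bump :: "real \<Rightarrow> 'a::euclidean_space \<Rightarrow> 'a \<Rightarrow> real" where
  "bump r z a = flat_exp 0 (r\<^sup>2 - (a - z) \<bullet> (a - z))"

text \<open>The derivative of \<open>bump r z\<close> at \<open>a\<close> in the direction \<open>v\<close>.\<close>

definition dbump :: "real \<Rightarrow> 'a::euclidean_space \<Rightarrow> 'a \<Rightarrow> 'a \<Rightarrow> real" where
  "dbump r v z a = flat_exp 2 (r\<^sup>2 - (a - z) \<bullet> (a - z)) * (-2 * ((a - z) \<bullet> v))"

lemma flat_exp_quadratic_has_derivative: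
  fixes z :: "'a::euclidean_space"
  shows "((\<lambda>a. flat_exp k (s - (a - z) \<bullet> (a - z))) has_derivative
     (\<lambda>v. (flat_exp (k+2) (s - (a - z) \<bullet> (a - z)) - real k * flat_exp (k+1) (s - (a - z) \<bullet> (a - z)))
        * (-2 * ((a - z) \<bullet> v)))) (at a)"
proof -
  have "((\<lambda>a. s - (a - z) \<bullet> (a - z)) has_derivative (\<lambda>v. -2 * ((a - z) \<bullet> v))) (at a)"
    by (auto intro!: derivative_eq_intros simp: inner_commute)
  from has_derivative_compose[OF this, of "flat_exp k"
      "(*) (flat_exp (k+2) (s - (a - z) \<bullet> (a - z)) - real k * flat_exp (k+1) (s - (a - z) \<bullet> (a - z)))"]
  show ?thesis
    using flat_exp_has_real_derivative[of k "s - (a - z) \<bullet> (a - z)"]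
    by (simp add: has_field_derivative_def)
qed

lemma Ck_fun_flat_exp_quadratic:
  fixes z :: "'a::euclidean_space"
  shows "Ck_fun m (\<lambda>a. flat_exp k (s - (a - z) \<bullet> (a - z)))"
proof (induction m arbitrary: k)
  case 0
  show ?case by (auto intro!: continuous_intros)
next
  case (Suc m)
  have lin: "Ck_fun m (\<lambda>a. - 2 * ((a - z) \<bullet> v))" for v
  proof -
    have "Ck_fun m (\<lambda>a. (a \<bullet> (-2 *\<^sub>R v)) + 2 * (z \<bullet> v))"
      by (intro Ck_fun_add Ck_fun_const Ck_fun_bounded_linear bounded_linear_inner_left)
    then show ?thesis by (simp add: inner_diff_left algebra_simps)
  qed
  have "Ck_fun m (\<lambda>a. (flat_exp (k+2) (s - (a - z) \<bullet> (a - z))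
      + (- real k) * flat_exp (k+1) (s - (a - z) \<bullet> (a - z))) * (-2 * ((a - z) \<bullet> v)))" for v
    by (intro Ck_fun_mult Ck_fun_add Ck_fun_const Suc lin)
  then show ?case
    by (intro Ck_fun_SucI[OF flat_exp_quadratic_has_derivative]) simp
qed

lemma bump_has_derivative: "(bump r z has_derivative (\<lambda>v. dbump r v z a)) (at a)"
  using flat_exp_quadratic_has_derivative[of 0 "r\<^sup>2" z a]
  by (simp add: bump_def[abs_def] dbump_def numeral_2_eq_2)

lemma bump_commute: "bump r z a = bump r a z"
  by (simp add: bump_def inner_diff_left inner_diff_right inner_commute algebra_simps)

lemma dbump_commute: "dbump r v z a = - dbump r v a z"
  by (simp add: dbump_def inner_diff_left inner_diff_right inner_commute algebra_simps)

lemma bump_eq_0_iff: "r > 0 \<Longrightarrow> bump r z a = 0 \<longleftrightarrow> r \<le> dist z a"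
proof -
  assume "r > 0"
  have "(a - z) \<bullet> (a - z) = (dist z a)\<^sup>2" by (simp add: dist_norm power2_norm_eq_inner norm_minus_commute)
  moreover have "(dist z a)\<^sup>2 < r\<^sup>2 \<longleftrightarrow> dist z a < r"
    using \<open>r > 0\<close> power2_less_imp_less[of "dist z a" r] power_strict_mono[of "dist z a" r 2] by auto
  ultimately show ?thesis using \<open>r > 0\<close> by (auto simp: bump_def flat_exp_def not_less abs_of_pos)
qed

lemma dbump_eq_0:
  assumes "r > 0" "r \<le> dist z a" shows "dbump r v z a = 0"
proof -
  have "(a - z) \<bullet> (a - z) = (dist z a)\<^sup>2"
    by (simp add: dist_norm power2_norm_eq_inner norm_minus_commute)
  moreover have "r\<^sup>2 \<le> (dist z a)\<^sup>2" using assms by (intro power_mono) auto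
  ultimately have "\<not> r\<^sup>2 - (a - z) \<bullet> (a - z) > 0" by linarith
  then show ?thesis by (simp only: dbump_def flat_exp_def if_False mult_zero_left)
qed

lemma bump_nonneg: "bump r z a \<ge> 0" by (simp add: bump_def flat_exp_nonneg)

lemma continuous_on_bump [continuous_intros]:
  "continuous_on S f \<Longrightarrow> continuous_on S g \<Longrightarrow> continuous_on S (\<lambda>x. bump r (f x) (g x))"
  unfolding bump_def by (intro continuous_intros)

lemma continuous_on_dbump [continuous_intros]:
  "continuous_on S f \<Longrightarrow> continuous_on S g \<Longrightarrow> continuous_on S (\<lambda>x. dbump r v (f x) (g x))"
  unfolding dbump_def by (intro continuous_intros)

lemma test_fun_bump:
  assumes "r > 0" "cball z r \<subseteq> S"
  shows "test_fun S (bump r z)"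
proof -
  have "closure {a. bump r z a \<noteq> 0} \<subseteq> cball z r"
    by (rule closure_minimal) (auto simp: bump_eq_0_iff[OF assms(1)])
  moreover from this have "compact (closure {a. bump r z a \<noteq> 0})"
    by (meson bounded_subset compact_eq_bounded_closed bounded_cball closed_closure)
  ultimately show ?thesis using assms(2) Ck_fun_flat_exp_quadratic[of _ 0 "r\<^sup>2" z]
    unfolding test_fun_def by (auto simp: bump_def[abs_def])
qed

section \<open>Integration of compactly supported functions\<close>

text \<open>Lebesgue integrals of compactly supported functions become integrals over a box, where
  differentiation under the integral sign and continuity in parameters are available.\<close>

lemma cbox_containing_support:
  obtains l u :: "'a::euclidean_space"
  where "\<And>f. (\<And>a. norm a \<ge> R \<Longrightarrow> f a = (0::real)) \<Longrightarrow> (\<lambda>a. indicator (cbox l u) a *\<^sub>R f a) = f"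
proof -
  obtain l :: 'a where l: "ball 0 R \<subseteq> cbox (- l) l"
    using bounded_subset_cbox_symmetric[of "ball (0::'a) R"] by auto
  show ?thesis
  proof (rule that[of "-l" l])
    fix f :: "'a \<Rightarrow> real" assume f: "\<And>a. norm a \<ge> R \<Longrightarrow> f a = 0"
    have out: "f a = 0" if "a \<notin> cbox (-l) l" for a
    proof -
      have "a \<notin> ball 0 R" using l that by blast
      then show ?thesis by (intro f) simp
    qed
    show "(\<lambda>a. indicator (cbox (-l) l) a *\<^sub>R f a) = f"
    proof (intro ext)
      fix a show "indicator (cbox (-l) l) a *\<^sub>R f a = f a"
        using out[of a] by (cases "a \<in> cbox (-l) l") (simp_all del: mem_box)
    qed
  qed
qed

lemma integrable_continuous_bounded_support:
  fixes f :: "'a::euclidean_space \<Rightarrow> 'b::{banach, second_countable_topology}"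
  assumes c: "continuous_on UNIV f" and supp: "\<And>a. norm a \<ge> R \<Longrightarrow> f a = 0"
  shows "integrable lborel f"
proof -
  have "integrable lborel (\<lambda>a. indicator (cball 0 R) a *\<^sub>R f a)"
    by (rule borel_integrable_compact) (use continuous_on_subset[OF c] in auto)
  moreover have "indicator (cball 0 R) a *\<^sub>R f a = f a" for a
    using supp[of a] by (cases "norm a \<le> R") auto
  ultimately show ?thesis by simp
qed

lemma integral_parametric_derivative:
  fixes F F' :: "real \<Rightarrow> 'a::euclidean_space \<Rightarrow> real"
  assumes der: "\<And>s a. ((\<lambda>s. F s a) has_real_derivative F' s a) (at s)"
    and cF: "\<And>s. continuous_on UNIV (F s)"
    and cF': "continuous_on UNIV (\<lambda>(s, a). F' s a)"
    and supp: "\<And>s a. \<bar>s\<bar> < 1 \<Longrightarrow> norm a \<ge> R \<Longrightarrow> F s a = 0"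
  shows "((\<lambda>s. \<integral>a. F s a \<partial>lborel) has_real_derivative (\<integral>a. F' 0 a \<partial>lborel)) (at 0)"
proof -
  obtain l u :: 'a where lu: "\<And>f. (\<And>a. norm a \<ge> R \<Longrightarrow> f a = (0::real)) \<Longrightarrow> (\<lambda>a. indicator (cbox l u) a *\<^sub>R f a) = f"
    using cbox_containing_support[of R] by metis
  have eq: "(\<integral>a. f a \<partial>lborel) = integral (cbox l u) f"
    if "continuous_on UNIV f" "\<And>a. norm a \<ge> R \<Longrightarrow> f a = 0" for f :: "'a \<Rightarrow> real"
  proof -
    have c: "continuous_on (cbox l u) f" using that(1) continuous_on_subset by blast
    have "set_integrable lborel (cbox l u) f"
      unfolding set_integrable_def by (rule borel_integrable_compact[OF compact_cbox c])
    have "integral\<^sup>L lborel f = integral\<^sup>L lborel (\<lambda>a. indicator (cbox l u) a *\<^sub>R f a)"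
      by (rule arg_cong[OF lu[OF that(2)], symmetric])
    also have "\<dots> = integral (cbox l u) f"
      using set_borel_integral_eq_integral(2)[OF \<open>set_integrable lborel (cbox l u) f\<close>]
      by (simp only: set_lebesgue_integral_def)
    finally show ?thesis .
  qed
  have F'0: "F' s a = 0" if "\<bar>s\<bar> < 1" "norm a \<ge> R" for s a
  proof -
    have "((\<lambda>s. 0) has_real_derivative F' s a) (at s)"
      by (rule has_field_derivative_transform_within_open[OF der, where S = "{-1<..<1}"])
         (use that supp in auto)
    then show ?thesis using DERIV_unique[OF _ DERIV_const] by blast
  qed
  have cF'0: "continuous_on UNIV (F' 0)"
    using continuous_on_compose2[OF cF', of UNIV "\<lambda>a. (0, a)"]
    by (simp add: continuous_on_Pair[OF continuous_on_const continuous_on_id])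
  have "((\<lambda>s. integral (cbox l u) (F s)) has_real_derivative integral (cbox l u) (F' 0))
        (at 0 within {-1<..<1})"
  proof (rule leibniz_rule_field_derivative)
    show "F s integrable_on cbox l u" for s
      by (rule integrable_continuous) (use cF continuous_on_subset in blast)
    show "continuous_on ({-1<..<1} \<times> cbox l u) (\<lambda>(s, a). F' s a)"
      using cF' continuous_on_subset by blast
  qed (use der in \<open>auto intro: has_field_derivative_at_within\<close>)
  then have "((\<lambda>s. integral (cbox l u) (F s)) has_real_derivative integral (cbox l u) (F' 0)) (at 0)"
    by (subst (asm) at_within_open) auto
  then have "((\<lambda>s. \<integral>a. F s a \<partial>lborel) has_real_derivative integral (cbox l u) (F' 0)) (at 0)"
    by (rule has_field_derivative_transform_within_open[where S = "{-1<..<1}"])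
       (use eq cF supp in auto)
  then show ?thesis using eq[OF cF'0] F'0 by simp
qed

lemma has_real_derivative_along_line:
  fixes \<Phi> :: "'a::real_normed_vector \<Rightarrow> real"
  assumes "\<And>z. ((\<lambda>s. \<Phi> (z + s *\<^sub>R v)) has_real_derivative \<Phi>' z) (at 0)"
  shows "((\<lambda>s. \<Phi> (z + s *\<^sub>R v)) has_real_derivative \<Phi>' (z + s *\<^sub>R v)) (at s)"
proof -
  have "((\<lambda>h. \<Phi> (z + (h + s) *\<^sub>R v)) has_real_derivative \<Phi>' (z + s *\<^sub>R v)) (at 0)"
    using assms[of "z + s *\<^sub>R v"] by (simp add: algebra_simps)
  then show ?thesis by (subst (asm) DERIV_shift[symmetric]) simp
qed

lemma nn_integral_translation:
  fixes f :: "'a::euclidean_space \<Rightarrow> ennreal"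
  assumes [measurable]: "f \<in> borel_measurable borel"
  shows "(\<integral>\<^sup>+z. f (z + y) \<partial>lborel) = (\<integral>\<^sup>+z. f z \<partial>lborel)"
proof -
  have "(\<integral>\<^sup>+z. f z \<partial>lborel) = (\<integral>\<^sup>+z. f z \<partial>distr lborel borel ((+) y))"
    by (simp add: lborel_distr_plus)
  also have "\<dots> = (\<integral>\<^sup>+z. f (z + y) \<partial>lborel)"
    by (subst nn_integral_distr) (auto simp: add.commute)
  finally show ?thesis by simp
qed

lemma integral_translation:
  fixes f :: "'a::euclidean_space \<Rightarrow> real"
  assumes [measurable]: "f \<in> borel_measurable borel"
  shows "(\<integral>z. f (z + y) \<partial>lborel) = (\<integral>z. f z \<partial>lborel)"
proof -
  have "(\<integral>z. f z \<partial>lborel) = (\<integral>z. f z \<partial>distr lborel borel ((+) y))"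
    by (simp add: lborel_distr_plus)
  also have "\<dots> = (\<integral>z. f (z + y) \<partial>lborel)"
    by (subst integral_distr) (auto simp: add.commute)
  finally show ?thesis by simp
qed

text \<open>Translation invariance makes \<open>s \<mapsto> \<integral> \<Phi>(z + s v) dz\<close> constant, so its derivative vanishes.
  This is integration by parts in its simplest form and avoids iterated integrals.\<close>

lemma integral_directional_derivative_eq_0:
  fixes \<Phi> \<Phi>' :: "'a::euclidean_space \<Rightarrow> real"
  assumes der: "\<And>z. ((\<lambda>s. \<Phi> (z + s *\<^sub>R v)) has_real_derivative \<Phi>' z) (at 0)"
    and c: "continuous_on UNIV \<Phi>" and c': "continuous_on UNIV \<Phi>'"
    and supp: "\<And>z. norm z \<ge> R \<Longrightarrow> \<Phi> z = 0"
  shows "(\<integral>z. \<Phi>' z \<partial>lborel) = 0"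
proof -
  have "((\<lambda>s. \<integral>a. \<Phi> (a + s *\<^sub>R v) \<partial>lborel) has_real_derivative (\<integral>a. \<Phi>' (a + 0 *\<^sub>R v) \<partial>lborel)) (at 0)"
  proof (rule integral_parametric_derivative[where R = "R + norm v"])
    show "((\<lambda>s. \<Phi> (a + s *\<^sub>R v)) has_real_derivative \<Phi>' (a + s *\<^sub>R v)) (at s)" for s a
      by (rule has_real_derivative_along_line[OF der])
    show "continuous_on UNIV (\<lambda>a. \<Phi> (a + s *\<^sub>R v))" for s
      by (rule continuous_on_compose2[OF c]) (auto intro!: continuous_intros)
    show "continuous_on UNIV (\<lambda>(s, a). \<Phi>' (a + s *\<^sub>R v))"
      unfolding case_prod_beta by (rule continuous_on_compose2[OF c']) (auto intro!: continuous_intros)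
    fix s :: real and a :: 'a assume *: "\<bar>s\<bar> < 1" "norm a \<ge> R + norm v"
    have "norm (s *\<^sub>R v) \<le> norm v" using *(1) by (simp add: mult_left_le_one_le)
    then have "norm (a + s *\<^sub>R v) \<ge> R" using *(2) norm_diff_ineq[of a "s *\<^sub>R v"] by linarith
    then show "\<Phi> (a + s *\<^sub>R v) = 0" by (rule supp)
  qed
  moreover have "(\<integral>a. \<Phi> (a + s *\<^sub>R v) \<partial>lborel) = (\<integral>a. \<Phi> a \<partial>lborel)" for s
    by (rule integral_translation) (use c borel_measurable_continuous_onI in blast)
  ultimately show ?thesis using DERIV_unique[OF _ DERIV_const] by fastforce
qed

section \<open>Continuity of translations in Lebesgue spaces\<close>

text \<open>Let \<open>K \<subseteq> A \<subseteq> T\<close> with \<open>K\<close> compact, \<open>T\<close> open and \<open>T - K\<close> of small measure. A translation that is shorter than the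
  distance of \<open>K\<close> from the complement of \<open>T\<close> can change membership in \<open>A\<close> only for points which lie in
  \<open>T - K\<close> before or after it.\<close>

lemma translation_continuous_L1_indicator:
  fixes A :: "'a::euclidean_space set"
  assumes A: "A \<in> sets borel" "emeasure lborel A < \<infinity>" and "e > 0"
  shows "\<exists>d>0. \<forall>y. norm y \<le> d \<longrightarrow>
    (\<integral>\<^sup>+z. ennreal \<bar>indicator A (z + y) - indicator A z\<bar> \<partial>lborel) \<le> ennreal e"
proof -
  define B where "B k = A - cball 0 (real k)" for k
  have "(\<lambda>k. emeasure lborel (B k)) \<longlonglongrightarrow> emeasure lborel (\<Inter>k. B k)"
  proof (rule Lim_emeasure_decseq)
    show "decseq B" unfolding B_def decseq_def
      by (auto simp: dist_norm)
    have "emeasure lborel (B k) \<le> emeasure lborel A" for k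
      using A by (intro emeasure_mono) (auto simp: B_def)
    then show "emeasure lborel (B k) \<noteq> \<infinity>" for k using A(2) by (metis infinity_ennreal_def linorder_not_less top.not_eq_extremum)
  qed (use A in \<open>auto simp: B_def\<close>)
  moreover have "(\<Inter>k. B k) = {}"
    using real_arch_simple by (auto simp: B_def dist_norm)
  ultimately have "(\<lambda>k. emeasure lborel (B k)) \<longlonglongrightarrow> 0" by simp
  then have "\<forall>\<^sub>F k in sequentially. emeasure lborel (B k) < ennreal (e/6)"
    using \<open>e > 0\<close> by (intro order_tendstoD) auto
  then obtain k where k: "emeasure lborel (B k) < ennreal (e/6)" by (auto simp: eventually_sequentially)
  define A1 where "A1 = A \<inter> cball 0 (real k)"
  have A1: "A1 \<in> sets lebesgue" "A \<in> sets lebesgue" using A unfolding A1_def by auto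
  obtain K where K: "closed K" "K \<subseteq> A1" "emeasure lebesgue (A1 - K) < ennreal (e/6)"
    using sets_lebesgue_inner_closed[OF A1(1), of "e/6"] \<open>e > 0\<close> by (metis divide_pos_pos zero_less_numeral)
  obtain T where T: "open T" "A \<subseteq> T" "emeasure lebesgue (T - A) < ennreal (e/6)"
    using sets_lebesgue_outer_open[OF A1(2), of "e/6"] \<open>e > 0\<close> by (metis divide_pos_pos zero_less_numeral)
  have [measurable]: "K \<in> sets borel" "T \<in> sets borel" "A \<in> sets borel" using K T A by auto
  have "compact K" using K unfolding A1_def
    by (meson bounded_cball bounded_subset compact_eq_bounded_closed inf.boundedE)
  moreover have "K \<subseteq> T" using K T A1_def by auto
  ultimately obtain d where d: "d > 0" "(\<Union>x\<in>K. cball x d) \<subseteq> T"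
    using T(1) compact_subset_open_imp_cball_epsilon_subset by metis
  have "emeasure lborel (T - K) \<le> emeasure lborel ((T - A) \<union> B k \<union> (A1 - K))"
    using A by (intro emeasure_mono) (auto simp: B_def A1_def)
  also have "\<dots> \<le> emeasure lborel (T - A) + emeasure lborel (B k) + emeasure lborel (A1 - K)"
    by (intro order_trans[OF emeasure_subadditive] add_mono order_refl)
       (auto simp: B_def A1_def)
  also have "\<dots> \<le> ennreal (e/6) + ennreal (e/6) + ennreal (e/6)"
    using K(3) T(3) k by (intro add_mono) (auto simp: A1_def)
  also have "\<dots> = ennreal (e/2)" using \<open>e > 0\<close> by (simp flip: ennreal_plus)
  finally have m: "emeasure lborel (T - K) \<le> ennreal (e/2)" .
  show ?thesis
  proof (intro exI[of _ d] conjI allI impI)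
    fix y :: 'a assume y: "norm y \<le> d"
    have "ennreal \<bar>indicator A (z + y) - indicator A z\<bar>
        \<le> indicator (T - K) (z + y) + indicator (T - K) z" for z
    proof -
      have "z + y \<in> T" if "z \<in> K" using d(2) that y by (force simp: dist_norm)
      moreover have "z \<in> T" if "z + y \<in> K" using d(2) that y by (force simp: dist_norm)
      ultimately show ?thesis using K(2) T(2) unfolding A1_def
        by (auto simp: indicator_def)
    qed
    then have "(\<integral>\<^sup>+z. ennreal \<bar>indicator A (z + y) - indicator A z\<bar> \<partial>lborel)
       \<le> (\<integral>\<^sup>+z. indicator (T - K) (z + y) + indicator (T - K) z \<partial>lborel)"
      by (intro nn_integral_mono) auto
    also have "\<dots> = (\<integral>\<^sup>+z. indicator (T - K) (z + y) \<partial>lborel) + (\<integral>\<^sup>+z. indicator (T - K) z \<partial>lborel)"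
      by (rule nn_integral_add) measurable
    also have "\<dots> = emeasure lborel (T - K) + emeasure lborel (T - K)"
      by (subst nn_integral_translation) auto
    also have "\<dots> \<le> ennreal (e/2) + ennreal (e/2)" using m by (intro add_mono)
    also have "\<dots> = ennreal e" using \<open>e > 0\<close> by (simp flip: ennreal_plus)
    finally show "(\<integral>\<^sup>+z. ennreal \<bar>indicator A (z + y) - indicator A z\<bar> \<partial>lborel) \<le> ennreal e" .
  qed (rule d(1))
qed

text \<open>The property passes to sums and to dominated limits, and therefore from indicators to all integrable
  functions.\<close>

lemma translation_continuous_L1:
  fixes f :: "'a::euclidean_space \<Rightarrow> real"
  assumes "integrable lborel f" and "e > 0"
  shows "\<exists>d>0. \<forall>y. norm y \<le> d \<longrightarrow> (\<integral>\<^sup>+z. ennreal \<bar>f (z + y) - f z\<bar> \<partial>lborel) \<le> ennreal e"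
  using assms
proof (induction f arbitrary: e rule: integrable_induct)
  case (base A c)
  then have A: "A \<in> sets borel" "emeasure lborel A < \<infinity>" by auto
  have "e / (\<bar>c\<bar> + 1) > 0" using base by auto
  from translation_continuous_L1_indicator[OF A this] obtain d where d: "d > 0"
    "\<And>y. norm y \<le> d \<Longrightarrow> (\<integral>\<^sup>+z. ennreal \<bar>indicator A (z + y) - indicator A z\<bar> \<partial>lborel) \<le> ennreal (e / (\<bar>c\<bar> + 1))"
    by auto
  have [measurable]: "A \<in> sets borel" by fact
  show ?case
  proof (intro exI[of _ d] conjI allI impI)
    fix y :: 'a assume "norm y \<le> d"
    have "\<bar>indicat_real A (z + y) *\<^sub>R c - indicat_real A z *\<^sub>R c\<bar> = \<bar>c\<bar> * \<bar>indicator A (z + y) - indicator A z\<bar>" for z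
      by (auto simp: indicator_def)
    then have "(\<integral>\<^sup>+z. ennreal \<bar>indicat_real A (z + y) *\<^sub>R c - indicat_real A z *\<^sub>R c\<bar> \<partial>lborel)
      = ennreal \<bar>c\<bar> * (\<integral>\<^sup>+z. ennreal \<bar>indicator A (z + y) - indicator A z\<bar> \<partial>lborel)"
      by (simp add: ennreal_mult nn_integral_cmult)
    also have "\<dots> \<le> ennreal \<bar>c\<bar> * ennreal (e / (\<bar>c\<bar> + 1))"
      by (intro mult_left_mono d) (use \<open>norm y \<le> d\<close> in auto)
    also have "\<dots> = ennreal (\<bar>c\<bar> * (e / (\<bar>c\<bar> + 1)))" using base by (subst ennreal_mult) auto
    also have "\<dots> \<le> ennreal e" using base by (intro ennreal_leI) (simp add: field_simps)
    finally show "(\<integral>\<^sup>+z. ennreal \<bar>indicat_real A (z + y) *\<^sub>R c - indicat_real A z *\<^sub>R c\<bar> \<partial>lborel) \<le> ennreal e" .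
  qed (rule d(1))
next
  case (add f g)
  have [measurable]: "f \<in> borel_measurable borel" "g \<in> borel_measurable borel"
    using borel_measurable_integrable[OF add.hyps(1)] borel_measurable_integrable[OF add.hyps(2)] by simp_all
  have "e/2 > 0" using add by auto
  obtain d1 where d1: "d1 > 0"
    "\<And>y. norm y \<le> d1 \<Longrightarrow> (\<integral>\<^sup>+z. ennreal \<bar>f (z + y) - f z\<bar> \<partial>lborel) \<le> ennreal (e/2)"
    using add.IH(1)[OF \<open>e/2 > 0\<close>] by blast
  obtain d2 where d2: "d2 > 0"
    "\<And>y. norm y \<le> d2 \<Longrightarrow> (\<integral>\<^sup>+z. ennreal \<bar>g (z + y) - g z\<bar> \<partial>lborel) \<le> ennreal (e/2)"
    using add.IH(2)[OF \<open>e/2 > 0\<close>] by blast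
  show ?case
  proof (intro exI[of _ "min d1 d2"] conjI allI impI)
    fix y :: 'a assume y: "norm y \<le> min d1 d2"
    have "(\<integral>\<^sup>+z. ennreal \<bar>f (z + y) + g (z + y) - (f z + g z)\<bar> \<partial>lborel)
       \<le> (\<integral>\<^sup>+z. ennreal \<bar>f (z + y) - f z\<bar> + ennreal \<bar>g (z + y) - g z\<bar> \<partial>lborel)"
      by (intro nn_integral_mono) (auto simp flip: ennreal_plus intro!: ennreal_leI)
    also have "\<dots> = (\<integral>\<^sup>+z. ennreal \<bar>f (z + y) - f z\<bar> \<partial>lborel) + (\<integral>\<^sup>+z. ennreal \<bar>g (z + y) - g z\<bar> \<partial>lborel)"
      by (rule nn_integral_add) measurable
    also have "\<dots> \<le> ennreal (e/2) + ennreal (e/2)" using y by (intro add_mono d1 d2) auto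
    also have "\<dots> = ennreal e" using add.prems by (simp flip: ennreal_plus)
    finally show "(\<integral>\<^sup>+z. ennreal \<bar>f (z + y) + g (z + y) - (f z + g z)\<bar> \<partial>lborel) \<le> ennreal e" .
  qed (use d1 d2 in auto)
next
  case (lim f s)
  have [measurable]: "f \<in> borel_measurable borel" "\<And>i. s i \<in> borel_measurable borel"
    using borel_measurable_integrable[OF lim.hyps(4)] borel_measurable_integrable[OF lim.hyps(1)] by simp_all
  have "(\<lambda>i. \<integral>\<^sup>+z. ennreal \<bar>s i z - f z\<bar> \<partial>lborel) \<longlonglongrightarrow> (\<integral>\<^sup>+z. 0 \<partial>(lborel :: 'a measure))"
  proof (rule nn_integral_dominated_convergence[where w = "\<lambda>z. ennreal (3 * \<bar>f z\<bar>)"])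
    show "AE z in lborel. ennreal \<bar>s i z - f z\<bar> \<le> ennreal (3 * \<bar>f z\<bar>)" for i
    proof (rule AE_I2, rule ennreal_leI)
      fix z show "\<bar>s i z - f z\<bar> \<le> 3 * \<bar>f z\<bar>"
        using lim.hyps(3)[of z i] by auto
    qed
    have "integrable lborel (\<lambda>z. 3 * \<bar>f z\<bar>)" using lim.hyps(4) by auto
    then show "(\<integral>\<^sup>+ z. ennreal (3 * \<bar>f z\<bar>) \<partial>lborel) < \<infinity>"
      by (subst nn_integral_eq_integral) auto
    show "AE z in lborel. (\<lambda>i. ennreal \<bar>s i z - f z\<bar>) \<longlonglongrightarrow> 0"
    proof (rule AE_I2)
      fix z :: 'a
      have "(\<lambda>i. \<bar>s i z - f z\<bar>) \<longlonglongrightarrow> \<bar>f z - f z\<bar>"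
        using lim.hyps(2)[of z] by (intro tendsto_intros) auto
      then show "(\<lambda>i. ennreal \<bar>s i z - f z\<bar>) \<longlonglongrightarrow> 0"
        using tendsto_ennrealI by fastforce
    qed
  qed measurable
  then have "\<forall>\<^sub>F i in sequentially. (\<integral>\<^sup>+z. ennreal \<bar>s i z - f z\<bar> \<partial>lborel) < ennreal (e/3)"
    using lim.prems by (intro order_tendstoD) auto
  then obtain i where i: "(\<integral>\<^sup>+z. ennreal \<bar>s i z - f z\<bar> \<partial>lborel) < ennreal (e/3)"
    by (auto simp: eventually_sequentially)
  have "e/3 > 0" using lim.prems by auto
  from lim.IH[OF this, of i] obtain d where d: "d > 0"
    "\<And>y. norm y \<le> d \<Longrightarrow> (\<integral>\<^sup>+z. ennreal \<bar>s i (z + y) - s i z\<bar> \<partial>lborel) \<le> ennreal (e/3)" by auto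
  show ?case
  proof (intro exI[of _ d] conjI allI impI)
    fix y :: 'a assume y: "norm y \<le> d"
    have "(\<integral>\<^sup>+z. ennreal \<bar>f (z + y) - f z\<bar> \<partial>lborel)
       \<le> (\<integral>\<^sup>+z. (ennreal \<bar>s i (z + y) - f (z + y)\<bar> + ennreal \<bar>s i (z + y) - s i z\<bar>) + ennreal \<bar>s i z - f z\<bar> \<partial>lborel)"
      by (intro nn_integral_mono) (auto simp flip: ennreal_plus intro!: ennreal_leI)
    also have "\<dots> = (\<integral>\<^sup>+z. (ennreal \<bar>s i (z + y) - f (z + y)\<bar> + ennreal \<bar>s i (z + y) - s i z\<bar>) \<partial>lborel)
        + (\<integral>\<^sup>+z. ennreal \<bar>s i z - f z\<bar> \<partial>lborel)"
      by (rule nn_integral_add) measurable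
    also have "(\<integral>\<^sup>+z. (ennreal \<bar>s i (z + y) - f (z + y)\<bar> + ennreal \<bar>s i (z + y) - s i z\<bar>) \<partial>lborel)
      = (\<integral>\<^sup>+z. ennreal \<bar>s i (z + y) - f (z + y)\<bar> \<partial>lborel) + (\<integral>\<^sup>+z. ennreal \<bar>s i (z + y) - s i z\<bar> \<partial>lborel)"
      by (rule nn_integral_add) measurable
    also have "(\<integral>\<^sup>+z. ennreal \<bar>s i (z + y) - f (z + y)\<bar> \<partial>lborel) = (\<integral>\<^sup>+z. ennreal \<bar>s i z - f z\<bar> \<partial>lborel)"
      by (rule nn_integral_translation[where f = "\<lambda>z. ennreal \<bar>s i z - f z\<bar>"]) measurable
    also have "(\<integral>\<^sup>+z. ennreal \<bar>s i z - f z\<bar> \<partial>lborel) + (\<integral>\<^sup>+z. ennreal \<bar>s i (z + y) - s i z\<bar> \<partial>lborel)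
        + (\<integral>\<^sup>+z. ennreal \<bar>s i z - f z\<bar> \<partial>lborel) \<le> ennreal (e/3) + ennreal (e/3) + ennreal (e/3)"
      using y i by (intro add_mono d) auto
    also have "\<dots> = ennreal e" using lim.prems by (simp flip: ennreal_plus)
    finally show "(\<integral>\<^sup>+z. ennreal \<bar>f (z + y) - f z\<bar> \<partial>lborel) \<le> ennreal e" .
  qed (rule d(1))
qed

lemma powr_superadditive:
  fixes a b :: real
  assumes "p \<ge> 1" "0 \<le> b" "b \<le> a"
  shows "(a - b) powr p \<le> a powr p - b powr p"
proof (cases "a = 0")
  case False
  with assms have a: "a > 0" by auto
  have le: "x powr p \<le> x" if "0 \<le> x" "x \<le> 1" for x :: real
    using powr_mono'[OF assms(1) that] that by simp
  have "(b/a) powr p + ((a - b)/a) powr p \<le> b/a + (a-b)/a"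
    using a assms by (intro add_mono le) (auto simp: field_simps)
  also have "\<dots> = 1" using a by (simp add: field_simps)
  finally show ?thesis using a assms by (simp add: powr_divide field_simps)
qed (use assms in auto)

lemma abs_diff_powr_le_signed_powr:
  fixes a b :: real
  assumes "p \<ge> 1"
  shows "\<bar>a - b\<bar> powr p \<le> 2 powr p * \<bar>sgn a * \<bar>a\<bar> powr p - sgn b * \<bar>b\<bar> powr p\<bar>"
proof -
  have same: "(a - b) powr p \<le> 2 powr p * (a powr p - b powr p)" if "0 \<le> b" "b \<le> a" for a b :: real
  proof -
    have "a powr p - b powr p \<ge> 0" using that assms by (simp add: powr_mono2)
    moreover have "2 powr p \<ge> (1::real)" using assms by (simp add: ge_one_powr_ge_zero)
    ultimately have "1 * (a powr p - b powr p) \<le> 2 powr p * (a powr p - b powr p)"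
      by (intro mult_right_mono)
    with powr_superadditive[OF assms that] show ?thesis by (simp only: mult_1)
  qed
  have opp: "(a + b) powr p \<le> 2 powr p * (a powr p + b powr p)" if "0 \<le> b" "b \<le> a" for a b :: real
  proof -
    have "(a + b) powr p \<le> (2 * a) powr p" using that assms by (intro powr_mono2) auto
    also have "\<dots> = 2 powr p * a powr p" using that by (simp add: powr_mult)
    also have "\<dots> \<le> 2 powr p * (a powr p + b powr p)" by (intro mult_left_mono) auto
    finally show ?thesis .
  qed
  have opp': "(a + b) powr p \<le> 2 powr p * (a powr p + b powr p)" if "0 \<le> b" "0 \<le> a" for a b :: real
    using opp[of b a] opp[of a b] that by (cases "b \<le> a") (simp_all add: add.commute)
  have pos: "sgn x * \<bar>x\<bar> powr p = x powr p" if "x \<ge> 0" for x :: real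
    using that by (cases "x = 0") auto
  have neg: "sgn x * \<bar>x\<bar> powr p = - ((-x) powr p)" if "x \<le> 0" for x :: real
    using that by (cases "x = 0") auto
  have mono: "x powr p \<le> y powr p" if "0 \<le> x" "x \<le> y" for x y :: real
    using that assms by (intro powr_mono2) auto
  consider "0 \<le> b" "b \<le> a" | "0 \<le> a" "a \<le> b" | "b \<le> 0" "a \<le> b" | "a \<le> 0" "b \<le> a"
    | "a \<ge> 0" "b \<le> 0" | "a \<le> 0" "b \<ge> 0" by linarith
  then show ?thesis
  proof cases
    case 1
    have *: "0 \<le> a" using 1 by linarith
    have "\<bar>sgn a * \<bar>a\<bar> powr p - sgn b * \<bar>b\<bar> powr p\<bar> = a powr p - b powr p"
      unfolding pos[OF *] pos[OF 1(1)] using mono[OF 1] by linarith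
    moreover have "\<bar>a - b\<bar> = a - b" using 1 by linarith
    ultimately show ?thesis using same[OF 1] by metis
  next
    case 2
    have *: "0 \<le> b" using 2 by linarith
    have "\<bar>sgn a * \<bar>a\<bar> powr p - sgn b * \<bar>b\<bar> powr p\<bar> = b powr p - a powr p"
      unfolding pos[OF *] pos[OF 2(1)] using mono[OF 2] by linarith
    moreover have "\<bar>a - b\<bar> = b - a" using 2 by linarith
    ultimately show ?thesis using same[OF 2] by metis
  next
    case 3
    have *: "a \<le> 0" "0 \<le> -b" "-b \<le> -a" using 3 by linarith+
    have "\<bar>sgn a * \<bar>a\<bar> powr p - sgn b * \<bar>b\<bar> powr p\<bar> = (-a) powr p - (-b) powr p"
      unfolding neg[OF *(1)] neg[OF 3(1)] using mono[OF *(2,3)] by linarith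
    moreover have "\<bar>a - b\<bar> = (-a) - (-b)" using 3 by linarith
    ultimately show ?thesis using same[OF *(2,3)] by metis
  next
    case 4
    have *: "b \<le> 0" "0 \<le> -a" "-a \<le> -b" using 4 by linarith+
    have "\<bar>sgn a * \<bar>a\<bar> powr p - sgn b * \<bar>b\<bar> powr p\<bar> = (-b) powr p - (-a) powr p"
      unfolding neg[OF *(1)] neg[OF 4(1)] using mono[OF *(2,3)] by linarith
    moreover have "\<bar>a - b\<bar> = (-b) - (-a)" using 4 by linarith
    ultimately show ?thesis using same[OF *(2,3)] by metis
  next
    case 5
    have *: "0 \<le> -b" using 5 by linarith
    have "\<bar>sgn a * \<bar>a\<bar> powr p - sgn b * \<bar>b\<bar> powr p\<bar> = a powr p + (-b) powr p"
      unfolding pos[OF 5(1)] neg[OF 5(2)] using powr_ge_zero[of a p] powr_ge_zero[of "-b" p] by linarith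
    moreover have "\<bar>a - b\<bar> = a + (-b)" using 5 by linarith
    ultimately show ?thesis using opp'[OF * 5(1)] by metis
  next
    case 6
    have *: "0 \<le> -a" using 6 by linarith
    have "\<bar>sgn a * \<bar>a\<bar> powr p - sgn b * \<bar>b\<bar> powr p\<bar> = b powr p + (-a) powr p"
      unfolding neg[OF 6(1)] pos[OF 6(2)] using powr_ge_zero[of b p] powr_ge_zero[of "-a" p] by linarith
    moreover have "\<bar>a - b\<bar> = b + (-a)" using 6 by linarith
    ultimately show ?thesis using opp'[OF * 6(2)] by metis
  qed
qed

text \<open>The signed power turns an \<open>L\<^sup>p\<close> function into an integrable one and controls
  \<open>\<bar>a - b\<bar>\<^sup>p\<close>, which reduces the claim to the case \<open>p = 1\<close>.\<close>

lemma translation_continuous_Lp: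
  fixes f :: "'a::euclidean_space \<Rightarrow> real"
  assumes "p \<ge> 1" and [measurable]: "f \<in> borel_measurable borel"
    and f: "integrable lborel (\<lambda>z. \<bar>f z\<bar> powr p)" and "e > 0"
  shows "\<exists>d>0. \<forall>y. norm y \<le> d \<longrightarrow> (\<integral>\<^sup>+z. ennreal (\<bar>f (z + y) - f z\<bar> powr p) \<partial>lborel) \<le> ennreal e"
proof -
  define g where "g z = sgn (f z) * \<bar>f z\<bar> powr p" for z
  have [measurable]: "g \<in> borel_measurable borel" unfolding g_def by measurable
  have "integrable lborel g"
    by (rule Bochner_Integration.integrable_bound[OF f]) (auto simp: g_def abs_mult sgn_if)
  moreover have "e / 2 powr p > 0" using \<open>e > 0\<close> by simp
  ultimately obtain d where d: "d > 0"
     "\<And>y. norm y \<le> d \<Longrightarrow> (\<integral>\<^sup>+z. ennreal \<bar>g (z + y) - g z\<bar> \<partial>lborel) \<le> ennreal (e / 2 powr p)"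
    using translation_continuous_L1 by blast
  show ?thesis
  proof (intro exI[of _ d] conjI allI impI)
    fix y :: 'a assume y: "norm y \<le> d"
    have "(\<integral>\<^sup>+z. ennreal (\<bar>f (z + y) - f z\<bar> powr p) \<partial>lborel)
        \<le> (\<integral>\<^sup>+z. ennreal (2 powr p) * ennreal \<bar>g (z + y) - g z\<bar> \<partial>lborel)"
      unfolding g_def using abs_diff_powr_le_signed_powr[OF assms(1)]
      by (intro nn_integral_mono) (auto simp flip: ennreal_mult intro!: ennreal_leI)
    also have "\<dots> = ennreal (2 powr p) * (\<integral>\<^sup>+z. ennreal \<bar>g (z + y) - g z\<bar> \<partial>lborel)"
      by (rule nn_integral_cmult) measurable
    also have "\<dots> \<le> ennreal (2 powr p) * ennreal (e / 2 powr p)"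
      using y by (intro mult_left_mono d) auto
    also have "\<dots> = ennreal e" using \<open>e > 0\<close> by (simp flip: ennreal_mult)
    finally show "(\<integral>\<^sup>+z. ennreal (\<bar>f (z + y) - f z\<bar> powr p) \<partial>lborel) \<le> ennreal e" .
  qed (rule d(1))
qed

section \<open>Mollification\<close>

text \<open>The second argument selects the space on which the integral is taken.\<close>

definition bump_mass :: "real \<Rightarrow> 'a::euclidean_space itself \<Rightarrow> real" where
  "bump_mass r T = (\<integral>a. bump r (0::'a) a \<partial>lborel)"

definition mol :: "real \<Rightarrow> 'a::euclidean_space \<Rightarrow> 'a \<Rightarrow> real" where
  "mol r z a = bump r z a / bump_mass r TYPE('a)"

definition dmol :: "real \<Rightarrow> 'a::euclidean_space \<Rightarrow> 'a \<Rightarrow> 'a \<Rightarrow> real" where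
  "dmol r v z a = dbump r v z a / bump_mass r TYPE('a)"

definition mollify :: "real \<Rightarrow> ('a::euclidean_space \<Rightarrow> real) \<Rightarrow> 'a \<Rightarrow> real" where
  "mollify r f z = (\<integral>a. f a * mol r z a \<partial>lborel)"

text \<open>The derivative of \<open>mollify r f\<close> in the direction \<open>v\<close>. It falls on the kernel, as a function of its centre,
  so that \<open>f\<close> may be merely continuous.\<close>

definition mollify_deriv :: "real \<Rightarrow> 'a::euclidean_space \<Rightarrow> ('a \<Rightarrow> real) \<Rightarrow> 'a \<Rightarrow> real" where
  "mollify_deriv r v f z = (\<integral>a. f a * dmol r v a z \<partial>lborel)"

lemma integrable_bump: "r > 0 \<Longrightarrow> integrable lborel (bump r (z::'a::euclidean_space))"
proof (rule integrable_continuous_bounded_support[where R = "norm z + r"])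
  show "continuous_on UNIV (bump r z)" by (intro continuous_intros)
  fix a :: 'a assume "r > 0" "norm a \<ge> norm z + r"
  moreover have "norm a \<le> norm z + dist z a" by (simp add: dist_norm norm_triangle_sub norm_minus_commute)
  ultimately show "bump r z a = 0" using bump_eq_0_iff[of r z a] by linarith
qed

lemma bump_mass_pos: assumes "r > 0" shows "bump_mass r TYPE('a::euclidean_space) > 0"
proof -
  have "bump_mass r TYPE('a) \<noteq> 0"
  proof
    assume "bump_mass r TYPE('a) = 0"
    then have "AE a in lborel. bump r (0::'a) a = 0"
      using integral_nonneg_eq_0_iff_AE[OF integrable_bump[OF assms, of "0::'a"]] bump_nonneg
      unfolding bump_mass_def by auto
    then have "AE a in lborel. a \<notin> ball (0::'a) r"
      by (rule AE_mp) (auto simp: bump_eq_0_iff[OF assms])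
    then have "ball (0::'a) r \<in> null_sets lborel"
      by (subst AE_iff_null_sets) auto
    then have "measure lborel (ball (0::'a) r) = 0" by (simp add: measure_eq_0_null_sets)
    then show False using content_ball_pos[OF assms, of "0::'a"] by simp
  qed
  moreover have "bump_mass r TYPE('a) \<ge> 0"
    unfolding bump_mass_def by (intro integral_nonneg_AE) (auto simp: bump_nonneg)
  ultimately show ?thesis by linarith
qed

lemma mol_nonneg: "r > 0 \<Longrightarrow> mol r z a \<ge> 0"
  unfolding mol_def by (intro divide_nonneg_pos bump_nonneg bump_mass_pos)

lemma mol_commute: "mol r z a = mol r a z" by (simp add: mol_def bump_commute)

lemma dmol_commute: "dmol r v z a = - dmol r v a z"
  unfolding dmol_def by (subst dbump_commute) simp

lemma mol_eq_0: "r > 0 \<Longrightarrow> r \<le> dist z a \<Longrightarrow> mol r z a = 0"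
  by (simp add: mol_def bump_eq_0_iff)

lemma dmol_eq_0: "r > 0 \<Longrightarrow> r \<le> dist z a \<Longrightarrow> dmol r v z a = 0"
  by (simp add: dmol_def dbump_eq_0)

lemma mol_translate: "mol r z (z + y) = mol r 0 y"
  by (simp add: mol_def bump_def)

lemma continuous_on_mol [continuous_intros]:
  "continuous_on S f \<Longrightarrow> continuous_on S g \<Longrightarrow> continuous_on S (\<lambda>x. mol r (f x) (g x))"
  unfolding mol_def by (cases "bump_mass r TYPE('b) = 0") (auto intro!: continuous_intros)

lemma continuous_on_dmol [continuous_intros]:
  "continuous_on S f \<Longrightarrow> continuous_on S g \<Longrightarrow> continuous_on S (\<lambda>x. dmol r v (f x) (g x))"
  unfolding dmol_def by (cases "bump_mass r TYPE('b) = 0") (auto intro!: continuous_intros)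

lemma mol_has_derivative: "(mol r z has_derivative (\<lambda>v. dmol r v z a)) (at a)"
proof -
  have "((\<lambda>a. bump r z a * (1 / bump_mass r TYPE('a))) has_derivative
     (\<lambda>v. dbump r v z a * (1 / bump_mass r TYPE('a)))) (at a)"
    by (rule has_derivative_mult_left[OF bump_has_derivative])
  then show ?thesis by (simp add: mol_def[abs_def] dmol_def)
qed

lemma frechet_derivative_mol: "frechet_derivative (mol r z) (at a) = (\<lambda>v. dmol r v z a)"
  using frechet_derivative_at[OF mol_has_derivative, symmetric] .

lemma test_fun_mol:
  fixes z :: "'a::euclidean_space"
  assumes "r > 0" "cball z r \<subseteq> S"
  shows "test_fun S (mol r z)"
proof -
  have m: "mol r z = (\<lambda>a. bump r z a * (1 / bump_mass r TYPE('a)))" by (auto simp: mol_def)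
  have "{a. mol r z a \<noteq> 0} = {a. bump r z a \<noteq> 0}"
    using bump_mass_pos[OF assms(1), where 'a = 'a] by (auto simp: mol_def)
  then show ?thesis
    using test_fun_bump[OF assms] Ck_fun_mult[OF _ Ck_fun_const, of _ "bump r z" "1 / bump_mass r TYPE('a)"]
    unfolding test_fun_def by (simp add: m)
qed

lemma integral_mol: "r > 0 \<Longrightarrow> (\<integral>a. mol r (0::'a::euclidean_space) a \<partial>lborel) = 1"
  using bump_mass_pos[of r, where 'a = 'a] by (simp add: mol_def bump_mass_def)

lemma mol_bounded:
  assumes "r > 0" obtains C where "\<And>z a. \<bar>mol r (z::'a::euclidean_space) a\<bar> \<le> C"
proof -
  have "bounded (mol r (0::'a) ` cball 0 r)"
    by (intro compact_imp_bounded compact_continuous_image continuous_intros compact_cball)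
  then obtain C where C: "\<And>y. y \<in> cball 0 r \<Longrightarrow> \<bar>mol r (0::'a) y\<bar> \<le> C"
    unfolding bounded_iff by (metis image_eqI real_norm_def)
  have "\<bar>mol r z a\<bar> \<le> max C 0" for z a :: 'a
    using C[of "a - z"] mol_translate[of r z "a - z"] mol_eq_0[OF assms, of 0 "a - z"]
    by (cases "norm (a - z) \<le> r") (auto simp: dist_norm norm_minus_commute intro: le_max_iff_disj[THEN iffD2])
  then show ?thesis using that by blast
qed

lemma dmol_bounded:
  assumes "r > 0" obtains C where "\<And>z a. \<bar>dmol r v (z::'a::euclidean_space) a\<bar> \<le> C"
proof -
  have tr: "dmol r v z (z + y) = dmol r v 0 y" for z y :: 'a by (simp add: dmol_def dbump_def)
  have "bounded (dmol r v (0::'a) ` cball 0 r)"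
    by (intro compact_imp_bounded compact_continuous_image continuous_intros compact_cball)
  then obtain C where C: "\<And>y. y \<in> cball 0 r \<Longrightarrow> \<bar>dmol r v (0::'a) y\<bar> \<le> C"
    unfolding bounded_iff by (metis image_eqI real_norm_def)
  have "\<bar>dmol r v z a\<bar> \<le> max C 0" for z a :: 'a
    using C[of "a - z"] tr[of z "a - z"] dmol_eq_0[OF assms, of 0 "a - z" v]
    by (cases "norm (a - z) \<le> r") (auto simp: dist_norm norm_minus_commute intro: le_max_iff_disj[THEN iffD2])
  then show ?thesis using that by blast
qed

lemma dist_ge_if_norm_ge:
  fixes z a :: "'a::real_normed_vector"
  assumes "norm a \<ge> R + r" "norm z \<le> R" shows "r \<le> dist z a"
  using assms norm_triangle_ineq2[of a z] by (simp add: dist_norm norm_minus_commute)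

lemma mollify_has_derivative_along_line:
  fixes g :: "'a::euclidean_space \<Rightarrow> real"
  assumes g: "continuous_on UNIV g" and r: "r > 0"
  shows "((\<lambda>s. mollify r g (z + s *\<^sub>R v)) has_real_derivative mollify_deriv r v g z) (at 0)"
proof -
  have "((\<lambda>s. \<integral>a. g a * mol r (z + s *\<^sub>R v) a \<partial>lborel) has_real_derivative
      (\<integral>a. g a * dmol r v a (z + 0 *\<^sub>R v) \<partial>lborel)) (at 0)"
  proof (rule integral_parametric_derivative[where R = "(norm z + norm v) + r"])
    fix s a
    have "((\<lambda>s. mol r a (z + s *\<^sub>R v)) has_derivative (\<lambda>h. dmol r (h *\<^sub>R v) a (z + s *\<^sub>R v))) (at s)"
      by (rule has_derivative_compose[OF _ mol_has_derivative])
         (auto intro!: derivative_eq_intros)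
    moreover have "(\<lambda>h. dmol r (h *\<^sub>R v) a (z + s *\<^sub>R v)) = (*) (dmol r v a (z + s *\<^sub>R v))"
      by (auto simp: dmol_def dbump_def)
    ultimately have "((\<lambda>s. mol r a (z + s *\<^sub>R v)) has_real_derivative dmol r v a (z + s *\<^sub>R v)) (at s)"
      by (simp add: has_field_derivative_def)
    then show "((\<lambda>s. g a * mol r (z + s *\<^sub>R v) a) has_real_derivative g a * dmol r v a (z + s *\<^sub>R v)) (at s)"
      unfolding mol_commute[of r "z + _" a] by (rule DERIV_cmult)
  next
    show "continuous_on UNIV (\<lambda>a. g a * mol r (z + s *\<^sub>R v) a)" for s
      by (intro continuous_intros g)
    show "continuous_on UNIV (\<lambda>(s, a). g a * dmol r v a (z + s *\<^sub>R v))"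
      unfolding case_prod_beta
      by (intro continuous_intros continuous_on_compose2[OF g]) auto
    fix s :: real and a :: 'a assume *: "\<bar>s\<bar> < 1" "norm a \<ge> norm z + norm v + r"
    have "norm (s *\<^sub>R v) \<le> norm v" using *(1) by (simp add: mult_left_le_one_le)
    then have "norm (z + s *\<^sub>R v) \<le> norm z + norm v" using norm_triangle_ineq[of z "s *\<^sub>R v"] by linarith
    then have "r \<le> dist (z + s *\<^sub>R v) a" using *(2) dist_ge_if_norm_ge by blast
    then show "g a * mol r (z + s *\<^sub>R v) a = 0" by (simp add: mol_eq_0 r)
  qed
  then show ?thesis by (simp add: mollify_def mollify_deriv_def)
qed

lemma continuous_on_parametric_integral:
  fixes g :: "'a::euclidean_space \<Rightarrow> real" and k :: "'a \<Rightarrow> 'a \<Rightarrow> real"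
  assumes g: "continuous_on UNIV g" and k: "continuous_on UNIV (\<lambda>(z, a). k z a)"
    and supp: "\<And>z a. r \<le> dist z a \<Longrightarrow> k z a = 0"
  shows "continuous_on UNIV (\<lambda>z. \<integral>a. g a * k z a \<partial>lborel)"
proof -
  have "continuous_on (ball 0 R) (\<lambda>z. \<integral>a. g a * k z a \<partial>lborel)" for R
  proof -
    obtain l u :: 'a where lu: "\<And>f. (\<And>a. norm a \<ge> R + r \<Longrightarrow> f a = (0::real)) \<Longrightarrow> (\<lambda>a. indicator (cbox l u) a *\<^sub>R f a) = f"
      using cbox_containing_support[of "R + r"] by metis
    have gk: "continuous_on UNIV (\<lambda>(z, a). g a * k z a)"
      using k unfolding case_prod_beta by (intro continuous_intros continuous_on_compose2[OF g]) auto
    have eq: "(\<integral>a. g a * k z a \<partial>lborel) = integral (cbox l u) (\<lambda>a. g a * k z a)" if z: "z \<in> ball 0 R" for z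
    proof -
      have 0: "g a * k z a = 0" if "norm a \<ge> R + r" for a
        using supp[OF dist_ge_if_norm_ge[OF that, of z]] z by simp
      have "continuous_on UNIV (\<lambda>a. g a * k z a)"
        using continuous_on_compose2[OF gk, of UNIV "\<lambda>a. (z, a)"]
        by (simp add: continuous_on_Pair[OF continuous_on_const continuous_on_id])
      then have "set_integrable lborel (cbox l u) (\<lambda>a. g a * k z a)"
        unfolding set_integrable_def
        by (intro borel_integrable_compact) (auto intro: continuous_on_subset)
      from set_borel_integral_eq_integral(2)[OF this] show ?thesis
        by (simp only: set_lebesgue_integral_def lu[OF 0])
    qed
    have "continuous_on (ball 0 R) (\<lambda>z. integral (cbox l u) (\<lambda>a. g a * k z a))"
      by (intro integral_continuous_on_param continuous_on_subset[OF gk]) auto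
    then show ?thesis by (rule continuous_on_eq) (use eq in auto)
  qed
  then have "continuous_on (\<Union>R. ball 0 R) (\<lambda>z. \<integral>a. g a * k z a \<partial>lborel)"
    by (intro continuous_on_open_UN) auto
  moreover have "(\<Union>R. ball 0 R) = (UNIV :: 'a set)" by (auto intro: gt_ex)
  ultimately show ?thesis by simp
qed

lemma continuous_on_mollify: "continuous_on UNIV g \<Longrightarrow> r > 0 \<Longrightarrow> continuous_on UNIV (mollify r g)"
  unfolding mollify_def[abs_def]
  by (rule continuous_on_parametric_integral[where r = r])
     (auto simp: case_prod_beta mol_eq_0 intro!: continuous_intros)

lemma continuous_on_mollify_deriv: "continuous_on UNIV g \<Longrightarrow> r > 0 \<Longrightarrow> continuous_on UNIV (mollify_deriv r v g)"
  unfolding mollify_deriv_def[abs_def]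
  by (rule continuous_on_parametric_integral[where r = r])
     (auto simp: case_prod_beta dmol_eq_0 dist_commute intro!: continuous_intros)

lemma integrable_mult_bounded:
  fixes F k :: "'a::euclidean_space \<Rightarrow> real"
  assumes "integrable lborel F" "k \<in> borel_measurable borel" "\<And>a. \<bar>k a\<bar> \<le> C"
  shows "integrable lborel (\<lambda>a. F a * k a)"
proof (rule Bochner_Integration.integrable_bound)
  show "integrable lborel (\<lambda>a. C * \<bar>F a\<bar>)" using assms(1) by auto
  show "(\<lambda>a. F a * k a) \<in> borel_measurable lborel" using assms by measurable
  show "AE a in lborel. norm (F a * k a) \<le> norm (C * \<bar>F a\<bar>)"
  proof (rule AE_I2)
    fix a show "norm (F a * k a) \<le> norm (C * \<bar>F a\<bar>)"
      using mult_right_mono[OF order_trans[OF assms(3)[of a] abs_ge_self[of C]], of "\<bar>F a\<bar>"]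
      by (simp add: abs_mult mult.commute)
  qed
qed

text \<open>Fubini's theorem in the form that moves the mollification from one factor to the other.\<close>

lemma integral_kernel_swap:
  fixes \<zeta> F :: "'a::euclidean_space \<Rightarrow> real" and k :: "'a \<Rightarrow> 'a \<Rightarrow> real"
  assumes z: "integrable lborel \<zeta>" and F: "integrable lborel F"
    and k: "continuous_on UNIV (\<lambda>(z, a). k z a)" and C: "\<And>z a. \<bar>k z a\<bar> \<le> C"
  shows "(\<integral>z. \<zeta> z * (\<integral>a. F a * k z a \<partial>lborel) \<partial>lborel) = (\<integral>a. F a * (\<integral>z. \<zeta> z * k z a \<partial>lborel) \<partial>lborel)"
proof -
  have [measurable]: "\<zeta> \<in> borel_measurable borel" "F \<in> borel_measurable borel"
    using z F borel_measurable_integrable by fastforce+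
  have [measurable]: "(\<lambda>(z, a). k z a) \<in> borel_measurable (lborel \<Otimes>\<^sub>M lborel)"
    using borel_measurable_continuous_onI[OF k] by (simp add: lborel_prod)
  have 1: "integrable (lborel \<Otimes>\<^sub>M lborel) (\<lambda>(z, a). \<zeta> z * F a)"
    by (rule lborel_pair.Fubini_integrable) (use z F in \<open>auto simp: abs_mult\<close>)
  have "integrable (lborel \<Otimes>\<^sub>M lborel) (\<lambda>(z, a). (\<zeta> z * F a) * k z a)"
  proof (rule Bochner_Integration.integrable_bound)
    show "integrable (lborel \<Otimes>\<^sub>M lborel) (\<lambda>x. C * \<bar>case x of (z, a) \<Rightarrow> \<zeta> z * F a\<bar>)" using 1 by auto
    show "AE x in lborel \<Otimes>\<^sub>M lborel. norm (case x of (z, a) \<Rightarrow> \<zeta> z * F a * k z a) \<le> norm (C * \<bar>case x of (z, a) \<Rightarrow> \<zeta> z * F a\<bar>)"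
    proof (rule AE_I2, clarify)
      fix z a show "norm (\<zeta> z * F a * k z a) \<le> norm (C * \<bar>\<zeta> z * F a\<bar>)"
        using mult_right_mono[OF order_trans[OF C[of z a] abs_ge_self[of C]], of "\<bar>\<zeta> z * F a\<bar>"]
        by (simp add: abs_mult mult_ac)
    qed
  qed measurable
  then have i: "integrable (lborel \<Otimes>\<^sub>M lborel) (\<lambda>(z, a). \<zeta> z * (F a * k z a))"
    by (simp add: mult.assoc)
  have "(\<integral>z. \<zeta> z * (\<integral>a. F a * k z a \<partial>lborel) \<partial>lborel) = (\<integral>z. (\<integral>a. \<zeta> z * (F a * k z a) \<partial>lborel) \<partial>lborel)"
    by simp
  also have "\<dots> = (\<integral>a. (\<integral>z. \<zeta> z * (F a * k z a) \<partial>lborel) \<partial>lborel)"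
    by (rule lborel_pair.Fubini_integral[OF i, symmetric])
  also have "\<dots> = (\<integral>a. F a * (\<integral>z. \<zeta> z * k z a \<partial>lborel) \<partial>lborel)"
    by (simp add: mult.left_commute)
  finally show ?thesis .
qed

lemma mollify_eq_translation:
  fixes f :: "'a::euclidean_space \<Rightarrow> real"
  assumes [measurable]: "f \<in> borel_measurable borel"
  shows "mollify r f z = (\<integral>y. f (z + y) * mol r 0 y \<partial>lborel)"
proof -
  have [measurable]: "mol r z \<in> borel_measurable borel"
    by (intro borel_measurable_continuous_onI continuous_intros)
  have "(\<integral>y. f (y + z) * mol r z (y + z) \<partial>lborel) = mollify r f z"
    unfolding mollify_def by (rule integral_translation) measurable
  moreover have "mol r z (y + z) = mol r 0 y" for y by (simp only: add.commute[of y] mol_translate)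
  ultimately show ?thesis by (simp add: add.commute)
qed

lemma mollify_close:
  fixes g :: "'a::euclidean_space \<Rightarrow> real"
  assumes r: "r > 0" and g: "continuous_on UNIV g" and close: "\<And>y. norm y \<le> r \<Longrightarrow> \<bar>g (z + y) - g z\<bar> \<le> e"
  shows "\<bar>mollify r g z - g z\<bar> \<le> e"
proof -
  have im: "integrable lborel (mol r (0::'a))"
    using integrable_bump[OF r, of "0::'a"] by (auto simp: mol_def[abs_def])
  have ig: "integrable lborel (\<lambda>y. g (z + y) * mol r 0 y)"
    by (rule integrable_continuous_bounded_support[where R = r])
       (auto intro!: continuous_intros continuous_on_compose2[OF g] simp: mol_eq_0[OF r])
  have e: "\<bar>(g (z + y) - g z) * mol r 0 y\<bar> \<le> e * mol r 0 y" for y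
    using close[of y] mol_nonneg[OF r, of 0 y] mol_eq_0[OF r, of 0 y]
    by (cases "norm y \<le> r") (auto simp: abs_mult intro!: mult_right_mono)
  have "mollify r g z - g z = (\<integral>y. g (z + y) * mol r 0 y \<partial>lborel) - g z * (\<integral>y. mol r (0::'a) y \<partial>lborel)"
    using borel_measurable_continuous_onI[OF g] by (simp add: mollify_eq_translation integral_mol[OF r])
  also have "\<dots> = (\<integral>y. (g (z + y) - g z) * mol r 0 y \<partial>lborel)"
    using im ig by (simp add: left_diff_distrib)
  finally have "\<bar>mollify r g z - g z\<bar> = \<bar>\<integral>y. (g (z + y) - g z) * mol r 0 y \<partial>lborel\<bar>" by simp
  also have "\<dots> \<le> (\<integral>y. \<bar>(g (z + y) - g z) * mol r 0 y\<bar> \<partial>lborel)" by (rule integral_abs_bound)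
  also have "\<dots> \<le> (\<integral>y. e * mol r (0::'a) y \<partial>lborel)"
  proof (rule integral_mono)
    show "integrable lborel (\<lambda>y. \<bar>(g (z + y) - g z) * mol r 0 y\<bar>)"
      using im ig by (intro integrable_abs) (simp add: left_diff_distrib)
  qed (use im e in auto)
  also have "\<dots> = e" using integral_mol[OF r, where 'a='a] by simp
  finally show ?thesis .
qed

lemma mult_le_powr_sum:
  fixes a b :: real
  assumes "p > 1" "q > 1" "1/p + 1/q = 1" "a \<ge> 0" "b \<ge> 0"
  shows "a * b \<le> a powr p + b powr q"
proof -
  have "a powr p / p \<le> a powr p" "b powr q / q \<le> b powr q"
    using assms(1,2) by (auto simp: divide_le_eq mult_left_le intro: order_trans[OF _ mult_left_mono[of 1]])
  then show ?thesis using Youngs_inequality[OF assms] by linarith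
qed

lemma translation_continuous_product:
  fixes F H :: "'a::euclidean_space \<Rightarrow> real"
  assumes pq: "p > 1" "q > 1" "1/p + 1/q = 1"
    and [measurable]: "F \<in> borel_measurable borel" "H \<in> borel_measurable borel"
    and F: "integrable lborel (\<lambda>z. \<bar>F z\<bar> powr p)" and H: "integrable lborel (\<lambda>z. \<bar>H z\<bar> powr q)"
    and e: "e > 0"
  shows "\<exists>d>0. \<forall>y y'. norm y \<le> d \<longrightarrow> norm y' \<le> d \<longrightarrow>
    (\<integral>\<^sup>+z. ennreal \<bar>F (z + y) * H (z + y') - F z * H z\<bar> \<partial>lborel) \<le> ennreal e"
proof -
  define A where "A = (\<integral>z. \<bar>F z\<bar> powr p \<partial>lborel)"
  define B where "B = (\<integral>z. \<bar>H z\<bar> powr q \<partial>lborel)"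
  have A: "(\<integral>\<^sup>+z. ennreal (\<bar>F z\<bar> powr p) \<partial>lborel) = ennreal A" "A \<ge> 0"
    using nn_integral_eq_integral[OF F] unfolding A_def by auto
  have B: "(\<integral>\<^sup>+z. ennreal (\<bar>H z\<bar> powr q) \<partial>lborel) = ennreal B" "B \<ge> 0"
    using nn_integral_eq_integral[OF H] unfolding B_def by auto
  \<comment> \<open>Both products are split by Young's inequality with the factor \<open>\<tau>\<close> on the factor that does
    not become small.\<close>
  define \<tau> where "\<tau> = min 1 (e / (4 * (A + B + 1)))"
  have t: "\<tau> > 0" "\<tau> \<le> 1" using A B e by (auto simp: \<tau>_def)
  have tle: "\<tau> powr x \<le> \<tau>" if "x > 1" for x
    using powr_mono'[of 1 x \<tau>] t that by simp
  have tA: "\<tau> * A \<le> e/4" and tB: "\<tau> * B \<le> e/4"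
  proof -
    have "\<tau> * (A + B + 1) \<le> e / (4 * (A + B + 1)) * (A + B + 1)"
      using A B by (intro mult_right_mono) (auto simp: \<tau>_def)
    also have "\<dots> = e/4" using A B by (simp add: field_simps)
    finally have "\<tau> * (A + B + 1) \<le> e/4" .
    moreover have "\<tau> * A \<ge> 0" "\<tau> * B \<ge> 0" using t A B by auto
    ultimately show "\<tau> * A \<le> e/4" "\<tau> * B \<le> e/4" using t by (auto simp: algebra_simps)
  qed
  define eF where "eF = (e/4) * \<tau> powr p"
  define eH where "eH = (e/4) * \<tau> powr q"
  have eFH: "eF > 0" "eH > 0" using e t by (auto simp: eF_def eH_def)
  obtain d1 where d1: "d1 > 0" "\<And>y. norm y \<le> d1 \<Longrightarrow> (\<integral>\<^sup>+z. ennreal (\<bar>F (z + y) - F z\<bar> powr p) \<partial>lborel) \<le> ennreal eF"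
    using translation_continuous_Lp[of p F eF] pq F eFH by auto
  obtain d2 where d2: "d2 > 0" "\<And>y. norm y \<le> d2 \<Longrightarrow> (\<integral>\<^sup>+z. ennreal (\<bar>H (z + y) - H z\<bar> powr q) \<partial>lborel) \<le> ennreal eH"
    using translation_continuous_Lp[of q H eH] pq H eFH by auto
  show ?thesis
  proof (intro exI[of _ "min d1 d2"] conjI allI impI)
    fix y y' :: 'a assume y: "norm y \<le> min d1 d2" "norm y' \<le> min d1 d2"
    let ?a = "\<lambda>z. ennreal (\<tau> powr (-p)) * ennreal (\<bar>F (z + y) - F z\<bar> powr p)"
    let ?b = "\<lambda>z. ennreal (\<tau> powr q) * ennreal (\<bar>H (z + y')\<bar> powr q)"
    let ?c = "\<lambda>z. ennreal (\<tau> powr p) * ennreal (\<bar>F z\<bar> powr p)"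
    let ?d = "\<lambda>z. ennreal (\<tau> powr (-q)) * ennreal (\<bar>H (z + y') - H z\<bar> powr q)"
    have "ennreal \<bar>F (z + y) * H (z + y') - F z * H z\<bar> \<le> (?a z + ?b z) + (?c z + ?d z)" for z
    proof -
      have "\<bar>F (z + y) * H (z + y') - F z * H z\<bar>
          = \<bar>(F (z + y) - F z) * H (z + y') + F z * (H (z + y') - H z)\<bar>" by (simp add: algebra_simps)
      also have "\<dots> \<le> \<bar>F (z + y) - F z\<bar> * \<bar>H (z + y')\<bar> + \<bar>F z\<bar> * \<bar>H (z + y') - H z\<bar>"
        by (metis abs_mult abs_triangle_ineq)
      also have "\<bar>F (z + y) - F z\<bar> * \<bar>H (z + y')\<bar> = (\<bar>F (z + y) - F z\<bar> / \<tau>) * (\<tau> * \<bar>H (z + y')\<bar>)" using t by simp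
      also have "\<dots> \<le> (\<bar>F (z + y) - F z\<bar> / \<tau>) powr p + (\<tau> * \<bar>H (z + y')\<bar>) powr q"
        using t by (intro mult_le_powr_sum pq) auto
      also have "\<bar>F z\<bar> * \<bar>H (z + y') - H z\<bar> = (\<tau> * \<bar>F z\<bar>) * (\<bar>H (z + y') - H z\<bar> / \<tau>)" using t by simp
      also have "\<dots> \<le> (\<tau> * \<bar>F z\<bar>) powr p + (\<bar>H (z + y') - H z\<bar> / \<tau>) powr q"
        using t by (intro mult_le_powr_sum pq) auto
      finally have "\<bar>F (z + y) * H (z + y') - F z * H z\<bar> \<le>
          (\<tau> powr (-p) * \<bar>F (z + y) - F z\<bar> powr p + \<tau> powr q * \<bar>H (z + y')\<bar> powr q)
         + (\<tau> powr p * \<bar>F z\<bar> powr p + \<tau> powr (-q) * \<bar>H (z + y') - H z\<bar> powr q)"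
        using t by (simp add: powr_divide powr_mult powr_minus_divide)
      then have "ennreal \<bar>F (z + y) * H (z + y') - F z * H z\<bar> \<le>
         ennreal ((\<tau> powr (-p) * \<bar>F (z + y) - F z\<bar> powr p + \<tau> powr q * \<bar>H (z + y')\<bar> powr q)
         + (\<tau> powr p * \<bar>F z\<bar> powr p + \<tau> powr (-q) * \<bar>H (z + y') - H z\<bar> powr q))"
        by (rule ennreal_leI)
      then show ?thesis by (simp add: ennreal_mult)
    qed
    then have "(\<integral>\<^sup>+z. ennreal \<bar>F (z + y) * H (z + y') - F z * H z\<bar> \<partial>lborel)
       \<le> (\<integral>\<^sup>+z. (?a z + ?b z) + (?c z + ?d z) \<partial>lborel)" by (intro nn_integral_mono) auto
    also have "\<dots> = (integral\<^sup>N lborel ?a + integral\<^sup>N lborel ?b) + (integral\<^sup>N lborel ?c + integral\<^sup>N lborel ?d)"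
      by (simp add: nn_integral_add)
    also have "\<dots> \<le> (ennreal (e/4) + ennreal (e/4)) + (ennreal (e/4) + ennreal (e/4))"
    proof (intro add_mono)
      have "integral\<^sup>N lborel ?a = ennreal (\<tau> powr (-p)) * (\<integral>\<^sup>+z. ennreal (\<bar>F (z + y) - F z\<bar> powr p) \<partial>lborel)"
        by (rule nn_integral_cmult) measurable
      also have "\<dots> \<le> ennreal (\<tau> powr (-p)) * ennreal eF" using y by (intro mult_left_mono d1) auto
      also have "\<dots> = ennreal (e/4)" using t eFH unfolding eF_def
        by (simp flip: ennreal_mult) (simp add: powr_minus field_simps)
      finally show "integral\<^sup>N lborel ?a \<le> ennreal (e/4)" .
      have "integral\<^sup>N lborel ?d = ennreal (\<tau> powr (-q)) * (\<integral>\<^sup>+z. ennreal (\<bar>H (z + y') - H z\<bar> powr q) \<partial>lborel)"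
        by (rule nn_integral_cmult) measurable
      also have "\<dots> \<le> ennreal (\<tau> powr (-q)) * ennreal eH" using y by (intro mult_left_mono d2) auto
      also have "\<dots> = ennreal (e/4)" using t eFH unfolding eH_def
        by (simp flip: ennreal_mult) (simp add: powr_minus field_simps)
      finally show "integral\<^sup>N lborel ?d \<le> ennreal (e/4)" .
      have "integral\<^sup>N lborel ?b = ennreal (\<tau> powr q) * (\<integral>\<^sup>+z. ennreal (\<bar>H (z + y')\<bar> powr q) \<partial>lborel)"
        by (rule nn_integral_cmult) measurable
      also have "\<dots> = ennreal (\<tau> powr q) * ennreal B"
        using nn_integral_translation[of "\<lambda>z. ennreal (\<bar>H z\<bar> powr q)" y'] B by simp
      also have "\<dots> = ennreal (\<tau> powr q * B)" using B by (simp add: ennreal_mult)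
      also have "\<dots> \<le> ennreal (e/4)"
        using tB mult_right_mono[OF tle[OF pq(2)] B(2)] by (intro ennreal_leI) linarith
      finally show "integral\<^sup>N lborel ?b \<le> ennreal (e/4)" .
      have "integral\<^sup>N lborel ?c = ennreal (\<tau> powr p) * (\<integral>\<^sup>+z. ennreal (\<bar>F z\<bar> powr p) \<partial>lborel)"
        by (rule nn_integral_cmult) measurable
      also have "\<dots> = ennreal (\<tau> powr p * A)" using A by (simp add: ennreal_mult)
      also have "\<dots> \<le> ennreal (e/4)"
        using tA mult_right_mono[OF tle[OF pq(1)] A(2)] by (intro ennreal_leI) linarith
      finally show "integral\<^sup>N lborel ?c \<le> ennreal (e/4)" .
    qed
    also have "\<dots> = ennreal e" using e by (simp flip: ennreal_plus)
    finally show "(\<integral>\<^sup>+z. ennreal \<bar>F (z + y) * H (z + y') - F z * H z\<bar> \<partial>lborel) \<le> ennreal e" .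
  qed (use d1 d2 in auto)
qed

lemma integrable_mult_mol:
  fixes f :: "'a::euclidean_space \<Rightarrow> real"
  assumes r: "r > 0" and p: "p \<ge> 1" and [measurable]: "f \<in> borel_measurable borel"
    and f: "integrable lborel (\<lambda>z. \<bar>f z\<bar> powr p)"
  shows "integrable lborel (\<lambda>y. f (z + y) * mol r 0 y)"
proof -
  obtain C where C: "\<And>z a. \<bar>mol r (z::'a) a\<bar> \<le> C" using mol_bounded[OF r] by metis
  have [measurable]: "mol r (0::'a) \<in> borel_measurable borel"
    by (intro borel_measurable_continuous_onI continuous_intros)
  have im: "integrable lborel (mol r (0::'a))"
    using integrable_bump[OF r, of "0::'a"] by (auto simp: mol_def[abs_def])
  have f': "integrable lborel (\<lambda>y. \<bar>f (z + y)\<bar> powr p)"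
    using f lborel_distr_plus[of z] integrable_distr_eq[of "(+) z" lborel borel "\<lambda>z. \<bar>f z\<bar> powr p"] by simp
  have "integrable lborel (\<lambda>y. \<bar>f (z + y)\<bar> powr p * mol r 0 y)"
    by (rule integrable_mult_bounded[OF f' _ C]) measurable
  from Bochner_Integration.integrable_add[OF im this]
  have i: "integrable lborel (\<lambda>y. (1 + \<bar>f (z + y)\<bar> powr p) * mol r 0 y)" by (simp add: algebra_simps)
  show ?thesis
  proof (rule Bochner_Integration.integrable_bound[OF i], measurable, rule AE_I2)
    fix y :: 'a
    have "\<bar>f (z + y)\<bar> \<le> 1 + \<bar>f (z + y)\<bar> powr p"
      using powr_mono[of 1 p "\<bar>f (z + y)\<bar>"] p powr_ge_zero[of "\<bar>f (z + y)\<bar>" p]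
      by (cases "\<bar>f (z + y)\<bar> \<le> 1") (simp_all del: powr_ge_zero)
    then show "norm (f (z + y) * mol r 0 y) \<le> norm ((1 + \<bar>f (z + y)\<bar> powr p) * mol r 0 y)"
      by (auto simp: abs_mult intro!: mult_right_mono)
  qed
qed

text \<open>With independent shifts in the two factors, the product of the mollified functions is an average of the
  products \<open>F(z + y) H(z + y')\<close>, and the preceding bound is uniform in both shifts.\<close>

lemma mollify_product_approximation:
  fixes F H :: "'a::euclidean_space \<Rightarrow> real"
  assumes pq: "p > 1" "q > 1" "1/p + 1/q = 1"
    and [measurable]: "F \<in> borel_measurable borel" "H \<in> borel_measurable borel"
    and F: "integrable lborel (\<lambda>z. \<bar>F z\<bar> powr p)" and H: "integrable lborel (\<lambda>z. \<bar>H z\<bar> powr q)"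
    and e: "e > 0"
  shows "\<exists>d>0. \<forall>r. 0 < r \<and> r \<le> d \<longrightarrow>
    (\<integral>\<^sup>+z. ennreal \<bar>mollify r F z * mollify r H z - F z * H z\<bar> \<partial>lborel) \<le> ennreal e"
proof -
  obtain d where d: "d > 0" "\<And>y y'. norm y \<le> d \<Longrightarrow> norm y' \<le> d \<Longrightarrow>
    (\<integral>\<^sup>+z. ennreal \<bar>F (z + y) * H (z + y') - F z * H z\<bar> \<partial>lborel) \<le> ennreal e"
    using translation_continuous_product[OF assms] by auto
  show ?thesis
  proof (intro exI[of _ d] conjI allI impI)
    fix r assume r: "0 < r \<and> r \<le> d"
    then have r0: "r > 0" by simp
    let ?m = "mol r (0::'a)"
    have [measurable]: "?m \<in> borel_measurable borel"
      by (intro borel_measurable_continuous_onI continuous_intros)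
    have im: "integrable lborel ?m"
      using integrable_bump[OF r0, of "0::'a"] by (auto simp: mol_def[abs_def])
    have nm: "(\<integral>\<^sup>+y. ennreal (?m y) \<partial>lborel) = 1"
      by (subst nn_integral_eq_integral[OF im]) (simp_all add: mol_nonneg[OF r0] integral_mol[OF r0])
    define K where "K z y y' = ennreal (?m y) * (ennreal (?m y') * ennreal \<bar>F (z + y) * H (z + y') - F z * H z\<bar>)" for z y y'
    have "ennreal \<bar>mollify r F z * mollify r H z - F z * H z\<bar> \<le> (\<integral>\<^sup>+y. \<integral>\<^sup>+y'. K z y y' \<partial>lborel \<partial>lborel)" for z
    proof -
      have iF: "integrable lborel (\<lambda>y. F (z + y) * ?m y)" and iH: "integrable lborel (\<lambda>y. H (z + y) * ?m y)"
        using integrable_mult_mol[OF r0 _ _ F] integrable_mult_mol[OF r0 _ _ H] pq by auto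
      have 1: "mollify r F z * mollify r H z - F z * H z
          = (\<integral>y. F (z + y) * ?m y * mollify r H z - F z * H z * ?m y \<partial>lborel)"
        using iF im by (simp add: mollify_eq_translation integral_mol[OF r0])
      have 2: "F (z + y) * ?m y * mollify r H z - F z * H z * ?m y
          = (\<integral>y'. ?m y * (?m y' * (F (z + y) * H (z + y') - F z * H z)) \<partial>lborel)" for y
      proof -
        have "F (z + y) * ?m y * mollify r H z - F z * H z * ?m y
          = (\<integral>y'. (F (z + y) * ?m y) * (H (z + y') * ?m y') - (F z * H z * ?m y) * ?m y' \<partial>lborel)"
          using iH im integral_mol[OF r0, where 'a='a] by (simp add: mollify_eq_translation)
        then show ?thesis by (simp add: algebra_simps)
      qed
      have "ennreal \<bar>mollify r F z * mollify r H z - F z * H z\<bar>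
         \<le> (\<integral>\<^sup>+y. ennreal \<bar>F (z + y) * ?m y * mollify r H z - F z * H z * ?m y\<bar> \<partial>lborel)"
        unfolding 1 using integral_norm_bound_ennreal[of lborel "\<lambda>y. F (z + y) * ?m y * mollify r H z - F z * H z * ?m y"] iF im
        by auto
      also have "\<dots> \<le> (\<integral>\<^sup>+y. \<integral>\<^sup>+y'. K z y y' \<partial>lborel \<partial>lborel)"
      proof (rule nn_integral_mono)
        fix y
        have "integrable lborel (\<lambda>y'. (F (z + y) * ?m y) * (H (z + y') * ?m y') - (F z * H z * ?m y) * ?m y')"
          using iH im by auto
        then have i: "integrable lborel (\<lambda>y'. ?m y * (?m y' * (F (z + y) * H (z + y') - F z * H z)))"
          by (simp add: algebra_simps)
        show "ennreal \<bar>F (z + y) * ?m y * mollify r H z - F z * H z * ?m y\<bar> \<le> (\<integral>\<^sup>+y'. K z y y' \<partial>lborel)"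
          unfolding 2 K_def using integral_norm_bound_ennreal[OF i] mol_nonneg[OF r0, of "0::'a"]
          by (simp add: abs_mult ennreal_mult)
      qed
      finally show ?thesis .
    qed
    then have "(\<integral>\<^sup>+z. ennreal \<bar>mollify r F z * mollify r H z - F z * H z\<bar> \<partial>lborel)
       \<le> (\<integral>\<^sup>+z. \<integral>\<^sup>+y. \<integral>\<^sup>+y'. K z y y' \<partial>lborel \<partial>lborel \<partial>lborel)" by (intro nn_integral_mono) auto
    also have "\<dots> = (\<integral>\<^sup>+y. \<integral>\<^sup>+z. \<integral>\<^sup>+y'. K z y y' \<partial>lborel \<partial>lborel \<partial>lborel)"
      by (rule lborel_pair.Fubini') (unfold K_def, measurable)
    also have "\<dots> = (\<integral>\<^sup>+y. \<integral>\<^sup>+y'. \<integral>\<^sup>+z. K z y y' \<partial>lborel \<partial>lborel \<partial>lborel)"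
      by (intro nn_integral_cong lborel_pair.Fubini') (unfold K_def, measurable)
    also have "\<dots> \<le> (\<integral>\<^sup>+y. \<integral>\<^sup>+y'. ennreal (?m y) * (ennreal (?m y') * ennreal e) \<partial>lborel \<partial>lborel)"
    proof (intro nn_integral_mono)
      fix y y' :: 'a
      have "(\<integral>\<^sup>+z. K z y y' \<partial>lborel) = ennreal (?m y) * (ennreal (?m y') * (\<integral>\<^sup>+z. ennreal \<bar>F (z + y) * H (z + y') - F z * H z\<bar> \<partial>lborel))"
        unfolding K_def by (simp add: nn_integral_cmult)
      also have "\<dots> \<le> ennreal (?m y) * (ennreal (?m y') * ennreal e)"
      proof (cases "norm y \<le> r \<and> norm y' \<le> r")
        case True
        then show ?thesis using r by (intro mult_left_mono d) auto
      next
        case False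
        then have "?m y = 0 \<or> ?m y' = 0" using mol_eq_0[OF r0, of "0::'a"] by (auto simp: not_le)
        then show ?thesis by auto
      qed
      finally show "(\<integral>\<^sup>+z. K z y y' \<partial>lborel) \<le> ennreal (?m y) * (ennreal (?m y') * ennreal e)" .
    qed
    also have "\<dots> = ennreal e"
      by (simp add: nn_integral_cmult nn_integral_multc nm)
    finally show "(\<integral>\<^sup>+z. ennreal \<bar>mollify r F z * mollify r H z - F z * H z\<bar> \<partial>lborel) \<le> ennreal e" .
  qed (rule d(1))
qed

section \<open>The comparison inequality behind monotone fluxes\<close>

lemma pos_part_power_has_derivative:
  "((\<lambda>x::real. (max 0 x) ^ Suc (Suc k)) has_real_derivative real (k + 2) * (max 0 x) ^ Suc k) (at x)"
proof -
  consider "x > 0" | "x < 0" | "x = 0" by linarith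
  then show ?thesis
  proof cases
    case 1
    have "((\<lambda>x::real. x ^ Suc (Suc k)) has_real_derivative real (k + 2) * (max 0 x) ^ Suc k) (at x)"
      using DERIV_pow[of "Suc (Suc k)" x] 1 by (simp add: max_def del: power_Suc)
    then show ?thesis
      by (rule has_field_derivative_transform_within_open[where S = "{0<..}"]) (use 1 in auto)
  next
    case 2
    have "((\<lambda>x::real. 0) has_real_derivative real (k + 2) * (max 0 x) ^ Suc k) (at x)"
      using 2 by (auto simp: max_def)
    then show ?thesis
      by (rule has_field_derivative_transform_within_open[where S = "{..<0}"]) (use 2 in auto)
  next
    case 3
    have "((\<lambda>h::real. (max 0 h) ^ Suc k) \<longlongrightarrow> (max 0 0) ^ Suc k) (at 0)"
      by (intro tendsto_intros)
    then have "((\<lambda>h::real. (max 0 h) ^ Suc k) \<longlongrightarrow> 0) (at 0)" by simp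
    then have "((\<lambda>h::real. ((max 0 (0 + h)) ^ Suc (Suc k) - (max 0 0) ^ Suc (Suc k)) / h) \<longlongrightarrow> 0) (at 0)"
      by (rule Lim_transform_eventually) (auto simp: eventually_at_filter max_def intro!: eventuallyI)
    then show ?thesis using 3 by (simp add: DERIV_def)
  qed
qed

lemma pos_part_power_chain:
  "(f has_real_derivative D) (at s) \<Longrightarrow>
   ((\<lambda>s. (max 0 (f s)) ^ Suc (Suc k)) has_real_derivative real (k + 2) * (max 0 (f s)) ^ Suc k * D) (at s)"
  by (rule DERIV_chain2[OF pos_part_power_has_derivative])

lemma integral_continuous_pos:
  fixes f :: "'a::euclidean_space \<Rightarrow> real"
  assumes c: "continuous_on UNIV f" and i: "integrable lborel f" and nn: "\<And>z. f z \<ge> 0" and z1: "f z1 > 0"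
  shows "(\<integral>z. f z \<partial>lborel) > 0"
proof -
  have "(\<integral>z. f z \<partial>lborel) \<noteq> 0"
  proof
    assume "(\<integral>z. f z \<partial>lborel) = 0"
    then have ae: "AE z in lborel. f z = 0"
      using integral_nonneg_eq_0_iff_AE[OF i] nn by auto
    have "open {z. f z > 0}" using open_Collect_less[OF continuous_on_const c] .
    then obtain d where d: "d > 0" "ball z1 d \<subseteq> {z. f z > 0}" using z1 unfolding open_contains_ball by auto
    have "AE z in lborel. z \<notin> ball z1 d" using ae by (rule AE_mp) (use d in \<open>auto simp: subset_iff intro!: AE_I2\<close>)
    then have "ball z1 d \<in> null_sets lborel" by (subst AE_iff_null_sets) auto
    then have "measure lborel (ball z1 d) = 0" by (simp add: measure_eq_0_null_sets)
    then show False using content_ball_pos[OF d(1), of z1] by simp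
  qed
  moreover have "(\<integral>z. f z \<partial>lborel) \<ge> 0" using nn by simp
  ultimately show ?thesis by linarith
qed

lemma integrable_powr_imp_integrable_product:
  fixes F H :: "'a::euclidean_space \<Rightarrow> real"
  assumes pq: "p > 1" "q > 1" "1/p + 1/q = 1"
    and [measurable]: "F \<in> borel_measurable borel" "H \<in> borel_measurable borel"
    and F: "integrable lborel (\<lambda>z. \<bar>F z\<bar> powr p)" and H: "integrable lborel (\<lambda>z. \<bar>H z\<bar> powr q)"
  shows "integrable lborel (\<lambda>z. F z * H z)"
  by (rule Bochner_Integration.integrable_bound[OF Bochner_Integration.integrable_add[OF F H]])
     (auto simp: abs_mult intro!: mult_le_powr_sum[OF pq])

text \<open>Formally, \<open>\<partial>\<^sub>t g \<le> div F\<close> with \<open>H\<close> the spatial gradient of \<open>g\<close> and \<open>F \<bullet> H \<ge> 0\<close>. The mollified inequality is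
  multiplied by \<open>\<zeta> = \<eta>(t) \<psi>(g\<^sub>r)\<close>, where \<open>\<psi>(s) = (s - 2 e)\<^sub>+\<^sup>2\<close> restricts to a superlevel set of \<open>g\<close> and
  \<open>\<eta>(t) = (T - t)\<^sub>+\<^sup>2\<close> removes the final time. Integration by parts in time produces a positive quantity
  bounded away from \<open>0\<close> if \<open>g\<close> exceeds \<open>3 e\<close> somewhere before the time \<open>T\<close>; in space it produces \<open>F \<bullet> H\<close> up to an error that
  vanishes with \<open>r\<close>.\<close>

lemma monotone_flux_comparison:
  fixes g :: "(real^'n) \<times> real \<Rightarrow> real" and F H :: "'n \<Rightarrow> (real^'n) \<times> real \<Rightarrow> real"
    and b :: "'n \<Rightarrow> (real^'n) \<times> real"
  defines "b \<equiv> \<lambda>i. (axis i 1, 0)"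
  assumes pq: "p > 1" "q > 1" "1/p + 1/q = 1"
    and g_cont: "continuous_on UNIV g" and g_ucont: "uniformly_continuous_on UNIV g"
    and g_bdd: "\<And>z. \<bar>g z\<bar> \<le> B"
    and Fm: "\<And>i. F i \<in> borel_measurable borel" and Hm: "\<And>i. H i \<in> borel_measurable borel"
    and Fp: "\<And>i. integrable lborel (\<lambda>z. \<bar>F i z\<bar> powr p)" and Hq: "\<And>i. integrable lborel (\<lambda>z. \<bar>H i z\<bar> powr q)"
    and F1: "\<And>i. integrable lborel (F i)"
    and mono: "AE z in lborel. (\<Sum>i\<in>UNIV. F i z * H i z) \<ge> 0"
    and S: "compact S" "S \<subseteq> V" and V: "open V"
    and e: "e > 0" and level: "\<And>z. snd z \<le> T \<Longrightarrow> g z \<ge> e \<Longrightarrow> z \<in> S"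
    and weak1: "\<And>\<phi>. test_fun V \<phi> \<Longrightarrow> (\<And>z. \<phi> z \<ge> 0) \<Longrightarrow>
       (\<Sum>i\<in>UNIV. \<integral>z. F i z * frechet_derivative \<phi> (at z) (b i) \<partial>lborel)
        - (\<integral>z. g z * frechet_derivative \<phi> (at z) (0, 1) \<partial>lborel) \<le> 0"
    and weak2: "\<And>\<phi> i. test_fun V \<phi> \<Longrightarrow>
       (\<integral>z. g z * frechet_derivative \<phi> (at z) (b i) \<partial>lborel) = - (\<integral>z. H i z * \<phi> z \<partial>lborel)"
    and z1: "snd z1 < T"
  shows "g z1 \<le> 3 * e"
proof (rule ccontr)
  assume "\<not> g z1 \<le> 3 * e"
  then have gz1: "g z1 > 3 * e" by simp
  note [measurable] = Fm Hm
  define \<psi> where "\<psi> s = (max 0 (s - 2 * e))\<^sup>2" for s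
  define \<psi>' where "\<psi>' s = 2 * max 0 (s - 2 * e)" for s
  define \<Psi> where "\<Psi> s = (max 0 (s - 2 * e)) ^ 3 / 3" for s
  define \<eta> where "\<eta> t = (max 0 (T - t))\<^sup>2" for t
  define \<eta>n where "\<eta>n t = 2 * max 0 (T - t)" for t
  have lin: "((\<lambda>s. s - 2 * e) has_real_derivative 1) (at s)" "((\<lambda>t. T - t) has_real_derivative - 1) (at s)" for s
    by (auto intro!: derivative_eq_intros)
  have psi_der: "(\<psi> has_real_derivative \<psi>' s) (at s)" for s
    using pos_part_power_chain[OF lin(1)[of s], of 0] by (simp add: \<psi>_def[abs_def] \<psi>'_def power2_eq_square)
  have Psi_der: "(\<Psi> has_real_derivative \<psi> s) (at s)" for s
    using DERIV_cdivide[OF pos_part_power_chain[OF lin(1)[of s], of 1], of 3]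
    by (simp add: \<Psi>_def[abs_def] \<psi>_def eval_nat_numeral)
  have eta_der: "(\<eta> has_real_derivative - \<eta>n t) (at t)" for t
    using pos_part_power_chain[OF lin(2)[of t], of 0] by (simp add: \<eta>_def[abs_def] \<eta>n_def power2_eq_square)
  have nn: "\<psi> s \<ge> 0" "\<psi>' s \<ge> 0" "\<Psi> s \<ge> 0" "\<eta> s \<ge> 0" "\<eta>n s \<ge> 0" for s
    by (auto simp: \<psi>_def \<psi>'_def \<Psi>_def \<eta>_def \<eta>n_def)
  have c_psi: "continuous_on A (\<lambda>x. \<psi> (f x))" "continuous_on A (\<lambda>x. \<psi>' (f x))" "continuous_on A (\<lambda>x. \<Psi> (f x))"
     "continuous_on A (\<lambda>x. \<eta> (f x))" "continuous_on A (\<lambda>x. \<eta>n (f x))" if "continuous_on A f"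
    for f and A :: "((real^'n) \<times> real) set"
    using that by (auto simp: \<psi>_def \<psi>'_def \<Psi>_def \<eta>_def \<eta>n_def intro!: continuous_intros)
  \<comment> \<open>\<open>J\<close> bounds the time term from below, whatever the radius of mollification\<close>
  define J where "J z = \<eta>n (snd z) * \<Psi> (g z - e)" for z
  obtain R where R: "R > 0" "\<And>z. z \<in> S \<Longrightarrow> norm z < R"
    using compact_imp_bounded[OF S(1)] unfolding bounded_pos_less by auto
  have JS: "z \<in> S" if "J z \<noteq> 0" for z
  proof (rule level)
    show "snd z \<le> T" using that by (auto simp: J_def \<eta>n_def max_def split: if_splits)
    show "g z \<ge> e" using that e by (auto simp: J_def \<Psi>_def max_def split: if_splits)
  qed
  have J0: "J z = 0" if "norm z \<ge> R" for z using JS[of z] R(2)[of z] that by fastforce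
  have cJ: "continuous_on UNIV J" unfolding J_def
    by (intro continuous_intros c_psi g_cont)
  have iJ: "integrable lborel J" by (rule integrable_continuous_bounded_support[OF cJ J0])
  define m where "m = (\<integral>z. J z \<partial>lborel)"
  have m: "m > 0" unfolding m_def
  proof (rule integral_continuous_pos[OF cJ iJ])
    show "J z \<ge> 0" for z unfolding J_def using nn by simp
    have "\<eta>n (snd z1) > 0" using z1 by (simp add: \<eta>n_def)
    moreover have "\<Psi> (g z1 - e) > 0" using gz1 by (simp add: \<Psi>_def)
    ultimately show "J z1 > 0" by (simp add: J_def)
  qed
  define M where "M = (\<bar>T\<bar> + R)\<^sup>2 * (2 * (\<bar>B\<bar> + e)) + 1"
  have M: "M > 0" unfolding M_def using e by (intro add_nonneg_pos mult_nonneg_nonneg) auto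
  define \<epsilon> where "\<epsilon> = m / (2 * M * CARD('n))"
  have eps: "\<epsilon> > 0" unfolding \<epsilon>_def using m M by simp
  \<comment> \<open>\<open>r\<close> is small enough for the product approximation, for the uniform continuity of \<open>g\<close>, and
    for the kernels centred in \<open>S\<close> to be supported in \<open>V\<close>\<close>
  have "\<forall>i. \<exists>d. d > 0 \<and> (\<forall>r. 0 < r \<and> r \<le> d \<longrightarrow>
    (\<integral>\<^sup>+z. ennreal \<bar>mollify r (F i) z * mollify r (H i) z - F i z * H i z\<bar> \<partial>lborel) \<le> ennreal \<epsilon>)"
    by (rule allI, rule mollify_product_approximation[OF pq _ _ Fp Hq eps]) measurable
  from choice[OF this] obtain d where d': "\<forall>i. d i > 0 \<and> (\<forall>r. 0 < r \<and> r \<le> d i \<longrightarrow>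
    (\<integral>\<^sup>+z. ennreal \<bar>mollify r (F i) z * mollify r (H i) z - F i z * H i z\<bar> \<partial>lborel) \<le> ennreal \<epsilon>)" ..
  have d: "d i > 0" "\<And>r. 0 < r \<Longrightarrow> r \<le> d i \<Longrightarrow>
    (\<integral>\<^sup>+z. ennreal \<bar>mollify r (F i) z * mollify r (H i) z - F i z * H i z\<bar> \<partial>lborel) \<le> ennreal \<epsilon>" for i
    using d'[rule_format, of i] by (simp_all del: of_nat_less_0_iff)
  obtain d1 where d1: "d1 > 0" "\<And>z z'. dist z' z < d1 \<Longrightarrow> \<bar>g z' - g z\<bar> < e"
    using g_ucont e unfolding uniformly_continuous_on_def by (auto simp: dist_real_def)
  obtain d2 where d2: "d2 > 0" "(\<Union>x\<in>S. cball x d2) \<subseteq> V"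
    using compact_subset_open_imp_cball_epsilon_subset[OF S(1) V S(2)] by auto
  define r where "r = Min (insert (d1/2) (insert d2 (range d)))"
  have r_le: "r \<le> x" if "x \<in> insert (d1/2) (insert d2 (range d))" for x
    unfolding r_def using that by (intro Min_le) auto
  have r: "r > 0" "r \<le> d1/2" "r \<le> d2" "\<And>i. r \<le> d i"
  proof -
    show "r > 0" unfolding r_def using d1 d2 d(1) by (subst Min_gr_iff) auto
  qed (rule r_le, blast)+
  define G where "G = mollify r g"
  have cG: "continuous_on UNIV G" unfolding G_def by (rule continuous_on_mollify[OF g_cont r(1)])
  have G_close: "\<bar>G z - g z\<bar> \<le> e" for z
    unfolding G_def
  proof (rule mollify_close[OF r(1) g_cont])
    fix y :: "(real^'n) \<times> real" assume "norm y \<le> r"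
    then have "dist (z + y) z < d1" using r(2) d1(1) by (simp add: dist_norm)
    then show "\<bar>g (z + y) - g z\<bar> \<le> e" using d1(2) by (simp add: less_imp_le)
  qed
  have G_der: "((\<lambda>s. G (z + s *\<^sub>R v)) has_real_derivative mollify_deriv r v g z) (at 0)" for z v
    unfolding G_def by (rule mollify_has_derivative_along_line[OF g_cont r(1)])
  have G_chain: "((\<lambda>s. f (G (z + s *\<^sub>R v))) has_real_derivative f' (G z) * mollify_deriv r v g z) (at 0)"
    if f: "\<And>s. (f has_real_derivative f' s) (at s)" for f f' z v
    by (rule DERIV_chain2[where g = "\<lambda>s. G (z + s *\<^sub>R v)" and x = 0, OF _ G_der]) (simp add: f)
  define \<zeta> where "\<zeta> z = \<eta> (snd z) * \<psi> (G z)" for z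
  define K where "K z = \<eta> (snd z) * \<psi>' (G z)" for z
  have inS: "z \<in> S" if "max 0 (T - snd z) \<noteq> 0" "max 0 (G z - 2 * e) \<noteq> 0" for z
  proof (rule level)
    show "snd z \<le> T" using that by (auto simp: max_def split: if_splits)
    show "g z \<ge> e" using that(2) G_close[of z] by (auto simp: max_def split: if_splits)
  qed
  have zS: "\<zeta> z \<noteq> 0 \<Longrightarrow> z \<in> S" and KS: "K z \<noteq> 0 \<Longrightarrow> z \<in> S"
    and PS: "\<eta> (snd z) * \<Psi> (G z) \<noteq> 0 \<Longrightarrow> z \<in> S" for z
    using inS[of z] by (auto simp: \<zeta>_def K_def \<eta>_def \<psi>_def \<psi>'_def \<Psi>_def)
  have z0: "\<zeta> z = 0" and K0: "K z = 0" and P0: "\<eta> (snd z) * \<Psi> (G z) = 0" if "norm z \<ge> R" for z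
    using zS[of z] KS[of z] PS[of z] R(2)[of z] that by fastforce+
  have cz: "continuous_on UNIV \<zeta>" unfolding \<zeta>_def by (intro continuous_intros c_psi cG)
  have cK: "continuous_on UNIV K" unfolding K_def by (intro continuous_intros c_psi cG)
  have iz: "integrable lborel \<zeta>" by (rule integrable_continuous_bounded_support[OF cz z0])
  have znn: "\<zeta> z \<ge> 0" and Knn: "K z \<ge> 0" for z unfolding \<zeta>_def K_def using nn by auto
  have Kle: "K z \<le> M" for z
  proof (cases "K z = 0")
    case False
    then have "norm z < R" using KS R by blast
    then have "\<bar>snd z\<bar> < R" using norm_snd_le[of "snd z" "fst z"] by simp
    then have 1: "\<eta> (snd z) \<le> (\<bar>T\<bar> + R)\<^sup>2" unfolding \<eta>_def by (intro power_mono) auto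
    have 2: "\<psi>' (G z) \<le> 2 * (\<bar>B\<bar> + e)"
      unfolding \<psi>'_def using G_close[of z] g_bdd[of z] e by (auto simp: max_def)
    have "K z \<le> (\<bar>T\<bar> + R)\<^sup>2 * (2 * (\<bar>B\<bar> + e))" unfolding K_def using 1 2 nn by (intro mult_mono) auto
    then show ?thesis unfolding M_def by simp
  qed (use M in simp)
  define \<zeta>d where "\<zeta>d i z = K z * mollify_deriv r (b i) g z" for i z
  have cdG: "continuous_on UNIV (mollify_deriv r v g)" for v by (rule continuous_on_mollify_deriv[OF g_cont r(1)])
  have zd_der: "((\<lambda>s. \<zeta> (z + s *\<^sub>R b i)) has_real_derivative \<zeta>d i z) (at 0)" for z i
  proof -
    have "((\<lambda>s. \<eta> (snd z) * \<psi> (G (z + s *\<^sub>R b i))) has_real_derivative \<eta> (snd z) * (\<psi>' (G z) * mollify_deriv r (b i) g z)) (at 0)"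
      by (rule DERIV_cmult[OF G_chain[OF psi_der]])
    then show ?thesis by (simp add: \<zeta>_def \<zeta>d_def K_def b_def mult_ac)
  qed
  have czd: "continuous_on UNIV (\<zeta>d i)" for i unfolding \<zeta>d_def by (intro continuous_intros cK cdG)
  have zd0: "\<zeta>d i z = 0" if "norm z \<ge> R" for i z unfolding \<zeta>d_def using K0[OF that] by simp
  have izd: "integrable lborel (\<zeta>d i)" for i by (rule integrable_continuous_bounded_support[OF czd zd0])
  \<comment> \<open>\<open>\<psi>(g\<^sub>r) \<partial>\<^sub>t g\<^sub>r\<close> is the time derivative of \<open>\<Psi>(g\<^sub>r)\<close>, so that the derivative can be moved to \<open>\<eta>\<close>\<close>
  have time: "(\<integral>z. \<zeta> z * mollify_deriv r (0, 1) g z \<partial>lborel) = (\<integral>z. \<eta>n (snd z) * \<Psi> (G z) \<partial>lborel)"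
  proof -
    let ?\<Phi>' = "\<lambda>z. - \<eta>n (snd z) * \<Psi> (G z) + \<zeta> z * mollify_deriv r (0, 1) g z"
    have cn: "continuous_on UNIV (\<lambda>z. \<eta>n (snd z) * \<Psi> (G z))" by (intro continuous_intros c_psi cG)
    have czt: "continuous_on UNIV (\<lambda>z. \<zeta> z * mollify_deriv r (0, 1) g z)" by (intro continuous_intros cz cdG)
    have n0: "\<eta>n (snd z) * \<Psi> (G z) = 0" if "norm z \<ge> R" for z
      using P0[OF that] by (auto simp: \<eta>n_def \<eta>_def)
    have in': "integrable lborel (\<lambda>z. \<eta>n (snd z) * \<Psi> (G z))"
      by (rule integrable_continuous_bounded_support[OF cn n0])
    have izt: "integrable lborel (\<lambda>z. \<zeta> z * mollify_deriv r (0, 1) g z)"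
      by (rule integrable_continuous_bounded_support[OF czt, where R = R]) (simp add: z0)
    have "(\<integral>z. ?\<Phi>' z \<partial>lborel) = 0"
    proof (rule integral_directional_derivative_eq_0[where v = "(0, 1)" and R = R])
      fix z
      have 1: "((\<lambda>s. \<Psi> (G (z + s *\<^sub>R (0, 1)))) has_real_derivative \<psi> (G z) * mollify_deriv r (0, 1) g z) (at 0)"
        by (rule G_chain[OF Psi_der])
      have 2: "((\<lambda>s. \<eta> (snd z + s)) has_real_derivative - \<eta>n (snd z)) (at 0)"
        using eta_der[of "snd z + 0"] DERIV_shift[of \<eta> "- \<eta>n (snd z)" 0 "snd z"] by (simp add: add.commute)
      show "((\<lambda>s. \<eta> (snd (z + s *\<^sub>R (0, 1))) * \<Psi> (G (z + s *\<^sub>R (0, 1)))) has_real_derivative ?\<Phi>' z) (at 0)"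
        using DERIV_mult[OF 2 1] by (simp add: \<zeta>_def mult_ac add.commute flip: zero_prod_def)
    next
      show "continuous_on UNIV (\<lambda>z. \<eta> (snd z) * \<Psi> (G z))" by (intro continuous_intros c_psi cG)
      show "continuous_on UNIV ?\<Phi>'" using continuous_on_add[OF continuous_on_minus[OF cn] czt] by simp
    qed (rule P0)
    then show ?thesis using in' izt by simp
  qed
  \<comment> \<open>the derivative passes from the kernel to \<open>\<zeta>\<close>, and then the kernel to \<open>F\<close>\<close>
  have space: "(\<integral>z. \<zeta> z * (\<integral>a. F i a * dmol r (b i) z a \<partial>lborel) \<partial>lborel) = (\<integral>z. \<zeta>d i z * mollify r (F i) z \<partial>lborel)" for i
  proof -
    obtain C where C: "\<And>z a. \<bar>dmol r (b i) (z::(real^'n) \<times> real) a\<bar> \<le> C" using dmol_bounded[OF r(1)] by metis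
    obtain C' where C': "\<And>z a. \<bar>mol r (z::(real^'n) \<times> real) a\<bar> \<le> C'" using mol_bounded[OF r(1)] by metis
    have parts: "(\<integral>z. \<zeta> z * dmol r (b i) z a \<partial>lborel) = (\<integral>z. \<zeta>d i z * mol r z a \<partial>lborel)" for a
    proof -
      have c1: "continuous_on UNIV (\<lambda>z. \<zeta> z * dmol r (b i) z a)" by (intro continuous_intros cz)
      have c2: "continuous_on UNIV (\<lambda>z. \<zeta>d i z * mol r z a)" by (intro continuous_intros czd)
      have i1: "integrable lborel (\<lambda>z. \<zeta> z * dmol r (b i) z a)"
        by (rule integrable_continuous_bounded_support[OF c1, where R = R]) (simp add: z0)
      have i2: "integrable lborel (\<lambda>z. \<zeta>d i z * mol r z a)"
        by (rule integrable_continuous_bounded_support[OF c2, where R = R]) (simp add: zd0)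
      have "(\<integral>z. \<zeta>d i z * mol r z a - \<zeta> z * dmol r (b i) z a \<partial>lborel) = 0"
      proof (rule integral_directional_derivative_eq_0[where v = "b i" and R = R])
        fix z
        have "((\<lambda>s. mol r a (z + s *\<^sub>R b i)) has_derivative (\<lambda>h. dmol r (h *\<^sub>R b i) a (z + 0 *\<^sub>R b i))) (at 0)"
          by (rule has_derivative_compose[OF _ mol_has_derivative]) (auto intro!: derivative_eq_intros)
        moreover have "(\<lambda>h. dmol r (h *\<^sub>R b i) a (z + 0 *\<^sub>R b i)) = (*) (- dmol r (b i) z a)"
          by (subst dmol_commute[of r _ z]) (auto simp: dmol_def dbump_def)
        ultimately have 1: "((\<lambda>s. mol r (z + s *\<^sub>R b i) a) has_real_derivative - dmol r (b i) z a) (at 0)"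
          by (simp add: has_field_derivative_def mol_commute[of r _ a])
        show "((\<lambda>s. \<zeta> (z + s *\<^sub>R b i) * mol r (z + s *\<^sub>R b i) a) has_real_derivative
           \<zeta>d i z * mol r z a - \<zeta> z * dmol r (b i) z a) (at 0)"
          using DERIV_mult[OF zd_der 1, of z] by (simp add: mult_ac)
      next
        show "continuous_on UNIV (\<lambda>z. \<zeta> z * mol r z a)" by (intro continuous_intros cz)
        show "continuous_on UNIV (\<lambda>z. \<zeta>d i z * mol r z a - \<zeta> z * dmol r (b i) z a)"
          by (intro continuous_intros cz czd)
      qed (simp add: z0)
      then show ?thesis using i1 i2 by simp
    qed
    have "(\<integral>z. \<zeta> z * (\<integral>a. F i a * dmol r (b i) z a \<partial>lborel) \<partial>lborel)
        = (\<integral>a. F i a * (\<integral>z. \<zeta> z * dmol r (b i) z a \<partial>lborel) \<partial>lborel)"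
      by (rule integral_kernel_swap[OF iz F1 _ C]) (auto simp: case_prod_beta intro!: continuous_intros)
    also have "\<dots> = (\<integral>a. F i a * (\<integral>z. \<zeta>d i z * mol r z a \<partial>lborel) \<partial>lborel)" by (simp add: parts)
    also have "\<dots> = (\<integral>z. \<zeta>d i z * (\<integral>a. F i a * mol r z a \<partial>lborel) \<partial>lborel)"
      by (rule integral_kernel_swap[OF izd F1 _ C', symmetric]) (auto simp: case_prod_beta intro!: continuous_intros)
    finally show ?thesis unfolding mollify_def .
  qed
  \<comment> \<open>where \<open>\<zeta>\<close> does not vanish, the kernel is an admissible test function\<close>
  have sp_int: "integrable lborel (\<lambda>z. \<zeta> z * (\<integral>a. F i a * dmol r (b i) z a \<partial>lborel))" for i
  proof -
    obtain C where C: "\<And>z a. \<bar>dmol r (b i) (z::(real^'n) \<times> real) a\<bar> \<le> C" using dmol_bounded[OF r(1)] by metis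
    have "continuous_on UNIV (\<lambda>(z, a). dmol r (b i) z a)"
      by (auto simp: case_prod_beta intro!: continuous_intros)
    from borel_measurable_continuous_onI[OF this]
    have [measurable]: "(\<lambda>(z, a). dmol r (b i) z a) \<in> borel_measurable (lborel \<Otimes>\<^sub>M lborel)"
      by (simp add: lborel_prod)
    have meas: "(\<lambda>z. \<integral>a. F i a * dmol r (b i) z a \<partial>lborel) \<in> borel_measurable lborel"
      by (rule lborel.borel_measurable_lebesgue_integral) measurable
    show ?thesis
    proof (rule integrable_mult_bounded[OF iz])
      show "(\<lambda>z. \<integral>a. F i a * dmol r (b i) z a \<partial>lborel) \<in> borel_measurable borel"
        using meas by simp
      fix z
      have "\<bar>\<integral>a. F i a * dmol r (b i) z a \<partial>lborel\<bar> \<le> (\<integral>a. \<bar>F i a * dmol r (b i) z a\<bar> \<partial>lborel)" by (rule integral_abs_bound)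
      also have "\<dots> \<le> (\<integral>a. \<bar>F i a\<bar> * C \<partial>lborel)"
      proof (rule integral_mono)
        have "dmol r (b i) z \<in> borel_measurable borel" by (intro borel_measurable_continuous_onI continuous_intros)
        from integrable_mult_bounded[OF F1 this C, of i]
        show "integrable lborel (\<lambda>a. \<bar>F i a * dmol r (b i) z a\<bar>)" by (rule integrable_abs)
      qed (use F1 in simp, simp only: abs_mult, intro mult_left_mono C abs_ge_zero)
      finally show "\<bar>\<integral>a. F i a * dmol r (b i) z a \<partial>lborel\<bar> \<le> (\<integral>a. \<bar>F i a\<bar> * C \<partial>lborel)" .
    qed
  qed
  have dc: "(\<integral>a. g a * dmol r v z a \<partial>lborel) = - mollify_deriv r v g z" for v z
    unfolding mollify_deriv_def by (subst dmol_commute) simp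
  have test: "test_fun V (mol r z)" if "z \<in> S" for z
  proof (rule test_fun_mol[OF r(1)])
    show "cball z r \<subseteq> V" using subset_cball[OF r(3), of z] d2(2) that by blast
  qed
  let ?E = "\<lambda>z. (\<Sum>i\<in>UNIV. \<zeta> z * (\<integral>a. F i a * dmol r (b i) z a \<partial>lborel)) + \<zeta> z * mollify_deriv r (0, 1) g z"
  have E: "?E z \<le> 0" for z
  proof -
    show ?thesis
    proof (cases "\<zeta> z = 0")
      case False
      from weak1[OF test[OF zS[OF False]] mol_nonneg[OF r(1)]]
      have "(\<Sum>i\<in>UNIV. \<integral>a. F i a * dmol r (b i) z a \<partial>lborel) + mollify_deriv r (0, 1) g z \<le> 0"
        by (simp add: frechet_derivative_mol dc)
      then have "\<zeta> z * ((\<Sum>i\<in>UNIV. \<integral>a. F i a * dmol r (b i) z a \<partial>lborel) + mollify_deriv r (0, 1) g z) \<le> 0"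
        using znn by (simp add: mult_nonneg_nonpos)
      then show ?thesis by (simp add: distrib_left sum_distrib_left)
    qed simp
  qed
  have "0 \<le> (\<integral>z. - ?E z \<partial>lborel)"
    by (intro integral_nonneg_AE AE_I2) (use E in \<open>simp only: neg_0_le_iff_le\<close>)
  then have "(\<integral>z. ?E z \<partial>lborel) \<le> 0" by (simp only: integral_minus neg_0_le_iff_le)
  moreover have "continuous_on UNIV (\<lambda>z. \<zeta> z * mollify_deriv r (0, 1) g z)" by (intro continuous_intros cz cdG)
  then have "integrable lborel (\<lambda>z. \<zeta> z * mollify_deriv r (0, 1) g z)"
    by (rule integrable_continuous_bounded_support[where R = R]) (simp add: z0)
  ultimately have main: "(\<Sum>i\<in>UNIV. \<integral>z. \<zeta>d i z * mollify r (F i) z \<partial>lborel) + (\<integral>z. \<eta>n (snd z) * \<Psi> (G z) \<partial>lborel) \<le> 0"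
    using sp_int by (simp add: time space)
  have le_m: "m \<le> (\<integral>z. \<eta>n (snd z) * \<Psi> (G z) \<partial>lborel)"
    unfolding m_def
  proof (rule integral_mono[OF iJ])
    have "continuous_on UNIV (\<lambda>z. \<eta>n (snd z) * \<Psi> (G z))" by (intro continuous_intros c_psi cG)
    then show "integrable lborel (\<lambda>z. \<eta>n (snd z) * \<Psi> (G z))"
      by (rule integrable_continuous_bounded_support[where R = R]) (use P0 in \<open>auto simp: \<eta>n_def \<eta>_def\<close>)
    fix z
    have "max 0 (g z - e - 2 * e) \<le> max 0 (G z - 2 * e)" using G_close[of z] by auto
    then have "\<Psi> (g z - e) \<le> \<Psi> (G z)" unfolding \<Psi>_def by (simp add: power_mono divide_right_mono)
    then show "J z \<le> \<eta>n (snd z) * \<Psi> (G z)" unfolding J_def using nn by (intro mult_left_mono)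
  qed
  \<comment> \<open>\<open>K\<close> is nonnegative and bounded independently of \<open>r\<close>, so the mollified product may be replaced by
    \<open>F \<bullet> H \<ge> 0\<close>\<close>
  have zd_eq: "\<zeta>d i z * mollify r (F i) z = K z * (mollify r (F i) z * mollify r (H i) z)" for i z
  proof (cases "K z = 0")
    case False
    have "- mollify_deriv r (b i) g z = - mollify r (H i) z"
      using weak2[OF test[OF KS[OF False]], of i] by (simp add: frechet_derivative_mol dc mollify_def)
    then show ?thesis by (simp add: \<zeta>d_def mult_ac)
  qed (simp add: \<zeta>d_def)
  have mollify_meas: "mollify r f \<in> borel_measurable borel" if [measurable]: "f \<in> borel_measurable borel"
    for f :: "(real^'n) \<times> real \<Rightarrow> real"
  proof -
    have "continuous_on UNIV (\<lambda>(z, a). mol r (z :: (real^'n) \<times> real) a)"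
      by (auto simp: case_prod_beta intro!: continuous_intros)
    from borel_measurable_continuous_onI[OF this]
    have [measurable]: "(\<lambda>(z, a). mol r (z :: (real^'n) \<times> real) a) \<in> borel_measurable (lborel \<Otimes>\<^sub>M lborel)"
      by (simp add: lborel_prod)
    have "(\<lambda>z. \<integral>a. f a * mol r z a \<partial>lborel) \<in> borel_measurable lborel"
      by (rule lborel.borel_measurable_lebesgue_integral) measurable
    then show ?thesis unfolding mollify_def[abs_def] by simp
  qed
  have FH: "integrable lborel (\<lambda>z. F i z * H i z)" for i
    by (rule integrable_powr_imp_integrable_product[OF pq _ _ Fp Hq]) measurable
  have K_meas: "K \<in> borel_measurable borel" by (rule borel_measurable_continuous_onI[OF cK])
  have Kabs: "\<bar>K z\<bar> \<le> M" for z using Kle[of z] Knn[of z] by simp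
  have KFH: "integrable lborel (\<lambda>z. F i z * H i z * K z)" for i
    by (rule integrable_mult_bounded[OF FH K_meas Kabs])
  have err: "(\<integral>z. \<zeta>d i z * mollify r (F i) z \<partial>lborel) \<ge> (\<integral>z. F i z * H i z * K z \<partial>lborel) - M * \<epsilon>" for i
  proof -
    let ?D = "\<lambda>z. mollify r (F i) z * mollify r (H i) z - F i z * H i z"
    have Dm: "?D \<in> borel_measurable borel"
      using mollify_meas[OF Fm] mollify_meas[OF Hm] by measurable
    have nnD: "(\<integral>\<^sup>+z. ennreal \<bar>?D z\<bar> \<partial>lborel) \<le> ennreal \<epsilon>" by (rule d(2)[OF r(1) r(4)])
    have iD: "integrable lborel ?D"
      using Dm nnD le_less_trans[OF nnD ennreal_less_top] by (intro integrableI_bounded) auto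
    have "ennreal (\<integral>z. \<bar>?D z\<bar> \<partial>lborel) \<le> ennreal \<epsilon>"
      using nnD nn_integral_eq_integral[of lborel "\<lambda>z. \<bar>?D z\<bar>"] iD by auto
    then have D: "(\<integral>z. \<bar>?D z\<bar> \<partial>lborel) \<le> \<epsilon>" using eps by simp
    have iDK: "integrable lborel (\<lambda>z. ?D z * K z)" by (rule integrable_mult_bounded[OF iD K_meas Kabs])
    have "\<bar>\<integral>z. ?D z * K z \<partial>lborel\<bar> \<le> (\<integral>z. \<bar>?D z * K z\<bar> \<partial>lborel)" by (rule integral_abs_bound)
    also have "\<dots> \<le> (\<integral>z. \<bar>?D z\<bar> * M \<partial>lborel)"
    proof (rule integral_mono)
      show "integrable lborel (\<lambda>z. \<bar>?D z * K z\<bar>)" by (rule integrable_abs[OF iDK])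
      show "integrable lborel (\<lambda>z. \<bar>?D z\<bar> * M)" by (intro integrable_mult_left integrable_abs iD)
      show "\<bar>?D z * K z\<bar> \<le> \<bar>?D z\<bar> * M" for z
        unfolding abs_mult by (intro mult_left_mono Kabs) simp
    qed
    also have "\<dots> \<le> \<epsilon> * M" using D M by simp
    finally have 1: "\<bar>\<integral>z. ?D z * K z \<partial>lborel\<bar> \<le> \<epsilon> * M" .
    have "(\<integral>z. \<zeta>d i z * mollify r (F i) z \<partial>lborel) = (\<integral>z. F i z * H i z * K z + ?D z * K z \<partial>lborel)"
      by (intro Bochner_Integration.integral_cong) (auto simp: zd_eq algebra_simps)
    also have "\<dots> = (\<integral>z. F i z * H i z * K z \<partial>lborel) + (\<integral>z. ?D z * K z \<partial>lborel)"
      by (rule Bochner_Integration.integral_add[OF KFH iDK])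
    finally show ?thesis using 1 by (simp add: mult.commute)
  qed
  have "(\<Sum>i\<in>UNIV. \<integral>z. F i z * H i z * K z \<partial>lborel) = (\<integral>z. (\<Sum>i\<in>UNIV. F i z * H i z * K z) \<partial>lborel)"
    using KFH by simp
  also have "\<dots> \<ge> 0"
  proof (rule integral_nonneg_AE, use mono in eventually_elim)
    fix z assume "0 \<le> (\<Sum>i\<in>UNIV. F i z * H i z)"
    then have "0 \<le> (\<Sum>i\<in>UNIV. F i z * H i z) * K z" using Knn by simp
    then show "0 \<le> (\<Sum>i\<in>UNIV. F i z * H i z * K z)" by (simp add: sum_distrib_right)
  qed
  finally have "0 \<le> (\<Sum>i\<in>UNIV. \<integral>z. F i z * H i z * K z \<partial>lborel)" .
  moreover have "(\<Sum>i\<in>UNIV. (\<integral>z. F i z * H i z * K z \<partial>lborel) - M * \<epsilon>) \<le> (\<Sum>i\<in>UNIV. \<integral>z. \<zeta>d i z * mollify r (F i) z \<partial>lborel)"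
    by (intro sum_mono err)
  moreover have "(\<Sum>i\<in>(UNIV::'n set). M * \<epsilon>) = m/2" using M by (simp add: \<epsilon>_def)
  ultimately show False using main le_m m by (simp add: sum_subtractf)
qed

section \<open>Test functions and integration by parts\<close>

lemma test_funD:
  assumes "test_fun S \<phi>"
  shows test_fun_continuous: "continuous_on UNIV \<phi>"
    and test_fun_has_derivative: "(\<phi> has_derivative frechet_derivative \<phi> (at z)) (at z)"
    and test_fun_deriv_continuous: "continuous_on UNIV (\<lambda>z. frechet_derivative \<phi> (at z) v)"
    and test_fun_eq_0: "z \<notin> S \<Longrightarrow> \<phi> z = 0"
    and test_fun_deriv_eq_0: "z \<notin> S \<Longrightarrow> frechet_derivative \<phi> (at z) v = 0"
    and test_fun_bounded_support: "\<exists>R. \<forall>z. norm z \<ge> R \<longrightarrow> \<phi> z = 0 \<and> (\<forall>v. frechet_derivative \<phi> (at z) v = 0)"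
proof -
  have C: "Ck_fun k \<phi>" for k using assms by (simp add: test_fun_def)
  have "Ck_fun 0 \<phi>" by (rule C)
  then show "continuous_on UNIV \<phi>" by simp
  show der: "(\<phi> has_derivative frechet_derivative \<phi> (at z)) (at z)" for z
    using C[of "Suc 0"] by (rule Ck_fun_SucD)
  show "continuous_on UNIV (\<lambda>z. frechet_derivative \<phi> (at z) v)" using C[of "Suc 0"] by simp
  let ?K = "closure {x. \<phi> x \<noteq> 0}"
  have K: "compact ?K" "?K \<subseteq> S" using assms by (auto simp: test_fun_def)
  have 0: "\<phi> z = 0" if "z \<notin> ?K" for z using that closure_subset[of "{x. \<phi> x \<noteq> 0}"] by blast
  have d0: "frechet_derivative \<phi> (at z) v = 0" if "z \<notin> ?K" for z v
  proof -
    have "((\<lambda>x. 0) has_derivative frechet_derivative \<phi> (at z)) (at z)"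
    proof (rule has_derivative_transform_within_open[OF der])
      show "open (- ?K)" by (rule open_Compl) (rule closed_closure)
      show "z \<in> - ?K" using that by blast
      show "\<phi> x = 0" if "x \<in> - ?K" for x using 0 that by blast
    qed
    then have "frechet_derivative \<phi> (at z) = (\<lambda>v. 0)" by (rule has_derivative_unique) simp
    then show ?thesis by simp
  qed
  show "\<phi> z = 0" if "z \<notin> S" using 0 K(2) that by blast
  show "frechet_derivative \<phi> (at z) v = 0" if "z \<notin> S" using d0 K(2) that by blast
  obtain R where "\<And>z. z \<in> ?K \<Longrightarrow> norm z < R" using compact_imp_bounded[OF K(1)] unfolding bounded_pos_less by auto
  then have "z \<notin> ?K" if "norm z \<ge> R" for z using that by fastforce
  then show "\<exists>R. \<forall>z. norm z \<ge> R \<longrightarrow> \<phi> z = 0 \<and> (\<forall>v. frechet_derivative \<phi> (at z) v = 0)"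
    using 0 d0 by blast
qed

lemma test_fun_integrable:
  fixes f :: "'a::euclidean_space \<Rightarrow> real"
  assumes "test_fun S \<phi>" "continuous_on UNIV f"
  shows "integrable lborel (\<lambda>z. f z * \<phi> z)" "integrable lborel (\<lambda>z. f z * frechet_derivative \<phi> (at z) v)"
proof -
  obtain R where R: "\<And>z. norm z \<ge> R \<Longrightarrow> \<phi> z = 0" "\<And>z v. norm z \<ge> R \<Longrightarrow> frechet_derivative \<phi> (at z) v = 0"
    using test_fun_bounded_support[OF assms(1)] by blast
  show "integrable lborel (\<lambda>z. f z * \<phi> z)"
    by (rule integrable_continuous_bounded_support[where R = R])
       (auto intro!: continuous_intros assms(2) test_fun_continuous[OF assms(1)] simp: R)
  show "integrable lborel (\<lambda>z. f z * frechet_derivative \<phi> (at z) v)"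
    by (rule integrable_continuous_bounded_support[where R = R])
       (auto intro!: continuous_intros assms(2) test_fun_deriv_continuous[OF assms(1)] simp: R)
qed

lemma integral_by_parts_test_fun:
  fixes f f' :: "'a::euclidean_space \<Rightarrow> real"
  assumes \<phi>: "test_fun S \<phi>" and c: "continuous_on UNIV f" "continuous_on UNIV f'"
    and der: "\<And>z. ((\<lambda>s. f (z + s *\<^sub>R v)) has_real_derivative f' z) (at 0)"
  shows "(\<integral>z. f z * frechet_derivative \<phi> (at z) v \<partial>lborel) = - (\<integral>z. f' z * \<phi> z \<partial>lborel)"
proof -
  obtain R where R: "\<And>z. norm z \<ge> R \<Longrightarrow> \<phi> z = 0"
    using test_fun_bounded_support[OF \<phi>] by blast
  have "(\<integral>z. f' z * \<phi> z + f z * frechet_derivative \<phi> (at z) v \<partial>lborel) = 0"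
  proof (rule integral_directional_derivative_eq_0[where v = v and R = R])
    fix z
    have "((\<lambda>s. \<phi> (z + s *\<^sub>R v)) has_derivative (\<lambda>h. frechet_derivative \<phi> (at (z + 0 *\<^sub>R v)) (h *\<^sub>R v))) (at 0)"
      by (rule has_derivative_compose[OF _ test_fun_has_derivative[OF \<phi>]]) (auto intro!: derivative_eq_intros)
    moreover have "(\<lambda>h. frechet_derivative \<phi> (at (z + 0 *\<^sub>R v)) (h *\<^sub>R v)) = (*) (frechet_derivative \<phi> (at z) v)"
      using linear_cmul[OF has_derivative_linear[OF test_fun_has_derivative[OF \<phi>, of z]]] by (auto simp: mult.commute)
    ultimately have "((\<lambda>s. \<phi> (z + s *\<^sub>R v)) has_real_derivative frechet_derivative \<phi> (at z) v) (at 0)"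
      by (simp add: has_field_derivative_def)
    from DERIV_mult[OF der this]
    show "((\<lambda>s. f (z + s *\<^sub>R v) * \<phi> (z + s *\<^sub>R v)) has_real_derivative f' z * \<phi> z + f z * frechet_derivative \<phi> (at z) v) (at 0)"
      by (simp add: add.commute mult.commute)
  qed (auto intro!: continuous_intros c test_fun_continuous[OF \<phi>] test_fun_deriv_continuous[OF \<phi>] simp: R)
  then show ?thesis using test_fun_integrable(2)[OF \<phi> c(1), of v] test_fun_integrable(1)[OF \<phi> c(2)] by simp
qed

section \<open>Explicit solutions with linear flux\<close>

text \<open>At the origin the difference quotient is \<open>\<bar>h\<bar>\<^sup>q\<^sup>-\<^sup>1\<close>, which tends to \<open>0\<close> because \<open>q > 1\<close>; elsewhere this is the
  chain rule.\<close>

lemma norm_powr_has_derivative: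
  fixes x :: "'a::real_inner"
  assumes q: "q > 1"
  shows "((\<lambda>x. norm x powr q) has_derivative (\<lambda>v. q * norm x powr (q - 2) * (x \<bullet> v))) (at x)"
proof (cases "x = 0")
  case True
  have "((\<lambda>h::'a. norm h powr (q - 1)) \<longlongrightarrow> norm (0::'a) powr (q - 1)) (at 0)"
    using q by (intro tendsto_intros) (auto intro!: tendsto_norm_zero simp: eventually_at_filter)
  then have "((\<lambda>h::'a. norm h powr (q - 1)) \<longlongrightarrow> 0) (at 0)" using q by simp
  then have "((\<lambda>h::'a. norm (norm (0 + h) powr q - norm (0::'a) powr q - 0) / norm h) \<longlongrightarrow> 0) (at 0)"
  proof (rule Lim_transform_eventually)
    show "\<forall>\<^sub>F h::'a in at 0. norm h powr (q - 1) = norm (norm (0 + h) powr q - norm (0::'a) powr q - 0) / norm h"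
      using q by (auto simp: eventually_at_filter powr_diff intro!: eventuallyI)
  qed
  then show ?thesis using True by (simp add: has_derivative_at bounded_linear_zero)
next
  case False
  have "((\<lambda>x. norm x) has_derivative (\<lambda>h. (x \<bullet> h) / norm x)) (at x)"
    using has_derivative_norm[OF False] by (simp add: sgn_div_norm inner_commute field_simps)
  moreover have "((\<lambda>u. u powr q) has_derivative (*) (q * norm x powr (q - 1))) (at (norm x))"
    using has_real_derivative_powr[of "norm x" q] False by (simp add: has_field_derivative_def)
  ultimately have "((\<lambda>x. norm x powr q) has_derivative (\<lambda>h. (q * norm x powr (q - 1)) * ((x \<bullet> h) / norm x))) (at x)"
    by (rule has_derivative_compose)
  moreover have "norm x powr (q - 1) = norm x powr (q - 2) * norm x"
    using False powr_add[of "norm x" "q - 2" 1] by simp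
  ultimately show ?thesis using False by (simp add: field_simps)
qed

lemma norm_norm_powr_scaleR:
  fixes x :: "'a::real_normed_vector"
  shows "norm (norm x powr (q - 2) *\<^sub>R x) = norm x powr (q - 1)"
  using powr_add[of "norm x" "q - 2" 1] by (cases "x = 0") auto

lemma continuous_norm_powr_scaleR:
  fixes f :: "'b::topological_space \<Rightarrow> 'a::real_normed_vector"
  assumes q: "q > 1" and f: "continuous_on S f"
  shows "continuous_on S (\<lambda>x. norm (f x) powr (q - 2) *\<^sub>R f x)"
proof -
  have "isCont (\<lambda>x::'a. norm x powr (q - 2) *\<^sub>R x) y" for y
  proof (cases "y = 0")
    case True
    have "((\<lambda>h::'a. norm h powr (q - 1)) \<longlongrightarrow> norm (0::'a) powr (q - 1)) (at 0)"
      using q by (intro tendsto_intros) (auto intro!: tendsto_norm_zero simp: eventually_at_filter)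
    then have "((\<lambda>h::'a. norm (norm h powr (q - 2) *\<^sub>R h)) \<longlongrightarrow> 0) (at 0)"
      unfolding norm_norm_powr_scaleR using q by simp
    from tendsto_norm_zero_cancel[OF this] show ?thesis using True by (simp add: isCont_def)
  next
    case False
    then show ?thesis by (intro continuous_intros) auto
  qed
  then have "continuous_on UNIV (\<lambda>x::'a. norm x powr (q - 2) *\<^sub>R x)"
    by (simp add: continuous_at_imp_continuous_on)
  from continuous_on_compose2[OF this f] show ?thesis by simp
qed

text \<open>The sign \<open>s\<close> is \<open>1\<close> for the functions used from below and \<open>-1\<close> for their mirror images used from above.\<close>

definition profile :: "real \<Rightarrow> real \<Rightarrow> real \<Rightarrow> real^'n \<Rightarrow> real \<Rightarrow> real \<Rightarrow> (real^'n) \<times> real \<Rightarrow> real" where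
  "profile s c q y l d z = s * (c * norm (fst z - y) powr q + l * snd z) + d"

definition profile_grad :: "real \<Rightarrow> real \<Rightarrow> real \<Rightarrow> real^'n \<Rightarrow> real^'n \<Rightarrow> real^'n" where
  "profile_grad s c q y x = (s * c * q) *\<^sub>R (norm (x - y) powr (q - 2) *\<^sub>R (x - y))"

definition flux :: "real \<Rightarrow> real^'n \<Rightarrow> real^'n" where
  "flux p v = norm v powr (p - 2) *\<^sub>R v"

text \<open>The powers of \<open>\<bar>x - y\<bar>\<close> in the flux cancel: \<open>(q - 1) (p - 2) + (q - 2) = 0\<close>.\<close>

lemma flux_profile_grad:
  assumes p: "p > 2" and q: "q = p / (p - 1)" and c: "c \<ge> 0" and s: "\<bar>s\<bar> = 1"
  shows "flux p (profile_grad s c q y x) = (s * (c * q) powr (p - 1)) *\<^sub>R (x - y)"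
proof (cases "c = 0 \<or> x = y")
  case True
  then show ?thesis using p by (auto simp: flux_def profile_grad_def)
next
  case False
  have q0: "q > 0" using p q by simp
  let ?m = "norm (x - y)"
  have m: "?m > 0" using False by simp
  have "norm (profile_grad s c q y x) = (c * q) * ?m powr (q - 1)"
    unfolding profile_grad_def norm_scaleR[of "s * c * q"] norm_norm_powr_scaleR using c q0 s by (simp add: abs_mult)
  then have "flux p (profile_grad s c q y x)
     = (((c * q) * ?m powr (q - 1)) powr (p - 2) * (s * c * q * ?m powr (q - 2))) *\<^sub>R (x - y)"
    unfolding flux_def by (simp add: profile_grad_def)
  also have "((c * q) * ?m powr (q - 1)) powr (p - 2) * (s * c * q * ?m powr (q - 2))
     = s * ((c * q) powr (p - 2) * (c * q)) * (?m powr ((q - 1) * (p - 2)) * ?m powr (q - 2))"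
    using c q0 by (simp add: powr_mult powr_powr mult_ac)
  also have "?m powr ((q - 1) * (p - 2)) * ?m powr (q - 2) = ?m powr ((q - 1) * (p - 2) + (q - 2))"
    by (simp add: powr_add)
  also have "(q - 1) * (p - 2) + (q - 2) = 0" using p unfolding q by (simp add: field_simps)
  also have "(c * q) powr (p - 2) * (c * q) = (c * q) powr (p - 1)"
    using powr_add[of "c * q" "p - 2" 1] c q0 False by simp
  finally show ?thesis using m by simp
qed

lemma profile_continuous: "q > 0 \<Longrightarrow> continuous_on UNIV (profile s c q y l d)"
  unfolding profile_def[abs_def]
  by (intro continuous_intros continuous_on_powr') auto

lemma profile_grad_continuous: "q > 1 \<Longrightarrow> continuous_on S f \<Longrightarrow> continuous_on S (\<lambda>z. profile_grad s c q y (f z))"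
  unfolding profile_grad_def
  by (intro continuous_on_scaleR continuous_on_const continuous_norm_powr_scaleR continuous_intros) auto

lemma profile_slice_has_derivative:
  assumes "q > 1"
  shows "((\<lambda>x. profile s c q y l d (x, t)) has_derivative (\<lambda>v. profile_grad s c q y x \<bullet> v)) (at x)"
proof -
  have "((\<lambda>x. norm (x - y) powr q) has_derivative (\<lambda>v. q * norm (x - y) powr (q - 2) * ((x - y) \<bullet> v))) (at x)"
    by (rule has_derivative_compose[OF _ norm_powr_has_derivative[OF assms]]) (auto intro!: derivative_eq_intros)
  then have "((\<lambda>x. s * (c * norm (x - y) powr q + l * t) + d) has_derivative
      (\<lambda>v. s * (c * (q * norm (x - y) powr (q - 2) * ((x - y) \<bullet> v)) + 0) + 0)) (at x)"
    by (intro has_derivative_add has_derivative_mult_right has_derivative_const)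
  then show ?thesis unfolding profile_def profile_grad_def by (simp add: mult_ac)
qed

lemma profile_has_derivative_space:
  assumes q: "q > 1"
  shows "((\<lambda>h. profile s c q y l d (z + h *\<^sub>R (axis i 1, 0))) has_real_derivative profile_grad s c q y (fst z) $ i) (at 0)"
proof -
  have "((\<lambda>h. profile s c q y l d (fst z + h *\<^sub>R axis i 1, snd z)) has_derivative
      (\<lambda>h. profile_grad s c q y (fst z + 0 *\<^sub>R axis i 1) \<bullet> (h *\<^sub>R axis i 1))) (at 0)"
    by (rule has_derivative_compose[OF _ profile_slice_has_derivative[OF q]]) (auto intro!: derivative_eq_intros)
  moreover have "(\<lambda>h. profile_grad s c q y (fst z + 0 *\<^sub>R axis i 1) \<bullet> (h *\<^sub>R axis i 1)) = (*) (profile_grad s c q y (fst z) $ i)"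
    by (auto simp: inner_axis mult.commute)
  moreover have "z + h *\<^sub>R (axis i 1, 0) = (fst z + h *\<^sub>R axis i 1, snd z)" for h
    by (simp add: prod_eq_iff)
  ultimately show ?thesis by (simp add: has_field_derivative_def)
qed

lemma profile_has_derivative_time:
  "((\<lambda>h. profile s c q y l d (z + h *\<^sub>R (0, 1))) has_real_derivative s * l) (at 0)"
  unfolding profile_def by (auto intro!: derivative_eq_intros)

lemma profile_weak_gradient_identity:
  assumes "q > 1" "test_fun S \<phi>"
  shows "(\<integral>z. profile s c q y l d z * frechet_derivative \<phi> (at z) (axis i 1, 0) \<partial>lborel)
     = - (\<integral>z. profile_grad s c q y (fst z) $ i * \<phi> z \<partial>lborel)"
proof (rule integral_by_parts_test_fun[OF assms(2)])
  show "continuous_on UNIV (profile s c q y l d)" using assms(1) by (intro profile_continuous) simp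
  show "continuous_on UNIV (\<lambda>z. profile_grad s c q y (fst z) $ i)"
    by (intro continuous_on_component profile_grad_continuous assms(1) continuous_intros)
qed (rule profile_has_derivative_space[OF assms(1)])

text \<open>The flux has the constant divergence \<open>s n (c q)\<^sup>p\<^sup>-\<^sup>1\<close>, the time derivative is \<open>s l\<close>. The sign of their difference
  decides between solution, subsolution and supersolution.\<close>

lemma profile_weak_identity:
  fixes y :: "real^'n"
  assumes p: "p > 2" and q: "q = p / (p - 1)" and c: "c \<ge> 0" and s: "\<bar>s\<bar> = 1" and \<phi>: "test_fun S \<phi>"
  shows "(\<Sum>i\<in>UNIV. \<integral>z. flux p (profile_grad s c q y (fst z)) $ i * frechet_derivative \<phi> (at z) (axis i 1, 0) \<partial>lborel)
     - (\<integral>z. profile s c q y l d z * frechet_derivative \<phi> (at z) (0, 1) \<partial>lborel)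
     = s * (l - CARD('n) * (c * q) powr (p - 1)) * (\<integral>z. \<phi> z \<partial>lborel)"
proof -
  let ?k = "s * (c * q) powr (p - 1)"
  have "(\<integral>z. flux p (profile_grad s c q y (fst z)) $ i * frechet_derivative \<phi> (at z) (axis i 1, 0) \<partial>lborel)
     = - (\<integral>z. ?k * \<phi> z \<partial>lborel)" for i
  proof (rule integral_by_parts_test_fun[OF \<phi>])
    show "((\<lambda>h. flux p (profile_grad s c q y (fst (z + h *\<^sub>R (axis i 1, 0)))) $ i) has_real_derivative ?k) (at 0)" for z
      unfolding flux_profile_grad[OF p q c s] by (auto intro!: derivative_eq_intros)
  qed (auto simp: flux_profile_grad[OF p q c s] intro!: continuous_intros)
  moreover have "q > 0" using p q by simp
  then have "(\<integral>z. profile s c q y l d z * frechet_derivative \<phi> (at z) (0, 1) \<partial>lborel) = - (\<integral>z. (s * l) * \<phi> z \<partial>lborel)"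
    by (intro integral_by_parts_test_fun[OF \<phi>] profile_continuous profile_has_derivative_time continuous_intros)
  ultimately show ?thesis by (simp add: algebra_simps)
qed

section \<open>Explicit functions are p-parabolic\<close>

lemma set_integral_lebesgue_eq_lborel:
  fixes f :: "'a::euclidean_space \<Rightarrow> 'b::{banach, second_countable_topology}"
  assumes "f \<in> borel_measurable borel" "\<And>z. z \<notin> S \<Longrightarrow> f z = 0"
  shows "(LINT z:S|lebesgue. f z) = (\<integral>z. f z \<partial>lborel)"
proof -
  have "(\<lambda>z. indicator S z *\<^sub>R f z) = f" using assms(2) by (auto simp: indicator_def)
  then show ?thesis unfolding set_lebesgue_integral_def using assms(1)
    by (simp add: integral_completion)
qed

lemma set_integrable_continuous_on_bounded:
  fixes f :: "'a::euclidean_space \<Rightarrow> 'b::{banach, second_countable_topology}"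
  assumes f: "continuous_on UNIV f" and S: "bounded S" "S \<in> sets borel"
  shows "set_integrable lebesgue S f"
proof -
  have "compact (closure S)" using S(1) by (simp add: compact_closure)
  then have "set_integrable lborel (closure S) f"
    unfolding set_integrable_def using continuous_on_subset[OF f]
    by (intro borel_integrable_compact) auto
  then have "set_integrable lborel S f"
    by (rule set_integrable_subset) (use S closure_subset in auto)
  moreover have "(\<lambda>x. indicator S x *\<^sub>R f x) \<in> borel_measurable borel"
    using borel_measurable_continuous_onI[OF f] S(2) by measurable
  ultimately show ?thesis unfolding set_integrable_def by (simp add: integrable_completion)
qed

lemma in_Lq_continuous:
  fixes f :: "'a::euclidean_space \<Rightarrow> real"
  assumes f: "continuous_on UNIV f" and S: "bounded S" "open S" and r: "r > 0"
  shows "in_Lq r S (\<lambda>x. ereal (f x))"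
proof -
  have "f \<in> borel_measurable lebesgue" using borel_measurable_continuous_onI[OF f] by (simp add: measurable_completion)
  then have "(\<lambda>x. ereal (f x)) \<in> borel_measurable (lebesgue_on S)"
    by (intro borel_measurable_ereal measurable_restrict_space1)
  moreover have "continuous_on UNIV (\<lambda>x. \<bar>f x\<bar> powr r)"
    using r by (intro continuous_on_powr' continuous_intros f) auto
  ultimately show ?thesis unfolding in_Lq_def
    using set_integrable_continuous_on_bounded[OF _ S(1)] S(2) by auto
qed

lemma weak_gradient_C1:
  fixes f :: "real^'n \<Rightarrow> real"
  assumes f: "continuous_on UNIV f" and g: "continuous_on UNIV g"
    and der: "\<And>x. (f has_derivative (\<lambda>v. g x \<bullet> v)) (at x)"
  shows "weak_gradient U (\<lambda>x. ereal (f x)) g"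
  unfolding weak_gradient_def
proof (intro conjI allI impI)
  fix K assume "compact K \<and> K \<subseteq> U"
  then have "bounded K" "K \<in> sets borel" by (auto intro: compact_imp_bounded borel_compact)
  then show "set_integrable lebesgue K (\<lambda>x. real_of_ereal (ereal (f x)))" "set_integrable lebesgue K g"
    using set_integrable_continuous_on_bounded f g by auto
next
  fix \<phi> :: "real^'n \<Rightarrow> real" assume \<phi>: "test_fun U \<phi>"
  have cg: "continuous_on UNIV (\<lambda>x. g x $ i)" for i by (intro continuous_intros g)
  obtain R where R: "\<And>z. norm z \<ge> R \<Longrightarrow> \<phi> z = 0" "\<And>z v. norm z \<ge> R \<Longrightarrow> frechet_derivative \<phi> (at z) v = 0"
    using test_fun_bounded_support[OF \<phi>] by blast
  have "continuous_on UNIV (grad \<phi>)"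
    unfolding grad_def by (intro continuous_on_vec_lambda test_fun_deriv_continuous[OF \<phi>])
  moreover have g0: "grad \<phi> x = 0" if "norm x \<ge> R" for x
    using that by (simp add: grad_def R vec_eq_iff)
  ultimately have i1: "integrable lborel (\<lambda>x. f x *\<^sub>R grad \<phi> x)"
    by (intro integrable_continuous_bounded_support[where R = R] continuous_on_scaleR f) (simp_all add: g0)
  have i2: "integrable lborel (\<lambda>x. \<phi> x *\<^sub>R g x)"
    by (intro integrable_continuous_bounded_support[where R = R] continuous_on_scaleR g test_fun_continuous[OF \<phi>]) (simp add: R)
  have 1: "(LINT x:U|lebesgue. real_of_ereal (ereal (f x)) *\<^sub>R grad \<phi> x) = (\<integral>x. f x *\<^sub>R grad \<phi> x \<partial>lborel)"
    using borel_measurable_integrable[OF i1] test_fun_deriv_eq_0[OF \<phi>]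
    by (subst set_integral_lebesgue_eq_lborel) (auto simp: grad_def vec_eq_iff)
  have 2: "(LINT x:U|lebesgue. \<phi> x *\<^sub>R g x) = (\<integral>x. \<phi> x *\<^sub>R g x \<partial>lborel)"
    using borel_measurable_integrable[OF i2] test_fun_eq_0[OF \<phi>]
    by (subst set_integral_lebesgue_eq_lborel) auto
  have "(\<integral>x. f x *\<^sub>R grad \<phi> x \<partial>lborel) $ i = (- (\<integral>x. \<phi> x *\<^sub>R g x \<partial>lborel)) $ i" for i
  proof -
    have "(\<integral>x. f x *\<^sub>R grad \<phi> x \<partial>lborel) $ i = (\<integral>x. f x * frechet_derivative \<phi> (at x) (axis i 1) \<partial>lborel)"
      using integral_bounded_linear[OF bounded_linear_vec_nth i1, of i] by (simp add: grad_def)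
    also have "\<dots> = - (\<integral>x. g x $ i * \<phi> x \<partial>lborel)"
    proof (rule integral_by_parts_test_fun[OF \<phi> f cg])
      fix x
      have "((\<lambda>s. f (x + s *\<^sub>R axis i 1)) has_derivative (\<lambda>h. g (x + 0 *\<^sub>R axis i 1) \<bullet> (h *\<^sub>R axis i 1))) (at 0)"
        by (rule has_derivative_compose[OF _ der]) (auto intro!: derivative_eq_intros)
      moreover have "(\<lambda>h. g (x + 0 *\<^sub>R axis i 1) \<bullet> (h *\<^sub>R axis i 1)) = (*) (g x $ i)"
        by (auto simp: inner_axis mult.commute)
      ultimately show "((\<lambda>s. f (x + s *\<^sub>R axis i 1)) has_real_derivative g x $ i) (at 0)"
        by (simp add: has_field_derivative_def)
    qed
    also have "(\<integral>x. g x $ i * \<phi> x \<partial>lborel) = (\<integral>x. \<phi> x *\<^sub>R g x \<partial>lborel) $ i"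
      using integral_bounded_linear[OF bounded_linear_vec_nth i2, of i] by (simp add: mult.commute)
    finally show ?thesis by simp
  qed
  then show "(LINT x:U|lebesgue. real_of_ereal (ereal (f x)) *\<^sub>R grad \<phi> x) = - (LINT x:U|lebesgue. \<phi> x *\<^sub>R g x)"
    unfolding 1 2 by (simp add: vec_eq_iff)
qed simp

lemma cylinder_bounded_base:
  assumes "t1 < t2" "compactly_inside (cylinder U t1 t2) \<Theta>"
  shows "bounded U"
proof -
  have "bounded (cylinder U t1 t2)"
    using assms(2) unfolding compactly_inside_def
    by (meson bounded_subset closure_subset compact_imp_bounded)
  then have "bounded (fst ` cylinder U t1 t2)" by (rule bounded_fst)
  moreover have "fst ` cylinder U t1 t2 = U" using assms(1) dense[of t1 t2] by (auto simp: cylinder_def)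
  ultimately show ?thesis by simp
qed

lemma profile_p_parabolic:
  fixes y :: "real^'n"
  assumes p: "p > 2" and q: "q = p / (p - 1)" and c: "c \<ge> 0" and s: "\<bar>s\<bar> = 1"
    and l: "l = CARD('n) * (c * q) powr (p - 1)"
  shows "p_parabolic p \<Theta> (profile s c q y l d)"
proof -
  let ?h = "profile s c q y l d"
  have q1: "q > 1" "q > 0" using p q by auto
  have ch: "continuous_on UNIV ?h" by (rule profile_continuous[OF q1(2)])
  have cslice: "continuous_on UNIV (\<lambda>x. ?h (x, t))" for t
    by (rule continuous_on_compose2[OF ch]) (auto intro!: continuous_intros)
  let ?G = "\<lambda>z. profile_grad s c q y (fst z)"
  have cG: "continuous_on UNIV ?G" by (intro profile_grad_continuous q1 continuous_intros)
  have cg: "continuous_on UNIV (profile_grad s c q y)" using profile_grad_continuous[OF q1(1), of UNIV "\<lambda>x. x"] by (simp add: continuous_on_id)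
  have "weak_solution p \<Theta> (\<lambda>z. ereal (?h z))"
    unfolding weak_solution_def
  proof (intro allI impI)
    fix U :: "(real^'n) set" and t1 t2 assume A: "open U \<and> t1 < t2 \<and> compactly_inside (cylinder U t1 t2) \<Theta>"
    then have U: "open U" "bounded U" "U \<in> sets borel" using cylinder_bounded_base by auto
    let ?C = "cylinder U t1 t2"
    have C: "open ?C" "bounded ?C" unfolding cylinder_def using U
      by (auto intro: open_Times bounded_Times)
    have w: "weak_gradient U (\<lambda>x. ereal (?h (x, t))) (profile_grad s c q y)" for t
      by (rule weak_gradient_C1[OF cslice cg profile_slice_has_derivative[OF q1(1)]])
    have pw: "continuous_on UNIV (\<lambda>z. norm (f z) powr p)" if "continuous_on UNIV f" for f :: "'z::topological_space \<Rightarrow> real^'n"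
      using p by (intro continuous_on_powr' continuous_intros that) auto
    have "in_C_L2 t1 t2 U (\<lambda>z. ereal (?h z))"
      unfolding in_C_L2_def
    proof (intro conjI ballI)
      show "in_Lq 2 U (\<lambda>x. ereal (?h (x, t)))" for t
        by (rule in_Lq_continuous[OF cslice U(2,1)]) simp
      define k where "k x = ?h (x, 0)" for x
      have ck: "continuous_on UNIV k" unfolding k_def by (rule cslice)
      have i: "set_integrable lebesgue U (\<lambda>x. (k x)\<^sup>2)" "set_integrable lebesgue U (\<lambda>x. t * (2 * s * l * k x))"
        "set_integrable lebesgue U (\<lambda>x. t\<^sup>2 * (s * l)\<^sup>2)" for t
        by (intro set_integrable_continuous_on_bounded[OF _ U(2,3)] continuous_intros ck)+
      have "\<bar>real_of_ereal (ereal (?h (x, t)))\<bar>\<^sup>2 = (k x)\<^sup>2 + t * (2 * s * l * k x) + t\<^sup>2 * (s * l)\<^sup>2" for x t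
        unfolding k_def by (simp add: profile_def power2_eq_square algebra_simps)
      then have "(LINT x:U|lebesgue. \<bar>real_of_ereal (ereal (?h (x, t)))\<bar>\<^sup>2)
         = (LINT x:U|lebesgue. (k x)\<^sup>2) + t * (LINT x:U|lebesgue. 2 * s * l * k x) + t\<^sup>2 * (LINT x:U|lebesgue. (s * l)\<^sup>2)" for t
        using set_integral_add(2)[OF set_integral_add(1)[OF i(1,2)] i(3), of t t] set_integral_add(2)[OF i(1,2), of t]
        by (simp only: set_integral_mult_right)
      \<comment> \<open>the squared norm is a quadratic polynomial in \<open>t\<close>\<close>
      then show "continuous_on {t1..t2} (\<lambda>t. LINT x:U|lebesgue. \<bar>real_of_ereal (ereal (?h (x, t)))\<bar>\<^sup>2)"
        by (simp only:) (intro continuous_intros)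
    qed
    moreover have "in_Lp_W1p_with_gradient p t1 t2 U (\<lambda>z. ereal (?h z)) ?G"
      unfolding in_Lp_W1p_with_gradient_def
    proof (intro conjI AE_I2 impI)
      fix t
      have "in_Lq p U (\<lambda>x. ereal (?h (x, t)))" by (rule in_Lq_continuous[OF cslice U(2,1)]) (use p in simp)
      then show "in_W1p p U (\<lambda>x. ereal (?h (x, t)))"
        unfolding in_W1p_def using w set_integrable_continuous_on_bounded[OF pw[OF cg] U(2,3)] by blast
      show "weak_gradient U (\<lambda>x. ereal (?h (x, t))) (\<lambda>x. ?G (x, t))" using w by simp
    next
      have "?G \<in> borel_measurable lebesgue" using borel_measurable_continuous_onI[OF cG] by (intro measurable_completion) simp
      then show "?G \<in> borel_measurable (lebesgue_on ?C)" by (rule measurable_restrict_space1)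
      show "in_Lq p ?C (\<lambda>z. ereal (?h z))" by (rule in_Lq_continuous[OF ch C(2,1)]) (use p in simp)
      show "set_integrable lebesgue ?C (\<lambda>z. norm (?G z) powr p)"
        using set_integrable_continuous_on_bounded[OF pw[OF cG] C(2)] C(1) by simp
    qed
    moreover have "(LINT z:?C|lebesgue. (norm (?G z) powr (p - 2) *\<^sub>R ?G z) \<bullet> grad_x \<phi> z)
             - (LINT z:?C|lebesgue. real_of_ereal (ereal (?h z)) * deriv_t \<phi> z) = 0"
      if \<phi>: "test_fun ?C \<phi>" for \<phi>
    proof -
      have cf: "continuous_on UNIV (\<lambda>z. flux p (?G z) $ i)" for i
        unfolding flux_profile_grad[OF p q c s] by (intro continuous_intros)
      have i: "integrable lborel (\<lambda>z. flux p (?G z) $ i * frechet_derivative \<phi> (at z) (axis i 1, 0))" for i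
        by (rule test_fun_integrable(2)[OF \<phi> cf])
      have e: "(norm (?G z) powr (p - 2) *\<^sub>R ?G z) \<bullet> grad_x \<phi> z
        = (\<Sum>i\<in>UNIV. flux p (?G z) $ i * frechet_derivative \<phi> (at z) (axis i 1, 0))" for z
        by (simp add: flux_def inner_vec_def grad_x_def)
      have "(LINT z:?C|lebesgue. (norm (?G z) powr (p - 2) *\<^sub>R ?G z) \<bullet> grad_x \<phi> z)
        = (\<integral>z. (\<Sum>i\<in>UNIV. flux p (?G z) $ i * frechet_derivative \<phi> (at z) (axis i 1, 0)) \<partial>lborel)"
        unfolding e using borel_measurable_integrable[OF Bochner_Integration.integrable_sum[of UNIV, OF i]]
        by (intro set_integral_lebesgue_eq_lborel) (auto simp: test_fun_deriv_eq_0[OF \<phi>])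
      also have "\<dots> = (\<Sum>i\<in>UNIV. \<integral>z. flux p (?G z) $ i * frechet_derivative \<phi> (at z) (axis i 1, 0) \<partial>lborel)"
        using i by simp
      finally have 1: "(LINT z:?C|lebesgue. (norm (?G z) powr (p - 2) *\<^sub>R ?G z) \<bullet> grad_x \<phi> z) = \<dots>" .
      have 2: "(LINT z:?C|lebesgue. real_of_ereal (ereal (?h z)) * deriv_t \<phi> z)
          = (\<integral>z. ?h z * frechet_derivative \<phi> (at z) (0, 1) \<partial>lborel)"
        using borel_measurable_integrable[OF test_fun_integrable(2)[OF \<phi> ch]] unfolding deriv_t_def
        by (subst set_integral_lebesgue_eq_lborel) (auto simp: test_fun_deriv_eq_0[OF \<phi>])
      show ?thesis unfolding 1 2 using profile_weak_identity[OF p q c s \<phi>, of y l d] l by simp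
    qed
    ultimately show "in_C_L2 t1 t2 U (\<lambda>z. ereal (?h z)) \<and>
        (\<exists>G. in_Lp_W1p_with_gradient p t1 t2 U (\<lambda>z. ereal (?h z)) G \<and>
          (\<forall>\<phi>. test_fun ?C \<phi> \<longrightarrow>
             (LINT z:?C|lebesgue. (norm (G z) powr (p - 2) *\<^sub>R G z) \<bullet> grad_x \<phi> z)
             - (LINT z:?C|lebesgue. real_of_ereal (ereal (?h z)) * deriv_t \<phi> z) = 0))"
      by blast
  qed
  then show ?thesis unfolding p_parabolic_def using continuous_on_subset[OF ch] by blast
qed

section \<open>Weak gradients on time slices\<close>

lemma Ck_fun_slice:
  fixes \<phi> :: "('a::euclidean_space) \<times> real \<Rightarrow> real"
  shows "Ck_fun k \<phi> \<Longrightarrow> Ck_fun k (\<lambda>x. \<phi> (x, t))"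
proof (induction k arbitrary: \<phi>)
  case 0
  then show ?case by (auto intro!: continuous_on_compose2[of UNIV \<phi>] continuous_intros)
next
  case (Suc k)
  have "((\<lambda>x. \<phi> (x, t)) has_derivative (\<lambda>v. frechet_derivative \<phi> (at (x, t)) (v, 0))) (at x)" for x
    by (rule has_derivative_compose[OF _ Ck_fun_SucD[OF Suc.prems]]) (auto intro!: derivative_eq_intros)
  moreover have "Ck_fun k (\<lambda>x. frechet_derivative \<phi> (at (x, t)) (v, 0))" for v
    using Suc.IH[of "\<lambda>z. frechet_derivative \<phi> (at z) (v, 0)"] Suc.prems by simp
  ultimately show ?case by (rule Ck_fun_SucI)
qed

lemma test_fun_slice:
  fixes \<phi> :: "('a::euclidean_space) \<times> real \<Rightarrow> real"
  assumes \<phi>: "test_fun S \<phi>" and S: "\<And>x. (x, t) \<in> S \<Longrightarrow> x \<in> U"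
  shows "test_fun U (\<lambda>x. \<phi> (x, t))"
    and "frechet_derivative (\<lambda>x. \<phi> (x, t)) (at x) v = frechet_derivative \<phi> (at (x, t)) (v, 0)"
proof -
  let ?K = "closure {z. \<phi> z \<noteq> 0}"
  have K: "compact ?K" "?K \<subseteq> S" and C: "\<And>k. Ck_fun k \<phi>" using \<phi> by (auto simp: test_fun_def)
  let ?L = "(\<lambda>x. (x, t)) -` ?K"
  have "closed ?L" by (intro continuous_closed_vimage closed_closure) (auto intro!: continuous_intros)
  moreover have "{x. \<phi> (x, t) \<noteq> 0} \<subseteq> ?L" using closure_subset[of "{z. \<phi> z \<noteq> 0}"] by auto
  ultimately have L: "closure {x. \<phi> (x, t) \<noteq> 0} \<subseteq> ?L" by (rule closure_minimal[rotated])
  have "bounded ?L"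
    by (rule bounded_subset[OF bounded_fst[OF compact_imp_bounded[OF K(1)]]]) force
  then have "compact (closure {x. \<phi> (x, t) \<noteq> 0})"
    using L by (meson bounded_subset closed_closure compact_eq_bounded_closed)
  moreover have "closure {x. \<phi> (x, t) \<noteq> 0} \<subseteq> U" using L K(2) S by blast
  ultimately show "test_fun U (\<lambda>x. \<phi> (x, t))"
    unfolding test_fun_def using Ck_fun_slice[OF C] by blast
  have "((\<lambda>x. \<phi> (x, t)) has_derivative (\<lambda>v. frechet_derivative \<phi> (at (x, t)) (v, 0))) (at x)" for x
    by (rule has_derivative_compose[OF _ test_fun_has_derivative[OF \<phi>]]) (auto intro!: derivative_eq_intros)
  from frechet_derivative_at[OF this]
  show "frechet_derivative (\<lambda>x. \<phi> (x, t)) (at x) v = frechet_derivative \<phi> (at (x, t)) (v, 0)" by metis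
qed

text \<open>An exceptional set need only be contained in a Borel null set, and it is the sections of the latter that
  are null for almost every time.\<close>

lemma AE_time_slices:
  fixes P :: "('a::euclidean_space) \<times> real \<Rightarrow> bool"
  assumes "AE z in lborel. P z"
  shows "AE t in lborel. AE x in lborel. P (x, t)"
proof -
  obtain N where N: "{z. \<not> P z} \<subseteq> N" "emeasure lborel N = 0" "N \<in> sets borel"
    using assms by (auto elim: AE_E)
  have [measurable]: "N \<in> sets (lborel \<Otimes>\<^sub>M lborel)" using N(3) by (simp only: lborel_prod sets_lborel)
  have "AE z in lborel \<Otimes>\<^sub>M lborel. z \<notin> N"
    using N by (intro AE_not_in) (auto simp: lborel_prod null_sets_def)
  then have "AE x in lborel. AE t in lborel. (x, t) \<notin> N" by (rule lborel_pair.AE_pair)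
  then have "AE t in lborel. AE x in lborel. (x, t) \<notin> N"
  proof (subst (asm) lborel_pair.AE_commute)
    have "{x \<in> space (lborel \<Otimes>\<^sub>M lborel). (fst x, snd x) \<notin> N} = space (lborel \<Otimes>\<^sub>M lborel) - N" by auto
    then show "{x \<in> space (lborel \<Otimes>\<^sub>M lborel). (fst x, snd x) \<notin> N} \<in> sets (lborel \<Otimes>\<^sub>M lborel)"
      by (simp only:) (rule sets.compl_sets, rule \<open>N \<in> sets (lborel \<Otimes>\<^sub>M lborel)\<close>)
  qed
  then show ?thesis
    by eventually_elim (elim AE_mp, use N(1) in \<open>auto intro!: AE_I2\<close>)
qed

lemma test_fun_bounded:
  assumes "test_fun S \<phi>"
  shows "\<exists>C. \<forall>z. \<bar>\<phi> z\<bar> \<le> C" "\<exists>C. \<forall>z. \<bar>frechet_derivative \<phi> (at z) v\<bar> \<le> C"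
proof -
  obtain R where R: "\<And>z. norm z \<ge> R \<Longrightarrow> \<phi> z = 0" "\<And>z v. norm z \<ge> R \<Longrightarrow> frechet_derivative \<phi> (at z) v = 0"
    using test_fun_bounded_support[OF assms] by blast
  have b: "\<exists>C. \<forall>z. \<bar>f z\<bar> \<le> C" if f: "continuous_on UNIV f" "\<And>z. norm z \<ge> R \<Longrightarrow> f z = 0" for f :: "'a \<Rightarrow> real"
  proof -
    have "bounded (f ` cball 0 R)"
      by (intro compact_imp_bounded compact_continuous_image continuous_on_subset[OF f(1)]) auto
    then obtain C where C: "\<And>z. z \<in> cball 0 R \<Longrightarrow> \<bar>f z\<bar> \<le> C" unfolding bounded_iff by (metis image_eqI real_norm_def)
    have "\<bar>f z\<bar> \<le> max C 0" for z
    proof (cases "norm z \<le> R")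
      case True then show ?thesis using C[of z] by (simp add: le_max_iff_disj)
    next
      case False then show ?thesis using f(2)[of z] by simp
    qed
    then show ?thesis by blast
  qed
  show "\<exists>C. \<forall>z. \<bar>\<phi> z\<bar> \<le> C" using b[OF test_fun_continuous[OF assms] R(1)] .
  show "\<exists>C. \<forall>z. \<bar>frechet_derivative \<phi> (at z) v\<bar> \<le> C" using b[OF test_fun_deriv_continuous[OF assms] R(2)] .
qed

text \<open>Passes from the vector identity for the extended-real function on a slice to one component, a
  continuous extension \<open>f'\<close> and a Borel version \<open>Gi\<close>, as Fubini's theorem on space-time requires.\<close>

lemma weak_gradient_component:
  fixes f :: "real^'n \<Rightarrow> real"
  assumes w: "weak_gradient U (\<lambda>x. ereal (f x)) G" and \<psi>: "test_fun U \<psi>"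
    and f': "continuous_on UNIV f'" "\<And>x. x \<in> U \<Longrightarrow> f' x = f x"
    and Gi: "Gi \<in> borel_measurable borel" "AE x in lborel. x \<in> U \<longrightarrow> Gi x = G x $ i"
  shows "(\<integral>x. f' x * frechet_derivative \<psi> (at x) (axis i 1) \<partial>lborel) = - (\<integral>x. Gi x * \<psi> x \<partial>lborel)"
proof -
  let ?K = "closure {x. \<psi> x \<noteq> 0}"
  have K: "compact ?K" "?K \<subseteq> U" using \<psi> by (auto simp: test_fun_def)
  have \<psi>K: "\<psi> x = 0" if "x \<notin> ?K" for x using that closure_subset[of "{x. \<psi> x \<noteq> 0}"] by blast
  obtain C where C: "\<And>x. \<bar>\<psi> x\<bar> \<le> C" using test_fun_bounded(1)[OF \<psi>] by blast
  have "set_integrable lebesgue ?K G" using w K unfolding weak_gradient_def by blast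
  then have iG: "integrable lebesgue (\<lambda>x. indicator ?K x *\<^sub>R G x)" by (simp add: set_integrable_def)
  have [measurable]: "\<psi> \<in> borel_measurable lebesgue"
    using borel_measurable_continuous_onI[OF test_fun_continuous[OF \<psi>]] by (simp add: measurable_completion)
  have i2': "integrable lebesgue (\<lambda>x. \<psi> x *\<^sub>R (indicator ?K x *\<^sub>R G x))"
  proof (rule Bochner_Integration.integrable_bound)
    show "integrable lebesgue (\<lambda>x. C * norm (indicator ?K x *\<^sub>R G x))"
      by (intro integrable_mult_right integrable_norm iG)
    show "(\<lambda>x. \<psi> x *\<^sub>R (indicator ?K x *\<^sub>R G x)) \<in> borel_measurable lebesgue"
      using borel_measurable_integrable[OF iG] by measurable
    show "AE x in lebesgue. norm (\<psi> x *\<^sub>R (indicator ?K x *\<^sub>R G x)) \<le> norm (C * norm (indicator ?K x *\<^sub>R G x))"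
    proof (rule AE_I2)
      fix x show "norm (\<psi> x *\<^sub>R (indicator ?K x *\<^sub>R G x)) \<le> norm (C * norm (indicator ?K x *\<^sub>R G x))"
        using mult_right_mono[OF order_trans[OF C[of x] abs_ge_self[of C]] norm_ge_zero[of "indicator ?K x *\<^sub>R G x"]]
        by (simp only: norm_scaleR abs_mult real_norm_def abs_norm_cancel norm_ge_zero abs_idempotent)
    qed
  qed
  have eq: "indicator U x *\<^sub>R \<psi> x *\<^sub>R G x = \<psi> x *\<^sub>R (indicator ?K x *\<^sub>R G x)" for x
    using \<psi>K[of x] K(2) by (cases "x \<in> ?K") (auto simp: indicator_def)
  have i2: "integrable lebesgue (\<lambda>x. indicator U x *\<^sub>R \<psi> x *\<^sub>R G x)" unfolding eq by (rule i2')
  obtain R where R: "\<And>z. norm z \<ge> R \<Longrightarrow> \<psi> z = 0" "\<And>z v. norm z \<ge> R \<Longrightarrow> frechet_derivative \<psi> (at z) v = 0"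
    using test_fun_bounded_support[OF \<psi>] by blast
  have "continuous_on UNIV (grad \<psi>)"
    unfolding grad_def by (intro continuous_on_vec_lambda test_fun_deriv_continuous[OF \<psi>])
  moreover have g0: "grad \<psi> x = 0" if "norm x \<ge> R" for x
    using that by (simp add: grad_def R vec_eq_iff)
  ultimately have i1: "integrable lborel (\<lambda>x. f' x *\<^sub>R grad \<psi> x)"
    by (intro integrable_continuous_bounded_support[where R = R] continuous_on_scaleR f'(1)) (simp_all add: g0)
  have "(LINT x:U|lebesgue. real_of_ereal (ereal (f x)) *\<^sub>R grad \<psi> x) = (\<integral>x. indicator U x *\<^sub>R (f' x *\<^sub>R grad \<psi> x) \<partial>lebesgue)"
    unfolding set_lebesgue_integral_def by (intro Bochner_Integration.integral_cong) (auto simp: f'(2) indicator_def)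
  also have "\<dots> = (\<integral>x. f' x *\<^sub>R grad \<psi> x \<partial>lborel)"
    using set_integral_lebesgue_eq_lborel[of "\<lambda>x. f' x *\<^sub>R grad \<psi> x" U] borel_measurable_integrable[OF i1]
      test_fun_deriv_eq_0[OF \<psi>] by (auto simp: grad_def vec_eq_iff set_lebesgue_integral_def)
  finally have "(\<integral>x. f' x *\<^sub>R grad \<psi> x \<partial>lborel) = - (\<integral>x. indicator U x *\<^sub>R \<psi> x *\<^sub>R G x \<partial>lebesgue)"
    using w \<psi> unfolding weak_gradient_def set_lebesgue_integral_def by simp
  then have "(\<integral>x. f' x *\<^sub>R grad \<psi> x \<partial>lborel) $ i = - ((\<integral>x. indicator U x *\<^sub>R \<psi> x *\<^sub>R G x \<partial>lebesgue) $ i)" by simp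
  moreover have "(\<integral>x. f' x *\<^sub>R grad \<psi> x \<partial>lborel) $ i = (\<integral>x. f' x * frechet_derivative \<psi> (at x) (axis i 1) \<partial>lborel)"
    using integral_bounded_linear[OF bounded_linear_vec_nth i1, of i] by (simp add: grad_def)
  moreover have "(\<integral>x. indicator U x *\<^sub>R \<psi> x *\<^sub>R G x \<partial>lebesgue) $ i = (\<integral>x. Gi x * \<psi> x \<partial>lborel)"
  proof -
    have "(\<integral>x. indicator U x *\<^sub>R \<psi> x *\<^sub>R G x \<partial>lebesgue) $ i = (\<integral>x. indicator U x * (\<psi> x * G x $ i) \<partial>lebesgue)"
      using integral_bounded_linear[OF bounded_linear_vec_nth i2, of i] by (simp add: mult.assoc)
    also have "\<dots> = (\<integral>x. Gi x * \<psi> x \<partial>lebesgue)"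
    proof (rule integral_cong_AE)
      show "(\<lambda>x. indicator U x * (\<psi> x * G x $ i)) \<in> borel_measurable lebesgue"
        using borel_measurable_integrable[OF integrable_bounded_linear[OF bounded_linear_vec_nth i2, of i]] by (simp add: mult.assoc)
      have [measurable]: "Gi \<in> borel_measurable lebesgue" using Gi(1) by (simp add: measurable_completion)
      show "(\<lambda>x. Gi x * \<psi> x) \<in> borel_measurable lebesgue" by measurable
      show "AE x in lebesgue. indicator U x * (\<psi> x * G x $ i) = Gi x * \<psi> x"
        using AE_completion[OF Gi(2)] by eventually_elim (use test_fun_eq_0[OF \<psi>] in \<open>auto simp: indicator_def\<close>)
    qed
    also have "\<dots> = (\<integral>x. Gi x * \<psi> x \<partial>lborel)"
      using borel_measurable_times[OF Gi(1) borel_measurable_continuous_onI[OF test_fun_continuous[OF \<psi>]]]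
      by (intro integral_completion) simp
    finally show ?thesis .
  qed
  ultimately show ?thesis by simp
qed

section \<open>Comparison of p-parabolic functions with explicit supersolutions\<close>

text \<open>By the Cauchy-Schwarz inequality the claim reduces to the monotonicity of \<open>r \<mapsto> r\<^sup>p\<^sup>-\<^sup>1\<close> on the norms.\<close>

lemma flux_monotone:
  fixes v w :: "real^'n"
  assumes "p > 2"
  shows "(\<Sum>i\<in>UNIV. (flux p v - flux p w) $ i * (v - w) $ i) \<ge> 0"
proof -
  let ?a = "norm v" and ?b = "norm w"
  have sq: "?a powr (p - 2) * ?a = ?a powr (p - 1)" "?b powr (p - 2) * ?b = ?b powr (p - 1)"
    using powr_add[of ?a "p - 2" 1] powr_add[of ?b "p - 2" 1] by (cases "v = 0"; cases "w = 0"; simp)+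
  have "(\<Sum>i\<in>UNIV. (flux p v - flux p w) $ i * (v - w) $ i) = (flux p v - flux p w) \<bullet> (v - w)"
    by (simp add: inner_vec_def)
  also have "\<dots> = ?a powr (p - 2) * ?a * ?a + ?b powr (p - 2) * ?b * ?b
      - (?a powr (p - 2) + ?b powr (p - 2)) * (v \<bullet> w)"
    by (simp add: flux_def inner_diff_left inner_diff_right inner_commute algebra_simps
        power2_norm_eq_inner[symmetric] power2_eq_square)
  finally have eq: "(\<Sum>i\<in>UNIV. (flux p v - flux p w) $ i * (v - w) $ i) = \<dots>" .
  have "(?a powr (p - 2) + ?b powr (p - 2)) * (v \<bullet> w) \<le> (?a powr (p - 2) + ?b powr (p - 2)) * (?a * ?b)"
    using Cauchy_Schwarz_ineq2[of v w] by (intro mult_left_mono) auto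
  then have "(\<Sum>i\<in>UNIV. (flux p v - flux p w) $ i * (v - w) $ i)
     \<ge> ?a powr (p - 2) * ?a * ?a + ?b powr (p - 2) * ?b * ?b - (?a powr (p - 2) + ?b powr (p - 2)) * (?a * ?b)"
    unfolding eq by linarith
  also have "?a powr (p - 2) * ?a * ?a + ?b powr (p - 2) * ?b * ?b - (?a powr (p - 2) + ?b powr (p - 2)) * (?a * ?b)
     = (?a powr (p - 2) * ?a - ?b powr (p - 2) * ?b) * (?a - ?b)" by (simp add: algebra_simps)
  also have "\<dots> = (?a powr (p - 1) - ?b powr (p - 1)) * (?a - ?b)" by (simp only: sq)
  finally have *: "(\<Sum>i\<in>UNIV. (flux p v - flux p w) $ i * (v - w) $ i) \<ge> (?a powr (p - 1) - ?b powr (p - 1)) * (?a - ?b)" .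
  have "(?a powr (p - 1) - ?b powr (p - 1)) * (?a - ?b) \<ge> 0"
  proof (cases "?a \<le> ?b")
    case True
    then have "?a powr (p - 1) \<le> ?b powr (p - 1)" using assms by (intro powr_mono2) auto
    then show ?thesis using True by (intro mult_nonpos_nonpos) auto
  next
    case False
    then have "?b powr (p - 1) \<le> ?a powr (p - 1)" using assms by (intro powr_mono2) auto
    then show ?thesis using False by (intro mult_nonneg_nonneg) auto
  qed
  with * show ?thesis by linarith
qed

lemma norm_flux: "p > 2 \<Longrightarrow> norm (flux p v) = norm v powr (p - 1)"
  unfolding flux_def by (rule norm_norm_powr_scaleR)

lemma abs_diff_powr_le:
  fixes a b :: real
  assumes "r > 0"
  shows "\<bar>a - b\<bar> powr r \<le> 2 powr r * (\<bar>a\<bar> powr r + \<bar>b\<bar> powr r)"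
proof -
  have "\<bar>a - b\<bar> powr r \<le> (2 * max \<bar>a\<bar> \<bar>b\<bar>) powr r" using assms by (intro powr_mono2) auto
  also have "\<dots> = 2 powr r * (max \<bar>a\<bar> \<bar>b\<bar>) powr r" by (simp add: powr_mult)
  also have "(max \<bar>a\<bar> \<bar>b\<bar>) powr r \<le> \<bar>a\<bar> powr r + \<bar>b\<bar> powr r" by (cases "\<bar>a\<bar> \<le> \<bar>b\<bar>") auto
  finally show ?thesis by (simp add: mult_left_mono)
qed

text \<open>Subtracting the equations of \<open>h\<close> and of the explicit function \<open>w\<close> puts \<open>h - w\<close> into the form
  treated above. The pointwise weak gradient on the time slices is first turned into a Borel function
  on space-time.\<close>

lemma weak_solution_comparison_on_compact_level:
  fixes h g :: "(real^'n) \<times> real \<Rightarrow> real" and y :: "real^'n"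
  assumes p: "p > 2" and q: "q = p / (p - 1)" and c: "c \<ge> 0"
    and l: "l \<le> CARD('n) * (c * q) powr (p - 1)"
    and h: "weak_solution p C (\<lambda>z. ereal (h z))"
    and U: "open U" and t: "t1 < t2" and V: "compactly_inside (cylinder U t1 t2) C"
    and g: "continuous_on UNIV g" "uniformly_continuous_on UNIV g" "\<And>z. \<bar>g z\<bar> \<le> B"
    and gh: "\<And>z. z \<in> cylinder U t1 t2 \<Longrightarrow> g z = h z - profile (-1) c q y l d z"
    and S: "compact S" "S \<subseteq> cylinder U t1 t2"
    and e: "e > 0" and level: "\<And>z. snd z \<le> T \<Longrightarrow> g z \<ge> e \<Longrightarrow> z \<in> S"
    and z1: "snd z1 < T"
  shows "g z1 \<le> 3 * e"
proof -
  let ?V = "cylinder U t1 t2"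
  let ?w = "profile (-1) c q y l d"
  let ?W = "\<lambda>z. profile_grad (-1) c q y (fst z) :: real^'n"
  have q1: "q > 1" using p q by simp
  have bU: "bounded U" by (rule cylinder_bounded_base[OF t V])
  have oV: "open ?V" and bV: "bounded ?V" unfolding cylinder_def using U bU by (auto intro: open_Times bounded_Times)
  have VB[measurable]: "?V \<in> sets borel" using oV by simp
  obtain G where G: "in_Lp_W1p_with_gradient p t1 t2 U (\<lambda>z. ereal (h z)) G"
    and Geq: "\<And>\<phi>. test_fun ?V \<phi> \<Longrightarrow> (LINT z:?V|lebesgue. (norm (G z) powr (p - 2) *\<^sub>R G z) \<bullet> grad_x \<phi> z)
             - (LINT z:?V|lebesgue. real_of_ereal (ereal (h z)) * deriv_t \<phi> z) = 0"
    using h U t V unfolding weak_solution_def by blast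
  have Gw: "AE t in lebesgue. t \<in> {t1<..<t2} \<longrightarrow> weak_gradient U (\<lambda>x. ereal (h (x, t))) (\<lambda>x. G (x, t))"
    and Gm: "G \<in> borel_measurable (lebesgue_on ?V)"
    and Gp: "set_integrable lebesgue ?V (\<lambda>z. norm (G z) powr p)"
    using G unfolding in_Lp_W1p_with_gradient_def by auto
  \<comment> \<open>a Borel representative, set to zero outside of the cylinder\<close>
  have "(\<lambda>z. indicator ?V z *\<^sub>R G z) \<in> borel_measurable lebesgue"
    using Gm by (subst (asm) borel_measurable_restrict_space_iff) (auto simp: VB)
  then have "(\<lambda>z. (indicator ?V z *\<^sub>R G z) $ i) \<in> borel_measurable lebesgue" for i
    by (rule measurable_compose) (intro borel_measurable_continuous_onI continuous_intros)
  then have "\<forall>i. \<exists>g'. g' \<in> borel_measurable lborel \<and> (AE z in lborel. (indicator ?V z *\<^sub>R G z) $ i = g' z)"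
    using completion_ex_borel_measurable_real by blast
  from choice[OF this] obtain G0 where G0: "\<And>i. G0 i \<in> borel_measurable lborel"
    "\<And>i. AE z in lborel. (indicator ?V z *\<^sub>R G z) $ i = G0 i z" by blast
  define Gt where "Gt z = indicator ?V z *\<^sub>R (\<chi> i. G0 i z)" for z
  have Gti: "Gt z $ i = indicator ?V z * G0 i z" for z i by (simp add: Gt_def)
  have Gtm_i[measurable]: "(\<lambda>z. Gt z $ i) \<in> borel_measurable borel" for i
    using G0(1)[of i] VB unfolding Gti by simp
  have Gtm[measurable]: "Gt \<in> borel_measurable borel"
  proof (subst borel_measurable_euclidean_space, intro ballI)
    fix b :: "real^'n" assume "b \<in> Basis"
    then obtain i where "b = axis i 1" by (auto simp: Basis_vec_def)
    then show "(\<lambda>z. Gt z \<bullet> b) \<in> borel_measurable borel" using Gtm_i[of i] by (simp add: inner_axis)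
  qed
  have Gae: "AE z in lborel. Gt z = indicator ?V z *\<^sub>R G z"
  proof -
    have "AE z in lborel. \<forall>i. (indicator ?V z *\<^sub>R G z) $ i = G0 i z"
      using G0(2) by (simp add: AE_all_countable)
    then show ?thesis by eventually_elim (auto simp: Gt_def vec_eq_iff indicator_def)
  qed
  have Gt0: "Gt z = 0" if "z \<notin> ?V" for z using that by (simp add: Gt_def)
  have Gtp: "integrable lborel (\<lambda>z. norm (Gt z) powr p)"
  proof -
    have "integrable lebesgue (\<lambda>z. norm (Gt z) powr p)"
    proof (rule integrable_cong_AE_imp)
      show "integrable lebesgue (\<lambda>z. indicator ?V z *\<^sub>R norm (G z) powr p)" using Gp unfolding set_integrable_def .
      have "Gt \<in> borel_measurable lebesgue" using Gtm by (intro measurable_completion) simp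
      then show "(\<lambda>z. norm (Gt z) powr p) \<in> borel_measurable lebesgue" by measurable
      show "AE z in lebesgue. indicator ?V z *\<^sub>R norm (G z) powr p = norm (Gt z) powr p"
        using AE_completion[OF Gae] by eventually_elim (use p in \<open>auto simp: indicator_def\<close>)
    qed
    then show ?thesis by (subst (asm) integrable_completion) auto
  qed
  have cW: "continuous_on UNIV ?W" by (intro profile_grad_continuous q1 continuous_intros)
  have Wm[measurable]: "?W \<in> borel_measurable borel" by (rule borel_measurable_continuous_onI[OF cW])
  have fl: "continuous_on UNIV (flux p :: real^'n \<Rightarrow> real^'n)"
    unfolding flux_def using p by (intro continuous_norm_powr_scaleR continuous_intros) auto
  have flm[measurable]: "(flux p :: real^'n \<Rightarrow> real^'n) \<in> borel_measurable borel" by (rule borel_measurable_continuous_onI[OF fl])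
  have nth_m[measurable]: "(\<lambda>v::real^'n. v $ i) \<in> borel_measurable borel" for i
    by (intro borel_measurable_continuous_onI continuous_intros)
  have ind_int: "integrable lborel (\<lambda>z. indicator ?V z * f z)" if f: "continuous_on UNIV f" for f :: "_ \<Rightarrow> real"
  proof -
    have "set_integrable lebesgue ?V f" by (rule set_integrable_continuous_on_bounded[OF f bV VB])
    moreover have [measurable]: "f \<in> borel_measurable borel" by (rule borel_measurable_continuous_onI[OF f])
    have "(\<lambda>z. indicator ?V z *\<^sub>R f z) \<in> borel_measurable lborel" by measurable
    ultimately show ?thesis unfolding set_integrable_def by (simp add: integrable_completion)
  qed
  have iW: "integrable lborel (\<lambda>z. indicator ?V z * norm (?W z) powr p)"
    by (rule ind_int) (use p in \<open>intro continuous_on_powr' continuous_intros cW, auto\<close>)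
  define F where "F i z = indicator ?V z * (flux p (Gt z) - flux p (?W z)) $ i" for i z
  define H where "H i z = indicator ?V z * (Gt z - ?W z) $ i" for i z
  have Fm[measurable]: "F i \<in> borel_measurable borel" for i unfolding F_def by measurable
  have Hm[measurable]: "H i \<in> borel_measurable borel" for i unfolding H_def by measurable
  have pq: "q > 1" "p > 1" "1/q + 1/p = 1" using p q1 unfolding q by (auto simp: field_simps)
  have pq': "(p - 1) * q = p" using p unfolding q by simp
  have Hp: "integrable lborel (\<lambda>z. \<bar>H i z\<bar> powr p)" for i
  proof (rule Bochner_Integration.integrable_bound)
    show "integrable lborel (\<lambda>z. 2 powr p * (norm (Gt z) powr p + indicator ?V z * norm (?W z) powr p))"
      by (intro integrable_mult_right Bochner_Integration.integrable_add Gtp iW)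
    show "AE z in lborel. norm (\<bar>H i z\<bar> powr p) \<le> norm (2 powr p * (norm (Gt z) powr p + indicator ?V z * norm (?W z) powr p))"
    proof (rule AE_I2)
      fix z
      have "\<bar>Gt z $ i - ?W z $ i\<bar> powr p \<le> 2 powr p * (\<bar>Gt z $ i\<bar> powr p + \<bar>?W z $ i\<bar> powr p)"
        using p by (intro abs_diff_powr_le) auto
      also have "\<dots> \<le> 2 powr p * (norm (Gt z) powr p + norm (?W z) powr p)"
        using p by (intro mult_left_mono add_mono powr_mono2 component_le_norm_cart) auto
      finally show "norm (\<bar>H i z\<bar> powr p) \<le> norm (2 powr p * (norm (Gt z) powr p + indicator ?V z * norm (?W z) powr p))"
        using p by (cases "z \<in> ?V") (auto simp: H_def Gt0)
    qed
  qed measurable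
  have flux_powr: "norm (flux p v) powr q = norm v powr p" for v :: "real^'n"
    unfolding norm_flux[OF p] using pq' by (simp add: powr_powr)
  have Fq: "integrable lborel (\<lambda>z. \<bar>F i z\<bar> powr q)" for i
  proof (rule Bochner_Integration.integrable_bound)
    show "integrable lborel (\<lambda>z. 2 powr q * (norm (Gt z) powr p + indicator ?V z * norm (?W z) powr p))"
      by (intro integrable_mult_right Bochner_Integration.integrable_add Gtp iW)
    show "AE z in lborel. norm (\<bar>F i z\<bar> powr q) \<le> norm (2 powr q * (norm (Gt z) powr p + indicator ?V z * norm (?W z) powr p))"
    proof (rule AE_I2)
      fix z
      have "\<bar>flux p (Gt z) $ i - flux p (?W z) $ i\<bar> powr q \<le> 2 powr q * (\<bar>flux p (Gt z) $ i\<bar> powr q + \<bar>flux p (?W z) $ i\<bar> powr q)"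
        using q1 by (intro abs_diff_powr_le) auto
      also have "\<dots> \<le> 2 powr q * (norm (flux p (Gt z)) powr q + norm (flux p (?W z)) powr q)"
        using q1 by (intro mult_left_mono add_mono powr_mono2 component_le_norm_cart) auto
      finally have "\<bar>flux p (Gt z) $ i - flux p (?W z) $ i\<bar> powr q \<le> 2 powr q * (norm (Gt z) powr p + norm (?W z) powr p)"
        unfolding flux_powr .
      then show "norm (\<bar>F i z\<bar> powr q) \<le> norm (2 powr q * (norm (Gt z) powr p + indicator ?V z * norm (?W z) powr p))"
        using q1 by (cases "z \<in> ?V") (auto simp: F_def Gt0)
    qed
  qed measurable
  have one_plus: "x \<le> 1 + x powr r" if "x \<ge> 0" "r \<ge> 1" for x r :: real
    using powr_mono[of 1 r x] that powr_ge_zero[of x r] by (cases "x \<le> 1") (simp_all del: powr_ge_zero)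
  have iV: "integrable lborel (\<lambda>z. indicator ?V z :: real)" using ind_int[of "\<lambda>_. 1"] by simp
  have F1: "integrable lborel (F i)" for i
  proof (rule Bochner_Integration.integrable_bound[OF Bochner_Integration.integrable_add[OF iV Fq[of i]]])
    show "AE z in lborel. norm (F i z) \<le> norm (indicator ?V z + \<bar>F i z\<bar> powr q)"
    proof (rule AE_I2)
      fix z show "norm (F i z) \<le> norm (indicator ?V z + \<bar>F i z\<bar> powr q)"
        using one_plus[of "\<bar>F i z\<bar>" q] q1 by (cases "z \<in> ?V") (auto simp: F_def)
    qed
  qed measurable
  have mono: "AE z in lborel. (\<Sum>i\<in>UNIV. F i z * H i z) \<ge> 0"
    using flux_monotone[OF p] by (intro AE_I2) (auto simp: F_def H_def indicator_def)
  have cw: "continuous_on UNIV ?w" using q1 by (intro profile_continuous) simp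
  define hh where "hh z = g z + ?w z" for z
  have chh: "continuous_on UNIV hh" unfolding hh_def by (intro continuous_intros g(1) cw)
  have hh: "hh z = h z" if "z \<in> ?V" for z using gh[OF that] by (simp add: hh_def)
  have flG: "integrable lborel (\<lambda>z. flux p (Gt z) $ i)" for i
  proof (rule Bochner_Integration.integrable_bound[OF Bochner_Integration.integrable_add[OF iV Gtp]])
    show "AE z in lborel. norm (flux p (Gt z) $ i) \<le> norm (indicator ?V z + norm (Gt z) powr p)"
    proof (rule AE_I2)
      fix z
      have "\<bar>flux p (Gt z) $ i\<bar> \<le> norm (flux p (Gt z))" by (rule component_le_norm_cart)
      also have "\<dots> \<le> 1 + norm (flux p (Gt z)) powr q" using q1 by (intro one_plus) auto
      finally show "norm (flux p (Gt z) $ i) \<le> norm (indicator ?V z + norm (Gt z) powr p)"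
        unfolding flux_powr by (cases "z \<in> ?V") (auto simp: Gt0 flux_def)
    qed
  qed measurable
  have cflW: "continuous_on UNIV (\<lambda>z. flux p (?W z) $ i)" for i
    by (intro continuous_intros continuous_on_compose2[OF fl cW]) auto
  have weak1: "(\<Sum>i\<in>UNIV. \<integral>z. F i z * frechet_derivative \<phi> (at z) (axis i 1, 0) \<partial>lborel)
        - (\<integral>z. g z * frechet_derivative \<phi> (at z) (0, 1) \<partial>lborel) \<le> 0"
    if \<phi>: "test_fun ?V \<phi>" and \<phi>0: "\<And>z. \<phi> z \<ge> 0" for \<phi>
  proof -
    have dm[measurable]: "(\<lambda>z. frechet_derivative \<phi> (at z) v) \<in> borel_measurable borel" for v
      by (rule borel_measurable_continuous_onI[OF test_fun_deriv_continuous[OF \<phi>]])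
    have iG: "integrable lborel (\<lambda>z. flux p (Gt z) $ i * frechet_derivative \<phi> (at z) v)" for i v
    proof -
      obtain K where "\<And>z. \<bar>frechet_derivative \<phi> (at z) v\<bar> \<le> K" using test_fun_bounded(2)[OF \<phi>] by blast
      from integrable_mult_bounded[OF flG dm this] show ?thesis .
    qed
    note iWf = test_fun_integrable(2)[OF \<phi> cflW]
    have "(\<integral>z. F i z * frechet_derivative \<phi> (at z) (axis i 1, 0) \<partial>lborel)
       = (\<integral>z. flux p (Gt z) $ i * frechet_derivative \<phi> (at z) (axis i 1, 0)
            - flux p (?W z) $ i * frechet_derivative \<phi> (at z) (axis i 1, 0) \<partial>lborel)" for i
    proof (intro Bochner_Integration.integral_cong refl)
      fix z show "F i z * frechet_derivative \<phi> (at z) (axis i 1, 0) = flux p (Gt z) $ i * frechet_derivative \<phi> (at z) (axis i 1, 0)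
            - flux p (?W z) $ i * frechet_derivative \<phi> (at z) (axis i 1, 0)"
        using test_fun_deriv_eq_0[OF \<phi>, of z] by (cases "z \<in> ?V") (auto simp: F_def algebra_simps)
    qed
    then have 1: "(\<integral>z. F i z * frechet_derivative \<phi> (at z) (axis i 1, 0) \<partial>lborel)
       = (\<integral>z. flux p (Gt z) $ i * frechet_derivative \<phi> (at z) (axis i 1, 0) \<partial>lborel)
            - (\<integral>z. flux p (?W z) $ i * frechet_derivative \<phi> (at z) (axis i 1, 0) \<partial>lborel)" for i
      using Bochner_Integration.integral_diff[OF iG iWf] by simp
    have "(\<integral>z. g z * frechet_derivative \<phi> (at z) (0, 1) \<partial>lborel)
       = (\<integral>z. hh z * frechet_derivative \<phi> (at z) (0, 1) - ?w z * frechet_derivative \<phi> (at z) (0, 1) \<partial>lborel)"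
      by (intro Bochner_Integration.integral_cong refl) (simp add: hh_def algebra_simps)
    then have 2: "(\<integral>z. g z * frechet_derivative \<phi> (at z) (0, 1) \<partial>lborel)
       = (\<integral>z. hh z * frechet_derivative \<phi> (at z) (0, 1) \<partial>lborel) - (\<integral>z. ?w z * frechet_derivative \<phi> (at z) (0, 1) \<partial>lborel)"
      using Bochner_Integration.integral_diff[OF test_fun_integrable(2)[OF \<phi> chh] test_fun_integrable(2)[OF \<phi> cw]] by simp
    have 3: "(LINT z:?V|lebesgue. real_of_ereal (ereal (h z)) * deriv_t \<phi> z) = (\<integral>z. hh z * frechet_derivative \<phi> (at z) (0, 1) \<partial>lborel)"
    proof -
      have "(LINT z:?V|lebesgue. real_of_ereal (ereal (h z)) * deriv_t \<phi> z) = (LINT z:?V|lebesgue. hh z * frechet_derivative \<phi> (at z) (0, 1))"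
        unfolding set_lebesgue_integral_def
        by (intro Bochner_Integration.integral_cong refl) (auto simp: hh indicator_def deriv_t_def)
      also have "\<dots> = (\<integral>z. hh z * frechet_derivative \<phi> (at z) (0, 1) \<partial>lborel)"
        using borel_measurable_integrable[OF test_fun_integrable(2)[OF \<phi> chh]]
        by (intro set_integral_lebesgue_eq_lborel) (auto simp: test_fun_deriv_eq_0[OF \<phi>])
      finally show ?thesis .
    qed
    have 4: "(LINT z:?V|lebesgue. (norm (G z) powr (p - 2) *\<^sub>R G z) \<bullet> grad_x \<phi> z)
       = (\<Sum>i\<in>UNIV. \<integral>z. flux p (Gt z) $ i * frechet_derivative \<phi> (at z) (axis i 1, 0) \<partial>lborel)"
    proof -
      let ?I = "\<lambda>z. \<Sum>i\<in>UNIV. flux p (Gt z) $ i * frechet_derivative \<phi> (at z) (axis i 1, 0)"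
      have Im: "?I \<in> borel_measurable borel" by measurable
      have "(LINT z:?V|lebesgue. (norm (G z) powr (p - 2) *\<^sub>R G z) \<bullet> grad_x \<phi> z)
         = (\<integral>z. indicator ?V z *\<^sub>R ((norm (indicator ?V z *\<^sub>R G z) powr (p - 2) *\<^sub>R (indicator ?V z *\<^sub>R G z)) \<bullet> grad_x \<phi> z) \<partial>lebesgue)"
        unfolding set_lebesgue_integral_def by (intro Bochner_Integration.integral_cong refl) (auto simp: indicator_def)
      also have "\<dots> = (\<integral>z. ?I z \<partial>lebesgue)"
      proof (rule integral_cong_AE)
        have cgx: "continuous_on UNIV (grad_x \<phi>)"
          unfolding grad_x_def by (intro continuous_on_vec_lambda test_fun_deriv_continuous[OF \<phi>])
        have gx: "grad_x \<phi> \<in> borel_measurable lebesgue"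
          using borel_measurable_continuous_onI[OF cgx] by (intro measurable_completion) simp
        have "(\<lambda>z. flux p (indicator ?V z *\<^sub>R G z)) \<in> borel_measurable lebesgue"
          by (rule measurable_compose[OF \<open>(\<lambda>z. indicator ?V z *\<^sub>R G z) \<in> borel_measurable lebesgue\<close> flm])
        then have "(\<lambda>z. flux p (indicator ?V z *\<^sub>R G z) \<bullet> grad_x \<phi> z) \<in> borel_measurable lebesgue"
          by (rule borel_measurable_inner[OF _ gx])
        moreover have "(indicator ?V :: _ \<Rightarrow> real) \<in> borel_measurable lebesgue"
          using VB by (intro borel_measurable_indicator) auto
        ultimately show "(\<lambda>z. indicator ?V z *\<^sub>R ((norm (indicator ?V z *\<^sub>R G z) powr (p - 2) *\<^sub>R (indicator ?V z *\<^sub>R G z)) \<bullet> grad_x \<phi> z)) \<in> borel_measurable lebesgue"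
          unfolding flux_def by (intro borel_measurable_scaleR)
        show "?I \<in> borel_measurable lebesgue" using Im by (intro measurable_completion) simp
        show "AE z in lebesgue. indicator ?V z *\<^sub>R ((norm (indicator ?V z *\<^sub>R G z) powr (p - 2) *\<^sub>R (indicator ?V z *\<^sub>R G z)) \<bullet> grad_x \<phi> z) = ?I z"
          using AE_completion[OF Gae]
        proof eventually_elim
          fix z assume *: "Gt z = indicator ?V z *\<^sub>R G z"
          show "indicator ?V z *\<^sub>R ((norm (indicator ?V z *\<^sub>R G z) powr (p - 2) *\<^sub>R (indicator ?V z *\<^sub>R G z)) \<bullet> grad_x \<phi> z) = ?I z"
            unfolding *[symmetric] using Gt0[of z]
            by (cases "z \<in> ?V") (auto simp: flux_def inner_vec_def grad_x_def)
        qed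
      qed
      also have "\<dots> = (\<integral>z. ?I z \<partial>lborel)" using Im by (intro integral_completion) simp
      also have "\<dots> = (\<Sum>i\<in>UNIV. \<integral>z. flux p (Gt z) $ i * frechet_derivative \<phi> (at z) (axis i 1, 0) \<partial>lborel)"
        using iG by simp
      finally show ?thesis .
    qed
    have "(\<Sum>i\<in>UNIV. \<integral>z. flux p (?W z) $ i * frechet_derivative \<phi> (at z) (axis i 1, 0) \<partial>lborel)
        - (\<integral>z. ?w z * frechet_derivative \<phi> (at z) (0, 1) \<partial>lborel) = - 1 * (l - CARD('n) * (c * q) powr (p - 1)) * (\<integral>z. \<phi> z \<partial>lborel)"
      by (rule profile_weak_identity[OF p q c _ \<phi>]) simp
    moreover have "(\<integral>z. \<phi> z \<partial>lborel) \<ge> 0" using \<phi>0 by simp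
    then have "- 1 * (l - CARD('n) * (c * q) powr (p - 1)) * (\<integral>z. \<phi> z \<partial>lborel) \<ge> 0" using l by (simp add: mult_nonpos_nonneg)
    ultimately show ?thesis using Geq[OF \<phi>] unfolding 1 2 3 4 sum_subtractf by linarith
  qed
  have weak2: "(\<integral>z. g z * frechet_derivative \<phi> (at z) (axis i 1, 0) \<partial>lborel) = - (\<integral>z. H i z * \<phi> z \<partial>lborel)"
    if \<phi>: "test_fun ?V \<phi>" for \<phi> i
  proof -
    let ?d = "\<lambda>z. frechet_derivative \<phi> (at z) (axis i 1, 0)"
    obtain K where K: "\<And>z. \<bar>\<phi> z\<bar> \<le> K" using test_fun_bounded(1)[OF \<phi>] by blast
    have \<phi>m[measurable]: "\<phi> \<in> borel_measurable borel" by (rule borel_measurable_continuous_onI[OF test_fun_continuous[OF \<phi>]])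
    have Gt1: "integrable lborel (\<lambda>z. Gt z $ i)"
    proof (rule Bochner_Integration.integrable_bound[OF Bochner_Integration.integrable_add[OF iV Gtp]])
      show "AE z in lborel. norm (Gt z $ i) \<le> norm (indicator ?V z + norm (Gt z) powr p)"
      proof (rule AE_I2)
        fix z
        have "\<bar>Gt z $ i\<bar> \<le> norm (Gt z)" by (rule component_le_norm_cart)
        also have "\<dots> \<le> 1 + norm (Gt z) powr p" using p by (intro one_plus) auto
        finally show "norm (Gt z $ i) \<le> norm (indicator ?V z + norm (Gt z) powr p)"
          by (cases "z \<in> ?V") (auto simp: Gt0)
      qed
    qed measurable
    have iG: "integrable lborel (\<lambda>z. Gt z $ i * \<phi> z)" by (rule integrable_mult_bounded[OF Gt1 \<phi>m K])
    have ih: "integrable lborel (\<lambda>z. hh z * ?d z)" by (rule test_fun_integrable(2)[OF \<phi> chh])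
    have cWi: "continuous_on UNIV (\<lambda>z. ?W z $ i)" by (intro continuous_intros cW)
    have slices: "AE t in lborel. (\<integral>x. hh (x, t) * ?d (x, t) \<partial>lborel) = - (\<integral>x. Gt (x, t) $ i * \<phi> (x, t) \<partial>lborel)"
    proof -
      have "AE t in lborel. t \<in> {t1<..<t2} \<longrightarrow> weak_gradient U (\<lambda>x. ereal (h (x, t))) (\<lambda>x. G (x, t))"
        using Gw by (simp only: AE_completion_iff)
      moreover have "AE t in lborel. AE x in lborel. Gt (x, t) = indicator ?V (x, t) *\<^sub>R G (x, t)"
        by (rule AE_time_slices[OF Gae])
      ultimately show ?thesis
      proof eventually_elim
        fix t assume w: "t \<in> {t1<..<t2} \<longrightarrow> weak_gradient U (\<lambda>x. ereal (h (x, t))) (\<lambda>x. G (x, t))"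
          and ae: "AE x in lborel. Gt (x, t) = indicator ?V (x, t) *\<^sub>R G (x, t)"
        show "(\<integral>x. hh (x, t) * ?d (x, t) \<partial>lborel) = - (\<integral>x. Gt (x, t) $ i * \<phi> (x, t) \<partial>lborel)"
        proof (cases "t \<in> {t1<..<t2}")
          case False
          then have "(x, t) \<notin> ?V" for x by (auto simp: cylinder_def)
          then show ?thesis by (simp add: Gt0 test_fun_deriv_eq_0[OF \<phi>])
        next
          case True
          then have inV: "x \<in> U \<longleftrightarrow> (x, t) \<in> ?V" for x by (auto simp: cylinder_def)
          have sl: "test_fun U (\<lambda>x. \<phi> (x, t))" by (rule test_fun_slice(1)[OF \<phi>]) (use inV in blast)
          have "(\<integral>x. hh (x, t) * frechet_derivative (\<lambda>x. \<phi> (x, t)) (at x) (axis i 1) \<partial>lborel) = - (\<integral>x. Gt (x, t) $ i * \<phi> (x, t) \<partial>lborel)"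
          proof (rule weak_gradient_component[OF w[rule_format, OF True] sl])
            show "continuous_on UNIV (\<lambda>x. hh (x, t))"
              by (rule continuous_on_compose2[OF chh]) (auto intro!: continuous_intros)
            show "hh (x, t) = h (x, t)" if "x \<in> U" for x using hh inV that by blast
            have "(\<lambda>x. (x, t)) \<in> borel_measurable borel" by (intro borel_measurable_continuous_onI continuous_intros)
            from measurable_compose[OF this Gtm_i[of i]] show "(\<lambda>x. Gt (x, t) $ i) \<in> borel_measurable borel" .
            show "AE x in lborel. x \<in> U \<longrightarrow> Gt (x, t) $ i = G (x, t) $ i"
              using ae by eventually_elim (simp add: inV)
          qed
          moreover have "frechet_derivative (\<lambda>x. \<phi> (x, t)) (at x) (axis i 1) = ?d (x, t)" for x
            by (rule test_fun_slice(2)[OF \<phi>, of t U]) (use inV in blast)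
          ultimately show ?thesis by simp
        qed
      qed
    qed
    have fub: "(\<integral>z. f z \<partial>lborel) = (\<integral>t. (\<integral>x. f (x, t) \<partial>lborel) \<partial>lborel)" and fubm: "(\<lambda>t. \<integral>x. f (x, t) \<partial>lborel) \<in> borel_measurable lborel"
      if "integrable lborel f" for f :: "(real^'n) \<times> real \<Rightarrow> real"
    proof -
      have i: "integrable (lborel \<Otimes>\<^sub>M lborel) (\<lambda>(x, t). f (x, t))" using that by (simp add: lborel_prod)
      show "(\<integral>z. f z \<partial>lborel) = (\<integral>t. (\<integral>x. f (x, t) \<partial>lborel) \<partial>lborel)"
        using lborel_pair.integral_snd[OF i] by (simp add: lborel_prod)
      show "(\<lambda>t. \<integral>x. f (x, t) \<partial>lborel) \<in> borel_measurable lborel"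
        using lborel_pair.integrable_snd[OF i] by (rule borel_measurable_integrable)
    qed
    have "(\<integral>z. hh z * ?d z \<partial>lborel) = (\<integral>t. (\<integral>x. hh (x, t) * ?d (x, t) \<partial>lborel) \<partial>lborel)" by (rule fub[OF ih])
    also have "\<dots> = (\<integral>t. - (\<integral>x. Gt (x, t) $ i * \<phi> (x, t) \<partial>lborel) \<partial>lborel)"
      using fubm[OF ih] fubm[OF iG] slices by (intro integral_cong_AE) auto
    also have "\<dots> = - (\<integral>z. Gt z $ i * \<phi> z \<partial>lborel)" using fub[OF iG] by simp
    finally have 1: "(\<integral>z. hh z * ?d z \<partial>lborel) = - (\<integral>z. Gt z $ i * \<phi> z \<partial>lborel)" .
    have 2: "(\<integral>z. ?w z * ?d z \<partial>lborel) = - (\<integral>z. ?W z $ i * \<phi> z \<partial>lborel)"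
      by (rule profile_weak_gradient_identity[OF q1 \<phi>])
    have "(\<integral>z. g z * ?d z \<partial>lborel) = (\<integral>z. hh z * ?d z - ?w z * ?d z \<partial>lborel)"
      by (intro Bochner_Integration.integral_cong refl) (simp add: hh_def algebra_simps)
    also have "\<dots> = - (\<integral>z. Gt z $ i * \<phi> z \<partial>lborel) + (\<integral>z. ?W z $ i * \<phi> z \<partial>lborel)"
      using Bochner_Integration.integral_diff[OF ih test_fun_integrable(2)[OF \<phi> cw]] 1 2 by simp
    also have "\<dots> = - (\<integral>z. Gt z $ i * \<phi> z - ?W z $ i * \<phi> z \<partial>lborel)"
      using Bochner_Integration.integral_diff[OF iG test_fun_integrable(1)[OF \<phi> cWi]] by simp
    also have "(\<integral>z. Gt z $ i * \<phi> z - ?W z $ i * \<phi> z \<partial>lborel) = (\<integral>z. H i z * \<phi> z \<partial>lborel)"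
    proof (intro Bochner_Integration.integral_cong refl)
      fix z show "Gt z $ i * \<phi> z - ?W z $ i * \<phi> z = H i z * \<phi> z"
        using test_fun_eq_0[OF \<phi>, of z] by (cases "z \<in> ?V") (auto simp: H_def algebra_simps)
    qed
    finally show ?thesis .
  qed
  show ?thesis
    by (rule monotone_flux_comparison[OF pq g Fm Hm Fq Hp F1 mono S oV e level weak1 weak2 z1])
qed

lemma box_Pair: "box (a, c) (b, d) = box a b \<times> box c d"
  by (auto simp: box_def Basis_prod_def ball_Un)

lemma clamp_inner_Basis:
  assumes "\<And>i. i \<in> Basis \<Longrightarrow> a \<bullet> i \<le> b \<bullet> i" "i \<in> Basis"
  shows "clamp a b x \<bullet> i = (if x \<bullet> i < a \<bullet> i then a \<bullet> i else if x \<bullet> i \<le> b \<bullet> i then x \<bullet> i else b \<bullet> i)"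
  using assms by (simp add: clamp_def)

lemma parabolic_boundary_box:
  fixes a b :: "real^'n"
  assumes ne: "box a b \<noteq> {}"
    and z: "z \<in> cbox (a, t1) (b, t2)" "z \<notin> box (a, t1) (b, t2)" "snd z < t2"
  shows "z \<in> parabolic_boundary (box a b) t1 t2"
proof -
  obtain x s where xs: "z = (x, s)" by (cases z)
  have "x \<in> cbox a b" "t1 \<le> s" "s < t2" "x \<in> box a b \<longrightarrow> s = t1"
    using z unfolding xs by (auto simp: box_Pair cbox_Pair_eq)
  then show ?thesis using ne unfolding xs parabolic_boundary_def
    by (cases "s = t1") (auto simp: closure_box frontier_box)
qed

lemma closure_cylinder_box:
  fixes a b :: "real^'n"
  assumes "box a b \<noteq> {}" "t1 < t2"
  shows "closure (cylinder (box a b) t1 t2) = cbox (a, t1) (b, t2)"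
  using assms by (simp add: cylinder_def closure_Times closure_box cbox_Pair_eq)

lemma cylinder_box_eq:
  fixes a b :: "real^'n"
  shows "cylinder (box a b) t1 t2 = box (a, t1) (b, t2)"
  by (simp add: cylinder_def box_Pair box_real)

text \<open>Clamping to the closed box extends \<open>g = h - w\<close> continuously to the whole space, with values \<open>\<le> 0\<close> outside of the
  open box before the time \<open>t2\<close>. The superlevel sets of \<open>g\<close> up to a time \<open>T < t2\<close> are therefore compact
  subsets of the open box, and a slightly smaller cylinder contains them.\<close>

lemma explicit_supersolution_comparison:
  fixes a b y :: "real^'n"
  assumes p: "p > 2" and q: "q = p / (p - 1)" and c: "c \<ge> 0"
    and l: "l \<le> CARD('n) * (c * q) powr (p - 1)"
    and t: "t1 < t2" and h: "p_parabolic p (cylinder (box a b) t1 t2) h"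
    and ch: "continuous_on (closure (cylinder (box a b) t1 t2)) h"
    and bdry: "\<And>z. z \<in> parabolic_boundary (box a b) t1 t2 \<Longrightarrow> h z \<le> profile (-1) c q y l d z"
    and z: "z1 \<in> cylinder (box a b) t1 t2"
  shows "h z1 \<le> profile (-1) c q y l d z1"
proof -
  let ?w = "profile (-1) c q y l d"
  let ?A = "(a, t1)" and ?B = "(b, t2)"
  have q1: "q > 0" using p q by simp
  have ne: "box a b \<noteq> {}" using z by (auto simp: cylinder_def)
  note cl = closure_cylinder_box[OF ne t]
  have C: "cylinder (box a b) t1 t2 = box ?A ?B" by (rule cylinder_box_eq)
  have AB: "?A \<bullet> i \<le> ?B \<bullet> i" if "i \<in> Basis" for i
    using z that unfolding C mem_box by (meson less_le_trans less_imp_le)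
  define g0 where "g0 z = h z - ?w z" for z
  have cw: "continuous_on UNIV ?w" by (rule profile_continuous[OF q1])
  have cg0: "continuous_on (cbox ?A ?B) g0"
    using ch unfolding g0_def cl by (intro continuous_intros continuous_on_subset[OF cw]) auto
  define g where "g z = g0 (clamp ?A ?B z)" for z
  have cg: "continuous_on UNIV g" unfolding g_def by (rule clamp_continuous_on[OF cg0])
  have "bounded (range g)" unfolding g_def
    by (intro clamp_bounded compact_imp_bounded compact_continuous_image cg0 compact_cbox)
  then obtain B where B: "\<And>z. \<bar>g z\<bar> \<le> B" unfolding bounded_iff by auto
  have ug: "uniformly_continuous_on UNIV g"
  proof -
    have "uniformly_continuous_on (cbox ?A ?B) g0" by (rule compact_uniformly_continuous[OF cg0 compact_cbox])
    then show ?thesis unfolding uniformly_continuous_on_def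
    proof (intro allI impI)
      fix e :: real assume u: "\<forall>e>0. \<exists>d>0. \<forall>x\<in>cbox ?A ?B. \<forall>x'\<in>cbox ?A ?B. dist x' x < d \<longrightarrow> dist (g0 x') (g0 x) < e"
        and "e > 0"
      then obtain d where d: "d > 0"
        "\<And>x x'. x \<in> cbox ?A ?B \<Longrightarrow> x' \<in> cbox ?A ?B \<Longrightarrow> dist x' x < d \<Longrightarrow> dist (g0 x') (g0 x) < e" by blast
      have "dist (g x') (g x) < e" if "dist x' x < d" for x x'
        unfolding g_def
        by (intro d(2) clamp_in_interval AB le_less_trans[OF dist_clamps_le_dist_args that])
      then show "\<exists>d>0. \<forall>x\<in>UNIV. \<forall>x'\<in>UNIV. dist x' x < d \<longrightarrow> dist (g x') (g x) < e" using d(1) by blast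
    qed
  qed
  have g_in: "g z = h z - ?w z" if "z \<in> cbox ?A ?B" for z
    using clamp_cancel_cbox[OF that] by (simp add: g_def g0_def)
  have g_out: "g z \<le> 0" if z: "z \<notin> box ?A ?B" "snd z < t2" for z
  proof -
    let ?z = "clamp ?A ?B z"
    have "?z \<in> cbox ?A ?B" by (rule clamp_in_interval[OF AB])
    moreover have "?z \<notin> box ?A ?B"
    proof -
      obtain i where i: "i \<in> Basis" "\<not> (?A \<bullet> i < z \<bullet> i \<and> z \<bullet> i < ?B \<bullet> i)" using z(1) unfolding mem_box by blast
      then have "\<not> (?A \<bullet> i < ?z \<bullet> i \<and> ?z \<bullet> i < ?B \<bullet> i)"
        using clamp_inner_Basis[OF AB i(1), of z] AB[OF i(1)] by (simp split: if_splits)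
      then show ?thesis using i(1) unfolding mem_box by blast
    qed
    moreover have "snd ?z < t2"
    proof -
      have B01: "(0, 1) \<in> (Basis :: ((real^'n) \<times> real) set)" by (simp add: Basis_prod_def)
      have "w \<bullet> (0, 1) = snd w" for w :: "(real^'n) \<times> real" by (simp add: inner_prod_def)
      then show ?thesis using clamp_inner_Basis[OF AB B01, of z] z(2) t by (simp split: if_splits)
    qed
    ultimately have "?z \<in> parabolic_boundary (box a b) t1 t2" by (rule parabolic_boundary_box[OF ne])
    then show ?thesis using bdry unfolding g_def g0_def by (simp add: diff_le_0_iff_le)
  qed
  have "g z1 \<le> 3 * e" if e: "e > 0" for e
  proof -
    have z1t: "snd z1 < t2" using z by (auto simp: cylinder_def)
    then obtain T where T: "snd z1 < T" "T < t2" using dense by blast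
    define S where "S = {z \<in> cbox ?A ?B. snd z \<le> T \<and> g z \<ge> e}"
    have S_eq: "S = cbox ?A ?B \<inter> ({z. snd z \<le> T} \<inter> {z. e \<le> g z})" by (auto simp: S_def)
    have "closed ({z::(real^'n) \<times> real. snd z \<le> T} \<inter> {z. e \<le> g z})"
      by (intro closed_Int closed_Collect_le continuous_intros cg)
    then have cS: "compact S" unfolding S_eq by (intro compact_Int_closed compact_cbox)
    have SC: "S \<subseteq> box ?A ?B" using g_out T e unfolding S_def by force
    show ?thesis
    proof (cases "S = {}")
      case True
      have "z1 \<in> cbox ?A ?B" using z box_subset_cbox unfolding C by blast
      moreover have "\<not> (z1 \<in> cbox ?A ?B \<and> snd z1 \<le> T \<and> g z1 \<ge> e)" using True unfolding S_def by blast
      ultimately have "g z1 < e" using T(1) by linarith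
      then show ?thesis using e by linarith
    next
      case False
      obtain r where r: "r > 0" "(\<Union>x\<in>S. cball x r) \<subseteq> box ?A ?B"
        using compact_subset_open_imp_cball_epsilon_subset[OF cS open_box SC] by auto
      define a' where "a' = a + (r/2) *\<^sub>R One"
      define b' where "b' = b - (r/2) *\<^sub>R One"
      define s1 where "s1 = t1 + r/2"
      define s2 where "s2 = t2 - r/2"
      have Ai: "(a', s1) \<bullet> i = ?A \<bullet> i + r/2" and Bi: "(b', s2) \<bullet> i = ?B \<bullet> i - r/2" if "i \<in> Basis" for i :: "(real^'n) \<times> real"
        using that by (auto simp: a'_def b'_def s1_def s2_def Basis_prod_def inner_prod_def inner_add_left inner_diff_left)
      have SV: "S \<subseteq> box (a', s1) (b', s2)"
      proof
        fix z assume z: "z \<in> S"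
        show "z \<in> box (a', s1) (b', s2)" unfolding mem_box
        proof (intro ballI)
          fix i :: "(real^'n) \<times> real" assume i: "i \<in> Basis"
          have n: "norm i = 1" using i by simp
          have "z + r *\<^sub>R i \<in> cball z r" "z - r *\<^sub>R i \<in> cball z r"
            using r(1) n by (simp_all add: dist_norm)
          then have "z + r *\<^sub>R i \<in> box ?A ?B" "z - r *\<^sub>R i \<in> box ?A ?B"
            using r(2) z by blast+
          then have "(z + r *\<^sub>R i) \<bullet> i < ?B \<bullet> i" "?A \<bullet> i < (z - r *\<^sub>R i) \<bullet> i"
            using i unfolding mem_box by blast+
          then show "(a', s1) \<bullet> i < z \<bullet> i \<and> z \<bullet> i < (b', s2) \<bullet> i"
            unfolding Ai[OF i] Bi[OF i] using r(1) i by (simp add: inner_add_left inner_diff_left)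
        qed
      qed
      have V: "cylinder (box a' b') s1 s2 = box (a', s1) (b', s2)" by (rule cylinder_box_eq)
      obtain z0 where "z0 \<in> S" using False by blast
      then have z0: "z0 \<in> box a' b' \<times> {s1<..<s2}" using SV by (auto simp: box_Pair box_real)
      then have s: "s1 < s2" and ne': "box a' b' \<noteq> {}" by auto
      have sub: "cbox (a', s1) (b', s2) \<subseteq> box ?A ?B"
      proof
        fix z assume z: "z \<in> cbox (a', s1) (b', s2)"
        show "z \<in> box ?A ?B" unfolding mem_box
        proof (intro ballI)
          fix i :: "(real^'n) \<times> real" assume i: "i \<in> Basis"
          then have "(a', s1) \<bullet> i \<le> z \<bullet> i \<and> z \<bullet> i \<le> (b', s2) \<bullet> i" using z unfolding mem_box by blast
          then show "?A \<bullet> i < z \<bullet> i \<and> z \<bullet> i < ?B \<bullet> i" unfolding Ai[OF i] Bi[OF i] using r(1) by linarith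
        qed
      qed
      show ?thesis
      proof (rule weak_solution_comparison_on_compact_level[OF p q c l _ open_box s _ cg ug B _ cS _ e _ T(1)])
        show "weak_solution p (cylinder (box a b) t1 t2) (\<lambda>z. ereal (h z))" using h by (simp add: p_parabolic_def)
        show "compactly_inside (cylinder (box a' b') s1 s2) (cylinder (box a b) t1 t2)"
          unfolding compactly_inside_def closure_cylinder_box[OF ne' s] C using sub compact_cbox by blast
        show "g z = h z - ?w z" if "z \<in> cylinder (box a' b') s1 s2" for z
          using that sub box_subset_cbox unfolding V by (intro g_in) blast
        show "S \<subseteq> cylinder (box a' b') s1 s2" unfolding V by (rule SV)
        show "z \<in> S" if "snd z \<le> T" "e \<le> g z" for z
        proof -
          have "z \<in> box ?A ?B" using g_out[of z] that T e by force
          then show ?thesis using that box_subset_cbox unfolding S_def by blast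
        qed
      qed
    qed
  qed
  then have "g z1 \<le> 0 + e" if "e > 0" for e using that[THEN divide_pos_pos, of 3] by fastforce
  then have "g z1 \<le> 0" by (rule field_le_epsilon)
  moreover have "z1 \<in> cbox ?A ?B" using z box_subset_cbox unfolding C by blast
  ultimately show ?thesis using g_in by fastforce
qed

section \<open>Comparison of superparabolic functions with explicit subsolutions\<close>

text \<open>Bernoulli's inequality for real exponents, in strict form.\<close>

lemma powr_gt_tangent_at_1:
  fixes u :: real
  assumes q: "q > 1" and u: "u \<ge> 0" "u \<noteq> 1"
  shows "u powr q > 1 + q * (u - 1)"
proof -
  define f where "f u = u powr q - q * u" for u :: real
  have c: "continuous_on {a..b} f" if "a \<ge> 0" for a b
    unfolding f_def using q that by (intro continuous_intros continuous_on_powr') auto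
  have der: "(f has_real_derivative q * (x powr (q - 1) - 1)) (at x)" if "x > 0" for x
    unfolding f_def using that by (auto intro!: derivative_eq_intros simp: algebra_simps)
  have "f 1 < f u"
  proof (cases "u > 1")
    case True
    then show ?thesis
    proof (rule DERIV_pos_imp_increasing_open)
      fix x assume x: "1 < x" "x < u"
      have "x powr 0 < x powr (q - 1)" using x q by (intro powr_less_mono) auto
      then have "q * (x powr (q - 1) - 1) > 0" using x q by simp
      then show "\<exists>y. DERIV f x :> y \<and> 0 < y" using der[of x] x by auto
    qed (rule c, simp)
  next
    case False
    then have "u < 1" using u by simp
    then show ?thesis
    proof (rule DERIV_neg_imp_decreasing_open)
      fix x assume x: "u < x" "x < 1"
      then have x0: "x > 0" using u by linarith
      have "x powr (q - 1) < 1 powr (q - 1)" using x x0 q by (intro powr_less_mono2) auto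
      then have "q * (x powr (q - 1) - 1) < 0" using q by (simp add: mult_pos_neg)
      then show "\<exists>y. DERIV f x :> y \<and> y < 0" using der[OF x0] by auto
    qed (rule c, rule u(1))
  qed
  then show ?thesis by (simp add: f_def algebra_simps)
qed

lemma powr_gt_tangent:
  fixes s t :: real
  assumes q: "q > 1" and s: "s \<ge> 0" and t: "t > 0" and st: "s \<noteq> t"
  shows "s powr q > t powr q + q * t powr (q - 1) * (s - t)"
proof -
  have "(s / t) powr q > 1 + q * (s / t - 1)" using assms by (intro powr_gt_tangent_at_1) auto
  then have "t powr q * (1 + q * (s / t - 1)) < t powr q * (s / t) powr q" using t by (intro mult_strict_left_mono) auto
  also have "t powr q * (s / t) powr q = s powr q" using s t by (simp add: powr_divide)
  also have "t powr q * (1 + q * (s / t - 1)) = t powr q + q * (t powr q / t) * (s - t)" using t by (simp add: field_simps)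
  also have "t powr q / t = t powr (q - 1)" using t by (simp add: powr_diff)
  finally show ?thesis .
qed

text \<open>Strict convexity of \<open>s \<mapsto> s\<^sup>q\<close>, from the tangent at the weighted mean of \<open>a\<close> and \<open>b\<close>.\<close>

lemma weighted_powr_le:
  fixes a b :: real
  assumes q: "q > 1" and m: "m > 0" and ab: "a \<ge> 0" "b \<ge> 0"
  shows "(1 + m) powr (1 - q) * (a + m * b) powr q \<le> a powr q + m * b powr q"
    and "a \<noteq> b \<Longrightarrow> (1 + m) powr (1 - q) * (a + m * b) powr q < a powr q + m * b powr q"
proof -
  define t where "t = (a + m * b) / (1 + m)"
  have ab_t: "a + m * b = (1 + m) * t" unfolding t_def using m by simp
  have t0: "t \<ge> 0" unfolding t_def using m ab by simp
  have eq: "(1 + m) powr (1 - q) * (a + m * b) powr q = (1 + m) * t powr q"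
    unfolding ab_t using m t0 by (simp add: powr_mult powr_diff)
  show strict: "(1 + m) powr (1 - q) * (a + m * b) powr q < a powr q + m * b powr q" if ne: "a \<noteq> b"
  proof -
    have t: "t > 0"
    proof (rule ccontr)
      assume "\<not> t > 0"
      then have "a + m * b = 0" using ab_t t0 by simp
      then have "a = 0" "m * b = 0" using ab m by (auto simp: add_nonneg_eq_0_iff)
      then show False using m ne by simp
    qed
    have "a \<noteq> t" "b \<noteq> t" using ab_t ne m by (auto simp: algebra_simps)
    then have "a powr q > t powr q + q * t powr (q - 1) * (a - t)" "b powr q > t powr q + q * t powr (q - 1) * (b - t)"
      using powr_gt_tangent[OF q _ t] ab by auto
    then have "a powr q + m * b powr q > (t powr q + q * t powr (q - 1) * (a - t)) + m * (t powr q + q * t powr (q - 1) * (b - t))"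
      using m by (intro add_strict_mono mult_strict_left_mono) auto
    also have "(t powr q + q * t powr (q - 1) * (a - t)) + m * (t powr q + q * t powr (q - 1) * (b - t))
       = (1 + m) * t powr q + q * t powr (q - 1) * ((a + m * b) - (1 + m) * t)" by (simp add: algebra_simps)
    finally show ?thesis unfolding eq using ab_t by simp
  qed
  show "(1 + m) powr (1 - q) * (a + m * b) powr q \<le> a powr q + m * b powr q"
  proof (cases "a = b")
    case True
    then have "t = a" unfolding t_def using m by (simp add: field_simps)
    then show ?thesis unfolding eq using True by (simp add: algebra_simps)
  qed (use strict in auto)
qed

text \<open>If \<open>\<bar>x\<bar> \<noteq> \<bar>x0\<bar>\<close> the convexity of the power is strict, otherwise the triangle inequality is.\<close>

lemma norm_powr_weighted_le:
  fixes x x0 :: "'a::real_inner"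
  assumes q: "q > 1" and m: "m > 0"
  shows "(1 + m) powr (1 - q) * norm (x + m *\<^sub>R x0) powr q \<le> norm x powr q + m * norm x0 powr q"
    and "x \<noteq> x0 \<Longrightarrow> (1 + m) powr (1 - q) * norm (x + m *\<^sub>R x0) powr q < norm x powr q + m * norm x0 powr q"
proof -
  have tri: "norm (x + m *\<^sub>R x0) \<le> norm x + m * norm x0" using norm_triangle_ineq[of x "m *\<^sub>R x0"] m by simp
  then have le: "(1 + m) powr (1 - q) * norm (x + m *\<^sub>R x0) powr q \<le> (1 + m) powr (1 - q) * (norm x + m * norm x0) powr q"
    using q by (intro mult_left_mono powr_mono2) auto
  also have "\<dots> \<le> norm x powr q + m * norm x0 powr q" by (rule weighted_powr_le(1)[OF q m]) auto
  finally show "(1 + m) powr (1 - q) * norm (x + m *\<^sub>R x0) powr q \<le> norm x powr q + m * norm x0 powr q" .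
  assume ne: "x \<noteq> x0"
  show "(1 + m) powr (1 - q) * norm (x + m *\<^sub>R x0) powr q < norm x powr q + m * norm x0 powr q"
  proof (cases "norm x = norm x0")
    case False
    from weighted_powr_le(2)[OF q m _ _ this] le show ?thesis by simp
  next
    case True
    have "norm (x + m *\<^sub>R x0) \<noteq> norm x + m * norm x0"
    proof
      assume "norm (x + m *\<^sub>R x0) = norm x + m * norm x0"
      then have "norm (x + m *\<^sub>R x0) = norm x + norm (m *\<^sub>R x0)" using m by simp
      then have "norm x *\<^sub>R (m *\<^sub>R x0) = norm (m *\<^sub>R x0) *\<^sub>R x" by (simp only: norm_triangle_eq)
      then have "(norm x * m) *\<^sub>R x0 = (norm x * m) *\<^sub>R x" using True by (simp add: mult.commute abs_of_pos[OF m])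
      then show False using ne m True by auto
    qed
    then have "norm (x + m *\<^sub>R x0) < norm x + m * norm x0" using tri by simp
    then have "norm (x + m *\<^sub>R x0) powr q < (norm x + m * norm x0) powr q" using q by (intro powr_less_mono2) auto
    then have "(1 + m) powr (1 - q) * norm (x + m *\<^sub>R x0) powr q < (1 + m) powr (1 - q) * (norm x + m * norm x0) powr q"
      using m by (intro mult_strict_left_mono) auto
    also have "\<dots> \<le> norm x powr q + m * norm x0 powr q" by (rule weighted_powr_le(1)[OF q m]) auto
    finally show ?thesis .
  qed
qed

lemma superparabolic_open_above:
  fixes h :: "(real^'n) \<times> real \<Rightarrow> real"
  assumes \<Theta>: "open \<Theta>" and u: "p_superparabolic p \<Theta> u" and h: "continuous_on UNIV h"
  shows "open {z \<in> \<Theta>. ereal (h z) < u z}"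
proof -
  have "{z \<in> \<Theta>. ereal (h z) < u z} = (\<Union>k::real. {z \<in> \<Theta>. ereal k < u z} \<inter> {z. h z < k})"
  proof (intro equalityI subsetI)
    fix z assume "z \<in> {z \<in> \<Theta>. ereal (h z) < u z}"
    then obtain k where "ereal (h z) < ereal k" "ereal k < u z" "z \<in> \<Theta>" using ereal_dense2 by blast
    then show "z \<in> (\<Union>k::real. {z \<in> \<Theta>. ereal k < u z} \<inter> {z. h z < k})" by auto
  next
    fix z assume "z \<in> (\<Union>k::real. {z \<in> \<Theta>. ereal k < u z} \<inter> {z. h z < k})"
    then obtain k where "z \<in> \<Theta>" "ereal k < u z" "h z < k" by auto
    then show "z \<in> {z \<in> \<Theta>. ereal (h z) < u z}" using less_trans[of "ereal (h z)" "ereal k" "u z"] by auto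
  qed
  moreover have "open {z \<in> \<Theta>. ereal k < u z}" for k
  proof -
    have "openin (top_of_set \<Theta>) {z \<in> \<Theta>. ereal k < u z}" using u unfolding p_superparabolic_def by blast
    then show ?thesis using \<Theta> by (simp add: openin_open_eq)
  qed
  ultimately show ?thesis using open_Collect_less[OF h continuous_on_const] by (auto intro!: open_UN open_Int)
qed

text \<open>An explicit solution with a slightly smaller coefficient \<open>c\<^sub>1 = c (1 + m)\<^sup>1\<^sup>-\<^sup>q\<close>, centred at
  \<open>- m x\<^sub>0\<close>, touches the subsolution from below at \<open>x\<^sub>0\<close> and lies strictly below it elsewhere, by strict
  convexity of \<open>\<bar>x\<bar>\<^sup>q\<close>. Its speed \<open>n (c\<^sub>1 q)\<^sup>p\<^sup>-\<^sup>1\<close> still exceeds \<open>l\<close>. Lifted a little, it is an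
  admissible competitor in a small box which contradicts the comparison property at the touching point.\<close>

lemma superparabolic_no_touching:
  fixes x0 :: "real^'n"
  assumes p: "p > 2" and q: "q = p / (p - 1)" and c: "c > 0"
    and l: "l < CARD('n) * (c * q) powr (p - 1)"
    and \<Theta>: "open \<Theta>" and u: "p_superparabolic p \<Theta> u"
    and z0: "(x0, s0) \<in> \<Theta>" and \<tau>: "\<tau> < s0"
    and above: "\<And>z. z \<in> \<Theta> \<Longrightarrow> \<tau> \<le> snd z \<Longrightarrow> snd z \<le> s0 \<Longrightarrow> ereal (profile 1 c q 0 l d z) \<le> u z"
  shows "\<not> u (x0, s0) \<le> ereal (profile 1 c q 0 l d (x0, s0))"
proof
  let ?v = "profile 1 c q 0 l d :: (real^'n) \<times> real \<Rightarrow> real"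
  assume touch: "u (x0, s0) \<le> ereal (?v (x0, s0))"
  have q1: "q > 1" and pq: "(1 - q) * (p - 1) = - 1" using p unfolding q by (auto simp: field_simps)
  define \<kappa> where "\<kappa> = CARD('n) * (c * q) powr (p - 1)"
  define m where "m = (\<kappa> - l) / (2 * (\<bar>l\<bar> + 1))"
  have m: "m > 0" unfolding m_def using l by (intro divide_pos_pos) (auto simp: \<kappa>_def)
  have "l * m \<le> (\<bar>l\<bar> + 1) * m" using m by (intro mult_right_mono) auto
  also have "\<dots> = (\<kappa> - l) / 2" unfolding m_def by (simp add: field_simps)
  also have "\<dots> < \<kappa> - l" using l by (simp add: \<kappa>_def)
  finally have lm: "l * (1 + m) < \<kappa>" by (simp add: algebra_simps)
  define c1 where "c1 = c * (1 + m) powr (1 - q)"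
  have c1: "c1 > 0" unfolding c1_def using c m by simp
  define l1 where "l1 = CARD('n) * (c1 * q) powr (p - 1)"
  have "(c1 * q) powr (p - 1) = (c * q) powr (p - 1) / (1 + m)"
  proof -
    have "c1 * q = (c * q) * (1 + m) powr (1 - q)" by (simp add: c1_def)
    then have "(c1 * q) powr (p - 1) = (c * q) powr (p - 1) * (1 + m) powr ((1 - q) * (p - 1))"
      using c q1 m by (simp only: powr_mult powr_powr)
    then show ?thesis unfolding pq using m by (simp add: powr_minus_divide)
  qed
  then have "l1 = \<kappa> / (1 + m)" by (simp add: l1_def \<kappa>_def)
  then have l1: "l < l1" using lm m by (simp add: pos_less_divide_eq)
  define j where "j x = c * norm x powr q + c * m * norm x0 powr q - c1 * norm (x + m *\<^sub>R x0) powr q" for x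
  have j_eq: "j x = c * (norm x powr q + m * norm x0 powr q - (1 + m) powr (1 - q) * norm (x + m *\<^sub>R x0) powr q)" for x
    by (simp add: j_def c1_def algebra_simps)
  have j0: "j x \<ge> 0" for x unfolding j_eq using norm_powr_weighted_le(1)[OF q1 m, of x x0] c by simp
  have jpos: "j x > 0" if "x \<noteq> x0" for x unfolding j_eq using norm_powr_weighted_le(2)[OF q1 m that] c by simp
  have cj: "continuous_on A j" for A
  proof -
    have n: "continuous_on A (\<lambda>x. norm (x + y) powr q)" for y :: "real^'n"
      using q1 by (intro continuous_on_powr' continuous_on_norm continuous_on_add continuous_on_id continuous_on_const) auto
    show ?thesis unfolding j_def
      using n[of 0] n[of "m *\<^sub>R x0"] by (intro continuous_on_diff continuous_on_add continuous_on_mult continuous_on_const) auto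
  qed
  obtain A B where AB: "cbox A B \<subseteq> \<Theta>" "(x0, s0) \<in> box A B"
    using open_contains_cbox[OF \<Theta> z0] by metis
  obtain a t1' b t2' where A: "A = (a, t1')" and B: "B = (b, t2')" by (metis surj_pair)
  have x0: "x0 \<in> box a b" and s0: "t1' < s0" "s0 < t2'" using AB(2) unfolding A B box_Pair by (auto simp: box_real)
  define t1 where "t1 = max t1' \<tau>"
  have t1: "t1 < s0" "\<tau> \<le> t1" "t1' \<le> t1" using s0 \<tau> by (auto simp: t1_def)
  let ?Fr = "frontier (box a b)"
  have cFr: "compact ?Fr" by (intro compact_frontier_bounded bounded_box)
  have Fr: "x \<in> cbox a b" "x \<noteq> x0" if "x \<in> ?Fr" for x
    using that x0 by (auto simp: frontier_box split: if_splits)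
  obtain j1 where j1: "j1 > 0" "\<And>x. x \<in> ?Fr \<Longrightarrow> j1 \<le> j x"
  proof (cases "?Fr = {}")
    case True
    then show ?thesis using that[of 1] by auto
  next
    case False
    from continuous_attains_inf[OF cFr False cj] obtain x where "x \<in> ?Fr" "\<And>y. y \<in> ?Fr \<Longrightarrow> j x \<le> j y" by blast
    then show ?thesis using that[of "j x"] jpos Fr(2) by blast
  qed
  define \<delta> where "\<delta> = min (j1 / 2) ((l1 - l) * (s0 - t1))"
  have \<delta>: "\<delta> > 0" "\<delta> \<le> j1 / 2" "\<delta> \<le> (l1 - l) * (s0 - t1)" using j1 l1 t1 by (auto simp: \<delta>_def)
  define h where "h = profile 1 c1 q (- m *\<^sub>R x0) l1 (d + l * s0 - l1 * s0 - c * m * norm x0 powr q + \<delta>)"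
  have hv: "h (x, t) = ?v (x, t) - j x + (l1 - l) * (t - s0) + \<delta>" for x t
    by (simp add: h_def profile_def j_def algebra_simps)
  have ch: "continuous_on UNIV h" unfolding h_def using q1 by (intro profile_continuous) simp
  have hpar: "p_parabolic p S h" for S unfolding h_def
    by (rule profile_p_parabolic[OF p q]) (use c1 l1_def in auto)
  have "j x0 = 0"
  proof -
    have "x0 + m *\<^sub>R x0 = (1 + m) *\<^sub>R x0" by (simp add: scaleR_left_distrib)
    then have "(1 + m) powr (1 - q) * norm (x0 + m *\<^sub>R x0) powr q = ((1 + m) powr (1 - q) * (1 + m) powr q) * norm x0 powr q"
      using m by (simp add: powr_mult)
    also have "(1 + m) powr (1 - q) * (1 + m) powr q = 1 + m" using m by (simp flip: powr_add)
    finally show ?thesis unfolding j_eq by (simp add: algebra_simps)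
  qed
  then have hz0: "h (x0, s0) = ?v (x0, s0) + \<delta>" by (simp add: hv)
  have early: "ereal (h (x, t)) < u (x, t)" if "x \<in> ?Fr" "t1 \<le> t" "t \<le> s0" for x t
  proof -
    have "(x, t) \<in> cbox A B" using Fr(1)[OF that(1)] that t1 s0 unfolding A B cbox_Pair_eq by auto
    then have "ereal (?v (x, t)) \<le> u (x, t)" using AB(1) that t1 by (intro above) auto
    moreover have "(l1 - l) * (t - s0) \<le> 0" using l1 that by (intro mult_nonneg_nonpos) auto
    then have "h (x, t) < ?v (x, t)" unfolding hv using j1(1) j1(2)[OF that(1)] \<delta> by linarith
    ultimately show ?thesis by (meson ereal_less_eq(3) less_ereal.simps(1) less_le_trans)
  qed
  define W where "W = {z \<in> \<Theta>. ereal (h z) < u z}"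
  have oW: "open W" unfolding W_def by (rule superparabolic_open_above[OF \<Theta> u ch])
  have "?Fr \<times> {s0} \<subseteq> W"
  proof
    fix z assume "z \<in> ?Fr \<times> {s0}"
    then obtain x where x: "z = (x, s0)" "x \<in> ?Fr" by auto
    have "(x, s0) \<in> cbox A B" using Fr(1)[OF x(2)] s0 unfolding A B cbox_Pair_eq by auto
    then show "z \<in> W" using early[OF x(2), of s0] t1 AB(1) unfolding W_def x by auto
  qed
  then obtain \<eta> where \<eta>: "\<eta> > 0" "(\<Union>z\<in>?Fr \<times> {s0}. cball z \<eta>) \<subseteq> W"
    using compact_subset_open_imp_cball_epsilon_subset[OF compact_Times[OF cFr compact_sing] oW] by metis
  define t2 where "t2 = min t2' (s0 + \<eta>)"
  have t2: "s0 < t2" "t2 \<le> t2'" "t2 \<le> s0 + \<eta>" using s0 \<eta> by (auto simp: t2_def)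
  have ne: "box a b \<noteq> {}" and t12: "t1 < t2" using x0 t1 t2 by auto
  have cl: "closure (cylinder (box a b) t1 t2) = cbox (a, t1) (b, t2)" by (rule closure_cylinder_box[OF ne t12])
  have sub: "cbox (a, t1) (b, t2) \<subseteq> cbox A B" unfolding A B cbox_Pair_eq using t1 t2 by auto
  have "ereal (h z) \<le> u z" if z: "z \<in> parabolic_boundary (box a b) t1 t2" for z
  proof -
    obtain x t where xt: "z = (x, t)" by (cases z)
    consider "x \<in> cbox a b" "t = t1" | "x \<in> ?Fr" "t1 < t" "t \<le> t2"
      using z ne unfolding xt parabolic_boundary_def by (auto simp: closure_box)
    then show ?thesis
    proof cases
      case 1
      then have "(x, t) \<in> cbox (a, t1) (b, t2)" using t12 unfolding cbox_Pair_eq by auto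
      then have "(x, t) \<in> \<Theta>" using sub AB(1) by blast
      then have "ereal (?v (x, t)) \<le> u (x, t)" using 1 t1 by (intro above) auto
      moreover have "h (x, t) \<le> ?v (x, t)" unfolding hv using j0[of x] \<delta>(3) 1 by (simp add: algebra_simps)
      ultimately show ?thesis unfolding xt by (meson ereal_less_eq(3) order_trans)
    next
      case 2
      show ?thesis
      proof (cases "t \<le> s0")
        case True
        then show ?thesis using early[OF 2(1), of t] 2 unfolding xt by auto
      next
        case False
        then have "(x, t) \<in> cball (x, s0) \<eta>" using 2 t2 by (auto simp: dist_Pair_Pair dist_real_def)
        then have "(x, t) \<in> W" using \<eta>(2) 2(1) by blast
        then show ?thesis unfolding W_def xt by auto
      qed
    qed
  qed
  moreover have "compactly_inside (cylinder (box a b) t1 t2) \<Theta>"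
    unfolding compactly_inside_def cl using sub AB(1) by auto
  moreover have "(x0, s0) \<in> cylinder (box a b) t1 t2" using x0 t1 t2 by (auto simp: cylinder_def)
  moreover have "continuous_on (closure (cylinder (box a b) t1 t2)) h" using ch continuous_on_subset by blast
  ultimately have "ereal (h (x0, s0)) \<le> u (x0, s0)"
    using u t12 hpar unfolding p_superparabolic_def by blast
  from order_trans[OF this touch] have "ereal (h (x0, s0)) \<le> ereal (?v (x0, s0))" .
  then show False using hz0 \<delta>(1) by simp
qed

text \<open>Suppose that \<open>u - v\<close> has a negative infimum \<open>\<mu>\<close>. A minimizing sequence converges to a point of the closure.
  At a boundary point this contradicts the boundary values. At an interior point the infimum is attained
  by lower semicontinuity, necessarily after the time \<open>\<tau>\<close>, and \<open>v + \<mu>\<close> touches \<open>u\<close> from below there.\<close>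

lemma superparabolic_comparison:
  fixes \<Theta> :: "((real^'n) \<times> real) set"
  assumes p: "p > 2" and q: "q = p / (p - 1)" and c: "c > 0"
    and l: "l < CARD('n) * (c * q) powr (p - 1)"
    and \<Theta>: "open \<Theta>" "bounded \<Theta>" and u: "p_superparabolic p \<Theta> u"
    and below: "\<And>z. z \<in> \<Theta> \<Longrightarrow> ereal k0 \<le> u z"
    and bottom: "\<And>z. z \<in> \<Theta> \<Longrightarrow> snd z = \<tau> \<Longrightarrow> ereal (profile 1 c q 0 l d z) \<le> u z"
    and boundary: "\<And>\<xi>. \<xi> \<in> frontier \<Theta> \<Longrightarrow> \<tau> \<le> snd \<xi> \<Longrightarrow> snd \<xi> \<le> \<sigma> \<Longrightarrow>
        ereal (profile 1 c q 0 l d \<xi>) < Liminf (at \<xi> within \<Theta>) u"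
    and z1: "z1 \<in> \<Theta>" "\<tau> \<le> snd z1" "snd z1 \<le> \<sigma>"
  shows "ereal (profile 1 c q 0 l d z1) \<le> u z1"
proof (rule ccontr)
  let ?v = "profile 1 c q 0 l d :: (real^'n) \<times> real \<Rightarrow> real"
  assume "\<not> ereal (?v z1) \<le> u z1"
  then have z1': "u z1 < ereal (?v z1)" by simp
  have q0: "q > 0" using p q by simp
  have cv: "continuous_on UNIV ?v" by (rule profile_continuous[OF q0])
  define D where "D = {z \<in> \<Theta>. \<tau> \<le> snd z \<and> snd z \<le> \<sigma>}"
  define K where "K = {k::real. \<exists>z\<in>D. u z < ereal (?v z + k)}"
  have "bounded (?v ` closure \<Theta>)"
    using \<Theta>(2) by (intro compact_imp_bounded compact_continuous_image continuous_on_subset[OF cv]) (auto simp: compact_closure)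
  then obtain V where V: "\<And>z. z \<in> closure \<Theta> \<Longrightarrow> \<bar>?v z\<bar> \<le> V" unfolding bounded_iff by auto
  have bK: "bdd_below K"
  proof (rule bdd_belowI)
    fix k assume "k \<in> K"
    then obtain z where z: "z \<in> D" "u z < ereal (?v z + k)" by (auto simp: K_def)
    have z\<Theta>: "z \<in> \<Theta>" using z(1) by (simp add: D_def)
    have "ereal k0 < ereal (?v z + k)" by (rule le_less_trans[OF below[OF z\<Theta>] z(2)])
    moreover have "\<bar>?v z\<bar> \<le> V" using z\<Theta> closure_subset by (intro V) blast
    ultimately show "k0 - V \<le> k" by simp
  qed
  define \<mu> where "\<mu> = Inf K"
  have dense: "\<exists>k. k < k' \<and> u z < ereal (?v z + k)" if "u z < ereal (?v z + k')" for z k'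
  proof -
    obtain r where "u z < ereal r" "ereal r < ereal (?v z + k')" using ereal_dense2[OF \<open>u z < ereal (?v z + k')\<close>] by blast
    then show ?thesis by (intro exI[of _ "r - ?v z"]) auto
  qed
  have z1D: "z1 \<in> D" using z1 by (simp add: D_def)
  obtain k1 where k1: "k1 < 0" "u z1 < ereal (?v z1 + k1)" using dense[of z1 0] z1' by (metis add.right_neutral)
  then have "k1 \<in> K" using z1D by (auto simp: K_def)
  then have \<mu>0: "\<mu> < 0" and Kne: "K \<noteq> {}" using cInf_lower[OF _ bK, of k1] k1(1) by (auto simp: \<mu>_def)
  have ge: "ereal (?v z + \<mu>) \<le> u z" if z: "z \<in> D" for z
  proof (rule ccontr)
    assume "\<not> ereal (?v z + \<mu>) \<le> u z"
    then have "u z < ereal (?v z + \<mu>)" by simp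
    from dense[OF this] obtain k where "k < \<mu>" "u z < ereal (?v z + k)" by blast
    then show False using cInf_lower[OF _ bK, of k] z unfolding \<mu>_def K_def by fastforce
  qed
  have "\<exists>z\<in>D. u z < ereal (?v z + \<mu> + 1 / real (Suc n))" for n
  proof -
    have "Inf K < \<mu> + 1 / real (Suc n)" unfolding \<mu>_def by simp
    then obtain k z where "k < \<mu> + 1 / real (Suc n)" "z \<in> D" "u z < ereal (?v z + k)"
      using cInf_lessD[OF Kne] unfolding K_def by blast
    then show ?thesis by (intro bexI[of _ z]) (auto intro: less_le_trans)
  qed
  then obtain zn where zn: "\<And>n. zn n \<in> D" "\<And>n. u (zn n) < ereal (?v (zn n) + \<mu> + 1 / real (Suc n))" by metis
  have "\<forall>n. zn n \<in> closure \<Theta>" using zn(1) closure_subset[of \<Theta>] unfolding D_def by auto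
  moreover have "compact (closure \<Theta>)" using \<Theta>(2) by (simp add: compact_closure)
  ultimately obtain zs r where zs: "zs \<in> closure \<Theta>" "strict_mono r" "(zn \<circ> r) \<longlonglongrightarrow> zs"
    unfolding compact_def by metis
  have snd_lim: "(\<lambda>n. snd ((zn \<circ> r) n)) \<longlonglongrightarrow> snd zs" by (rule tendsto_snd[OF zs(3)])
  have zs_t: "\<tau> \<le> snd zs" "snd zs \<le> \<sigma>"
    using LIMSEQ_le_const[OF snd_lim, of \<tau>] LIMSEQ_le_const2[OF snd_lim, of \<sigma>] zn(1) unfolding D_def by auto
  \<comment> \<open>whatever lies eventually below \<open>u\<close> along the minimizing sequence lies below \<open>v + \<mu>\<close> at its limit\<close>
  have lim_le: "k \<le> ?v zs + \<mu>" if ev: "\<forall>\<^sub>F n in sequentially. ereal k < u ((zn \<circ> r) n)" for k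
  proof -
    have "isCont ?v zs" using cv continuous_on_eq_continuous_at[OF open_UNIV] by blast
    then have "(\<lambda>n. ?v ((zn \<circ> r) n)) \<longlonglongrightarrow> ?v zs" using zs(3) by (rule isCont_tendsto_compose)
    moreover have "(\<lambda>n. 1 / real (Suc (r n))) \<longlonglongrightarrow> 0"
      using LIMSEQ_subseq_LIMSEQ[OF lim_inverse_n' , of "\<lambda>n. Suc (r n)"] zs(2)
      by (simp add: o_def strict_mono_def)
    ultimately have "(\<lambda>n. ?v ((zn \<circ> r) n) + \<mu> + 1 / real (Suc (r n))) \<longlonglongrightarrow> ?v zs + \<mu> + 0"
      by (intro tendsto_intros)
    moreover have "\<forall>\<^sub>F n in sequentially. k \<le> ?v ((zn \<circ> r) n) + \<mu> + 1 / real (Suc (r n))"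
      using ev
    proof eventually_elim
      fix n assume k: "ereal k < u ((zn \<circ> r) n)"
      have "u ((zn \<circ> r) n) < ereal (?v ((zn \<circ> r) n) + \<mu> + 1 / real (Suc (r n)))"
        using zn(2)[of "r n"] by (simp only: o_apply)
      from less_trans[OF k this] show "k \<le> ?v ((zn \<circ> r) n) + \<mu> + 1 / real (Suc (r n))"
        by (simp only: less_ereal.simps(1) less_imp_le)
    qed
    ultimately have "k \<le> ?v zs + \<mu> + 0" by (intro tendsto_lowerbound[of _ "?v zs + \<mu> + 0"]) auto
    then show ?thesis by simp
  qed
  show False
  proof (cases "zs \<in> \<Theta>")
    case True
    have le: "u zs \<le> ereal (?v zs + \<mu>)"
    proof (rule ccontr)
      assume "\<not> u zs \<le> ereal (?v zs + \<mu>)"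
      then have "ereal (?v zs + \<mu>) < u zs" by simp
      from ereal_dense2[OF this] obtain k where k: "ereal (?v zs + \<mu>) < ereal k" "ereal k < u zs" by blast
      have "open {z \<in> \<Theta>. ereal k < u z}" by (rule superparabolic_open_above[OF \<Theta>(1) u continuous_on_const])
      moreover have "zs \<in> {z \<in> \<Theta>. ereal k < u z}" using True k by simp
      ultimately have "\<forall>\<^sub>F n in sequentially. (zn \<circ> r) n \<in> {z \<in> \<Theta>. ereal k < u z}"
        using zs(3) by (rule topological_tendstoD[rotated 1])
      then have "\<forall>\<^sub>F n in sequentially. ereal k < u ((zn \<circ> r) n)" by eventually_elim simp
      from lim_le[OF this] k(1) show False by simp
    qed
    obtain x0 s0 where xs: "zs = (x0, s0)" by (cases zs)
    have v\<mu>: "profile 1 c q 0 l (d + \<mu>) z = ?v z + \<mu>" for z :: "(real^'n) \<times> real" by (simp add: profile_def)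
    have "\<tau> < s0"
    proof (rule ccontr)
      assume "\<not> \<tau> < s0"
      then have "ereal (?v zs) \<le> u zs" using zs_t(1) True unfolding xs by (intro bottom) auto
      with le have "ereal (?v zs) \<le> ereal (?v zs + \<mu>)" by (rule order_trans[rotated])
      then show False using \<mu>0 by simp
    qed
    then have "\<not> u (x0, s0) \<le> ereal (profile 1 c q 0 l (d + \<mu>) (x0, s0))"
    proof (rule superparabolic_no_touching[OF p q c l \<Theta>(1) u True[unfolded xs]])
      fix z assume "z \<in> \<Theta>" "\<tau> \<le> snd z" "snd z \<le> s0"
      then show "ereal (profile 1 c q 0 l (d + \<mu>) z) \<le> u z"
        unfolding v\<mu> using zs_t(2) xs by (intro ge) (auto simp: D_def)
    qed
    then show False using le unfolding v\<mu> xs by simp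
  next
    case False
    then have "zs \<in> frontier \<Theta>" using zs(1) \<Theta>(1) by (simp add: frontier_def interior_open)
    then have "ereal (?v zs) < Liminf (at zs within \<Theta>) u" using zs_t by (intro boundary)
    then obtain k where k: "?v zs < k" "ereal k < Liminf (at zs within \<Theta>) u" using ereal_dense2 by force
    have "\<forall>\<^sub>F z in at zs within \<Theta>. ereal k < u z" by (rule less_LiminfD[OF k(2)])
    moreover have "filterlim (zn \<circ> r) (at zs within \<Theta>) sequentially"
      using zs(3) zn(1) False unfolding D_def by (auto simp: filterlim_at intro!: always_eventually)
    ultimately have "\<forall>\<^sub>F n in sequentially. ereal k < u ((zn \<circ> r) n)" unfolding filterlim_iff by blast
    from lim_le[OF this] k(1) \<mu>0 show False by simp
  qed
qed

section \<open>Explicit superparabolic functions and pasting in time\<close>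

lemma p_parabolic_subset: "p_parabolic p C h \<Longrightarrow> C' \<subseteq> C \<Longrightarrow> p_parabolic p C' h"
  unfolding p_parabolic_def weak_solution_def compactly_inside_def
  by (meson continuous_on_subset order_trans)

lemma profile_superparabolic:
  fixes y :: "real^'n"
  assumes p: "p > 2" and q: "q = p / (p - 1)" and c: "c \<ge> 0"
    and l: "l \<le> CARD('n) * (c * q) powr (p - 1)" and \<Theta>: "open \<Theta>"
  shows "p_superparabolic p \<Theta> (\<lambda>z. ereal (profile (-1) c q y l d z))"
  unfolding p_superparabolic_def
proof (intro conjI allI impI ballI)
  let ?w = "profile (-1) c q y l d"
  have "q > 0" using p q by simp
  then have cw: "continuous_on UNIV (\<lambda>z. ereal (?w z))" by (intro continuous_on_ereal profile_continuous)
  show "openin (top_of_set \<Theta>) {z \<in> \<Theta>. k < ereal (?w z)}" for k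
  proof -
    have "{z \<in> \<Theta>. k < ereal (?w z)} = \<Theta> \<inter> {z. k < ereal (?w z)}" by blast
    then show ?thesis using open_Int[OF \<Theta> open_Collect_less[OF continuous_on_const cw, of k]] \<Theta>
      by (simp add: openin_open_eq)
  qed
  show "\<Theta> \<subseteq> closure {z \<in> \<Theta>. \<bar>ereal (?w z)\<bar> \<noteq> \<infinity>}" by (simp add: closure_subset)
next
  let ?w = "profile (-1) c q y l d"
  fix a b :: "real^'n" and t1 t2 h z
  assume A: "t1 < t2 \<and> compactly_inside (cylinder (box a b) t1 t2) \<Theta> \<and>
        p_parabolic p (cylinder (box a b) t1 t2) h \<and>
        continuous_on (closure (cylinder (box a b) t1 t2)) h \<and>
        (\<forall>z\<in>parabolic_boundary (box a b) t1 t2. ereal (h z) \<le> ereal (?w z))"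
    and zc: "z \<in> cylinder (box a b) t1 t2"
  have "h z \<le> ?w z" 
  proof (rule explicit_supersolution_comparison[OF p q c l _ _ _ _ zc])
    show "h z' \<le> ?w z'" if "z' \<in> parabolic_boundary (box a b) t1 t2" for z' using A that by simp
  qed (use A in blast)+
  then show "ereal (h z) \<le> ereal (?w z)" by simp
qed simp

text \<open>A superparabolic function may jump upwards in time. Beyond the jump the comparison starts afresh
  from the bottom value \<open>f \<le> w\<close>; continuity of \<open>f\<close> up to the time \<open>s\<close> carries the inequality from
  the times before \<open>s\<close> to the time \<open>s\<close> itself.\<close>

lemma superparabolic_paste:
  fixes y :: "real^'n" and f k :: "(real^'n) \<times> real \<Rightarrow> real"
  assumes p: "p > 2" and q: "q = p / (p - 1)" and c: "c \<ge> 0"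
    and l: "l \<le> CARD('n) * (c * q) powr (p - 1)" and \<Theta>: "open \<Theta>"
    and f: "p_superparabolic p \<Theta> (\<lambda>z. ereal (f z))"
    and k: "continuous_on UNIV k" and r: "r < s"
    and fk: "\<And>z. z \<in> \<Theta> \<Longrightarrow> r < snd z \<Longrightarrow> snd z \<le> s \<Longrightarrow> f z = k z"
    and kw: "\<And>z. z \<in> \<Theta> \<Longrightarrow> snd z = s \<Longrightarrow> k z \<le> profile (-1) c q y l d z"
  shows "p_superparabolic p \<Theta> (\<lambda>z. ereal (if snd z \<le> s then f z else profile (-1) c q y l d z))"
  unfolding p_superparabolic_def
proof (intro conjI allI impI ballI)
  let ?w = "profile (-1) c q y l d"
  let ?u = "\<lambda>z. if snd z \<le> s then f z else ?w z"
  have "q > 0" using p q by simp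
  then have cw: "continuous_on UNIV (\<lambda>z. ereal (?w z))" by (intro continuous_on_ereal profile_continuous)
  fix e :: ereal
  have 1: "open {z \<in> \<Theta>. e < ereal (f z)}"
  proof -
    have "openin (top_of_set \<Theta>) {z \<in> \<Theta>. e < ereal (f z)}" using f unfolding p_superparabolic_def by blast
    then show ?thesis using \<Theta> by (simp add: openin_open_eq)
  qed
  have 2: "open {z. e < ereal (?w z)}" by (rule open_Collect_less[OF continuous_on_const cw])
  have 3: "open {z :: (real^'n) \<times> real. snd z < s}" "open {z :: (real^'n) \<times> real. s < snd z}"
    by (auto intro!: open_Collect_less continuous_intros)
  have "{z \<in> \<Theta>. e < ereal (?u z)} = ({z \<in> \<Theta>. e < ereal (f z)} \<inter> {z. snd z < s})
     \<union> (\<Theta> \<inter> {z. e < ereal (?w z)} \<inter> {z. s < snd z}) \<union> ({z \<in> \<Theta>. e < ereal (f z)} \<inter> {z. e < ereal (?w z)})" (is "?L = ?R")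
  proof (intro equalityI subsetI)
    fix z assume z: "z \<in> ?L"
    consider "snd z < s" | "snd z = s" | "s < snd z" by linarith
    then show "z \<in> ?R"
    proof cases
      case 2
      then have "f z \<le> ?w z" using fk[of z] kw[of z] z r by auto
      then have "e < ereal (?w z)" using z 2 by (auto intro: less_le_trans)
      then show ?thesis using z 2 by auto
    qed (use z in auto)
  qed (auto split: if_splits)
  moreover have "open ?R" by (intro open_Un open_Int \<Theta> 1 2 3)
  ultimately show "openin (top_of_set \<Theta>) {z \<in> \<Theta>. e < ereal (?u z)}"
    using \<Theta> by (auto simp: openin_open_eq)
  show "\<Theta> \<subseteq> closure {z \<in> \<Theta>. \<bar>ereal (?u z)\<bar> \<noteq> \<infinity>}" by (simp add: closure_subset)
next
  let ?w = "profile (-1) c q y l d"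
  let ?u = "\<lambda>z. if snd z \<le> s then f z else ?w z"
  fix a b :: "real^'n" and t1 t2 h z
  assume A: "t1 < t2 \<and> compactly_inside (cylinder (box a b) t1 t2) \<Theta> \<and>
        p_parabolic p (cylinder (box a b) t1 t2) h \<and>
        continuous_on (closure (cylinder (box a b) t1 t2)) h \<and>
        (\<forall>z\<in>parabolic_boundary (box a b) t1 t2. ereal (h z) \<le> ereal (?u z))"
    and z: "z \<in> cylinder (box a b) t1 t2"
  then have t: "t1 < t2" and hp: "p_parabolic p (cylinder (box a b) t1 t2) h"
    and bd: "\<And>z. z \<in> parabolic_boundary (box a b) t1 t2 \<Longrightarrow> h z \<le> ?u z" by auto
  have ne: "box a b \<noteq> {}" using z by (auto simp: cylinder_def)
  note cl = closure_cylinder_box[OF ne]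
  have cub: "cbox (a, t1) (b, t2) \<subseteq> \<Theta>" using A cl[OF t] unfolding compactly_inside_def by auto
  have hc: "continuous_on (cbox (a, t1) (b, t2)) h" using A cl[OF t] by auto
  have pb: "(x, t) \<in> parabolic_boundary (box a b) u1 u2 \<longleftrightarrow> (x \<in> cbox a b \<and> t = u1) \<or> (x \<in> frontier (box a b) \<and> u1 < t \<and> t \<le> u2)"
    for x t u1 u2 using ne by (auto simp: parabolic_boundary_def closure_box)
  have in\<Theta>: "(x, t) \<in> \<Theta>" if "x \<in> cbox a b" "t1 \<le> t" "t \<le> t2" for x t
    using cub that unfolding cbox_Pair_eq by auto
  have fw: "f (x, s) \<le> ?w (x, s)" if "(x, s) \<in> \<Theta>" for x
    using fk[of "(x, s)"] kw[of "(x, s)"] that r by simp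
  have sub: "p_parabolic p (cylinder (box a b) u1 u2) h" "continuous_on (closure (cylinder (box a b) u1 u2)) h"
      "compactly_inside (cylinder (box a b) u1 u2) \<Theta>"
    if "t1 \<le> u1" "u1 < u2" "u2 \<le> t2" for u1 u2
  proof -
    have s': "cbox (a, u1) (b, u2) \<subseteq> cbox (a, t1) (b, t2)" using that unfolding cbox_Pair_eq by auto
    show "p_parabolic p (cylinder (box a b) u1 u2) h"
      by (rule p_parabolic_subset[OF hp]) (use that in \<open>auto simp: cylinder_def\<close>)
    show "continuous_on (closure (cylinder (box a b) u1 u2)) h" unfolding cl[OF that(2)] by (rule continuous_on_subset[OF hc s'])
    show "compactly_inside (cylinder (box a b) u1 u2) \<Theta>" unfolding compactly_inside_def cl[OF that(2)] using s' cub by auto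
  qed
  have early: "h z \<le> f z"
    if "t1 < u2" "u2 \<le> t2" "u2 \<le> s" "z \<in> cylinder (box a b) t1 u2" for z u2
  proof -
    have "ereal (h z') \<le> ereal (f z')" if "z' \<in> parabolic_boundary (box a b) t1 u2" for z'
    proof -
      obtain x t where xt: "z' = (x, t)" by (cases z')
      have "z' \<in> parabolic_boundary (box a b) t1 t2" "t \<le> s"
        using that \<open>t1 < u2\<close> \<open>u2 \<le> t2\<close> \<open>u2 \<le> s\<close> unfolding xt pb by auto
      then show ?thesis using bd[of z'] by (simp add: xt)
    qed
    then have "ereal (h z) \<le> ereal (f z)"
      using f sub[OF order_refl that(1,2)] that(1,4) unfolding p_superparabolic_def by blast
    then show ?thesis by simp
  qed
  have late: "h z \<le> ?w z"
    if "t1 \<le> u1" "s \<le> u1" "u1 < t2" "z \<in> cylinder (box a b) u1 t2" and bot: "\<And>x. x \<in> cbox a b \<Longrightarrow> h (x, u1) \<le> ?w (x, u1)" for z u1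
  proof (rule explicit_supersolution_comparison[OF p q c l that(3) sub(1,2)[OF that(1,3) order_refl] _ that(4)])
    fix z' assume z': "z' \<in> parabolic_boundary (box a b) u1 t2"
    obtain x t where xt: "z' = (x, t)" by (cases z')
    from z' consider "x \<in> cbox a b" "t = u1" | "x \<in> frontier (box a b)" "u1 < t" "t \<le> t2"
      unfolding xt pb by auto
    then show "h z' \<le> ?w z'"
    proof cases
      case 1 then show ?thesis using bot xt by simp
    next
      case 2
      then have "z' \<in> parabolic_boundary (box a b) t1 t2" "s < t" using that unfolding xt pb by auto
      then show ?thesis using bd[of z'] by (simp add: xt)
    qed
  qed
  obtain x0 \<tau> where z0: "z = (x0, \<tau>)" by (cases z)
  have x0: "x0 \<in> box a b" "t1 < \<tau>" "\<tau> < t2" using z unfolding z0 by (auto simp: cylinder_def)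
  have "h z \<le> ?u z"
  proof -
    consider "t2 \<le> s" | "s \<le> t1" | "t1 < s" "s < t2" by linarith
    then show ?thesis
    proof cases
      case 1
      then show ?thesis using early[OF t order_refl 1 z] x0 by (simp add: z0)
    next
      case 2
      have "h (x, t1) \<le> ?w (x, t1)" if "x \<in> cbox a b" for x
      proof -
        have "h (x, t1) \<le> ?u (x, t1)" by (intro bd) (use that in \<open>simp add: pb\<close>)
        then show ?thesis using 2 fw[of x] in\<Theta>[OF that, of t1] t by (cases "t1 = s") auto
      qed
      then have "h z \<le> ?w z" using late[OF order_refl 2 t z] by blast
      then show ?thesis using x0 2 by (simp add: z0)
    next
      case 3
      have at_s: "h (x, s) \<le> k (x, s)" if x: "x \<in> box a b" for x
      proof -
        have xc: "x \<in> cbox a b" using x box_subset_cbox by blast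
        have ch: "((\<lambda>t. h (x, t)) \<longlongrightarrow> h (x, s)) (at_left s)"
        proof -
          have "continuous_on {t1..t2} (\<lambda>t. h (x, t))"
            by (rule continuous_on_compose2[OF hc]) (use xc in \<open>auto simp: cbox_Pair_eq intro!: continuous_intros\<close>)
          then have "continuous (at s within {t1..t2}) (\<lambda>t. h (x, t))" using 3 by (simp add: continuous_on_eq_continuous_within)
          then have "isCont (\<lambda>t. h (x, t)) s" using 3 by (simp add: at_within_Icc_at)
          then show ?thesis by (simp add: isCont_def filterlim_at_split)
        qed
        have ck: "((\<lambda>t. k (x, t)) \<longlongrightarrow> k (x, s)) (at_left s)"
        proof -
          have "continuous_on UNIV (\<lambda>t. k (x, t))"
            by (rule continuous_on_compose2[OF k]) (auto intro!: continuous_intros)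
          then have "isCont (\<lambda>t. k (x, t)) s" using continuous_on_eq_continuous_at[OF open_UNIV] by blast
          then show ?thesis by (simp add: isCont_def filterlim_at_split)
        qed
        have "max r t1 < s" using r 3 by simp
        then have "\<forall>\<^sub>F t in at_left s. t \<in> {max r t1<..<s}" by (rule eventually_at_left_real)
        then have "\<forall>\<^sub>F t in at_left s. h (x, t) \<le> k (x, t)"
        proof eventually_elim
          fix t assume t': "t \<in> {max r t1<..<s}"
          have "h (x, t) \<le> f (x, t)"
            by (rule early[OF 3(1) less_imp_le[OF 3(2)] order_refl]) (use x t' in \<open>auto simp: cylinder_def\<close>)
          also have "f (x, t) = k (x, t)" by (rule fk) (use t' 3 in \<open>auto intro!: in\<Theta> xc\<close>)
          finally show "h (x, t) \<le> k (x, t)" .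
        qed
        then show ?thesis by (rule tendsto_le[OF _ ck ch, rotated]) simp
      qed
      have s\<Theta>: "(x, s) \<in> \<Theta>" if "x \<in> cbox a b" for x using that 3 by (intro in\<Theta>) auto
      have bot: "h (x, s) \<le> ?w (x, s)" if x: "x \<in> cbox a b" for x
      proof (cases "x \<in> box a b")
        case True
        then show ?thesis using at_s[OF True] kw[OF s\<Theta>[OF x]] by simp
      next
        case False
        then have "x \<in> frontier (box a b)" using x ne by (simp add: frontier_box)
        then have "h (x, s) \<le> f (x, s)" using bd[of "(x, s)"] 3 by (simp add: pb)
        then show ?thesis using fw[OF s\<Theta>[OF x]] by simp
      qed
      consider "\<tau> < s" | "\<tau> = s" | "s < \<tau>" by linarith
      then show ?thesis
      proof cases
        case 1
        have "h z \<le> f z" by (rule early[OF 3(1) less_imp_le[OF 3(2)] order_refl]) (use x0 1 in \<open>auto simp: z0 cylinder_def\<close>)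
        then show ?thesis using 1 by (simp add: z0)
      next
        case 2
        have "f (x0, s) = k (x0, s)" using fk[of "(x0, s)"] r s\<Theta> x0 box_subset_cbox[of a b] by auto
        then show ?thesis using at_s[OF x0(1)] 2 by (simp add: z0)
      next
        case c3: 3
        have "h z \<le> ?w z"
          by (rule late[OF less_imp_le[OF 3(1)] order_refl 3(2) _ bot]) (use x0 c3 in \<open>auto simp: z0 cylinder_def\<close>)
        then show ?thesis using c3 by (simp add: z0)
      qed
    qed
  qed
  then show "ereal (h z) \<le> ereal (?u z)" by simp
qed simp

section \<open>Barriers in thin domains\<close>

text \<open>The speed of an explicit solution with \<open>c = M / (4 \<rho>\<^sup>q)\<close> is \<open>n (M q / 4)\<^sup>p\<^sup>-\<^sup>1 \<rho>\<^sup>-\<^sup>p\<close>. With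
  \<open>\<rho> = \<epsilon> \<sigma>\<^sup>1\<^sup>/\<^sup>p\<close> it exceeds \<open>M / \<sigma>\<close> as soon as \<open>\<epsilon>\<^sup>p < (q/4)\<^sup>p\<^sup>-\<^sup>1 M\<^sup>p\<^sup>-\<^sup>2\<close>; since \<open>p > 2\<close>, one \<open>\<epsilon>\<close> serves
  all \<open>M \<ge> \<eta>\<close>.\<close>

lemma barrier_coefficient:
  fixes p q \<eta> :: real
  assumes p: "p > 2" and q: "q = p / (p - 1)" and \<eta>: "\<eta> > 0"
  shows "\<exists>\<epsilon>>0. \<forall>M\<ge>\<eta>. \<forall>\<sigma>>0. \<exists>c>0. c * (\<epsilon> * \<sigma> powr (1/p)) powr q = M / 4 \<and> M / \<sigma> < (c * q) powr (p - 1)"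
proof -
  define E where "E = (q / 4) powr (p - 1) * \<eta> powr (p - 2) / 2"
  have q0: "q > 0" and qp: "q * (p - 1) = p" using p unfolding q by auto
  have E: "E > 0" unfolding E_def using q0 \<eta> by simp
  define \<epsilon> where "\<epsilon> = E powr (1/p)"
  have \<epsilon>: "\<epsilon> > 0" unfolding \<epsilon>_def using E by simp
  have \<epsilon>p: "\<epsilon> powr p = E" unfolding \<epsilon>_def using E p by (simp add: powr_powr)
  have "\<exists>c>0. c * (\<epsilon> * \<sigma> powr (1/p)) powr q = M / 4 \<and> M / \<sigma> < (c * q) powr (p - 1)" if M: "M \<ge> \<eta>" and \<sigma>: "\<sigma> > 0" for M \<sigma>
  proof -
    define \<rho> where "\<rho> = \<epsilon> * \<sigma> powr (1/p)"
    have \<rho>: "\<rho> > 0" unfolding \<rho>_def using \<epsilon> \<sigma> by simp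
    have M0: "M > 0" using M \<eta> by linarith
    have \<rho>p: "\<rho> powr p = E * \<sigma>" unfolding \<rho>_def using \<epsilon> \<sigma> p by (simp add: powr_mult \<epsilon>p powr_powr)
    define c where "c = M / (4 * \<rho> powr q)"
    have c: "c > 0" unfolding c_def using M0 \<rho> by simp
    have "c * q = (M * (q / 4)) / \<rho> powr q" unfolding c_def by simp
    then have "(c * q) powr (p - 1) = (M powr (p - 1) * (q / 4) powr (p - 1)) / (\<rho> powr q) powr (p - 1)"
      using M0 q0 \<rho> by (simp only: powr_divide powr_mult)
    also have "(\<rho> powr q) powr (p - 1) = E * \<sigma>" by (simp only: powr_powr qp \<rho>p)
    also have "M powr (p - 1) = M * M powr (p - 2)" using powr_add[of M 1 "p - 2"] M0 by simp
    finally have cq: "(c * q) powr (p - 1) = (M / \<sigma>) * (((q / 4) powr (p - 1) * M powr (p - 2)) / E)" by (simp add: mult_ac)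
    have "E < (q / 4) powr (p - 1) * \<eta> powr (p - 2)" unfolding E_def using q0 \<eta> by simp
    also have "\<dots> \<le> (q / 4) powr (p - 1) * M powr (p - 2)"
      using M \<eta> p by (intro mult_left_mono powr_mono2) auto
    finally have "1 < ((q / 4) powr (p - 1) * M powr (p - 2)) / E" using E by simp
    then have "(M / \<sigma>) * 1 < (c * q) powr (p - 1)" unfolding cq using M0 \<sigma> by (intro mult_strict_left_mono) auto
    moreover have "c * \<rho> powr q = M / 4" unfolding c_def using \<rho> by simp
    ultimately show ?thesis unfolding \<rho>_def[symmetric] using c by auto
  qed
  with \<epsilon> show ?thesis by blast
qed

lemma geometric_decay:
  assumes base: "Q M0 s0" and s0: "s0 < 0" and \<eta>: "\<eta> > (0::real)"
    and step: "\<And>M s. Q M s \<Longrightarrow> \<eta> \<le> M \<Longrightarrow> s0 \<le> s \<Longrightarrow> s < 0 \<Longrightarrow> Q (3/4 * M) (s/4)"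
  shows "\<exists>M s. M < \<eta> \<and> s0 \<le> s \<and> s < (0::real) \<and> Q M s"
proof (rule ccontr)
  assume no: "\<not> ?thesis"
  have ex: "\<exists>s. s0 \<le> s \<and> s < 0 \<and> Q ((3/4)^k * M0) s" for k
  proof (induction k)
    case 0
    then show ?case using base s0 by auto
  next
    case (Suc k)
    then obtain s where s: "s0 \<le> s" "s < 0" "Q ((3/4)^k * M0) s" by blast
    then have "\<eta> \<le> (3/4)^k * M0" using no by (meson not_le)
    from step[OF s(3) this s(1,2)] have "Q ((3/4)^Suc k * M0) (s/4)" by (simp add: mult.assoc)
    then show ?case using s by (intro exI[of _ "s/4"]) auto
  qed
  have "(\<lambda>k. (3/4)^k * M0) \<longlonglongrightarrow> 0 * M0" by (intro tendsto_intros LIMSEQ_power_zero) simp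
  then have "\<forall>\<^sub>F k in sequentially. (3/4)^k * M0 < \<eta>" using \<eta> by (intro order_tendstoD) auto
  then obtain k where "(3/4)^k * M0 < \<eta>" by (auto simp: eventually_sequentially)
  then show False using ex[of k] no by blast
qed

lemma thin_domain_open:
  fixes \<Theta> :: "((real^'n) \<times> real) set"
  assumes \<Theta>: "\<Theta> = {(x, t). norm x < \<zeta> t \<and> t0 < t \<and> t < 0}" and \<zeta>: "continuous_on {t0<..<0} \<zeta>"
  shows "open \<Theta>"
proof -
  let ?O = "{z :: (real^'n) \<times> real. t0 < snd z} \<inter> {z. snd z < 0}"
  have O: "open ?O" by (intro open_Int open_Collect_less continuous_intros)
  have "continuous_on ?O (\<lambda>z. \<zeta> (snd z) - norm (fst z))"
    by (intro continuous_intros continuous_on_compose2[OF \<zeta>]) auto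
  then have "open (?O \<inter> (\<lambda>z. \<zeta> (snd z) - norm (fst z)) -` {0<..})"
    by (rule continuous_open_preimage[OF _ O]) simp
  moreover have "?O \<inter> (\<lambda>z. \<zeta> (snd z) - norm (fst z)) -` {0<..} = \<Theta>" unfolding \<Theta> by auto
  ultimately show ?thesis by simp
qed

lemma thin_domain_origin_frontier:
  fixes \<Theta> :: "((real^'n) \<times> real) set"
  assumes t0: "t0 < 0" and \<Theta>: "\<Theta> = {(x, t). norm x < \<zeta> t \<and> t0 < t \<and> t < 0}"
    and \<zeta>: "\<forall>t\<in>{t0<..<0}. \<zeta> t > 0"
  shows "(0, 0) \<in> frontier \<Theta>"
proof -
  have "(0, 0) \<in> closure \<Theta>"
    unfolding closure_approachable
  proof (intro allI impI)
    fix e :: real assume e: "e > 0"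
    define t where "t = max (t0 / 2) (- e / 2)"
    have "t0 < t" "t < 0" "\<bar>t\<bar> < e" using t0 e by (auto simp: t_def max_def)
    then have "(0, t) \<in> \<Theta>" "dist (0, t) ((0, 0) :: (real^'n) \<times> real) < e"
      unfolding \<Theta> using \<zeta> by (auto simp: dist_Pair_Pair)
    then show "\<exists>y\<in>\<Theta>. dist y (0, 0) < e" by blast
  qed
  moreover have "(0, 0) \<notin> interior \<Theta>" using interior_subset[of \<Theta>] unfolding \<Theta> by auto
  ultimately show ?thesis by (simp add: frontier_def)
qed

lemma nonpositive_time_on_closure:
  fixes \<Theta> :: "((real^'n) \<times> real) set"
  assumes "\<And>z. z \<in> \<Theta> \<Longrightarrow> snd z < 0" "z \<in> closure \<Theta>"
  shows "snd z \<le> 0"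
proof -
  have "closed {z :: (real^'n) \<times> real. snd z \<le> 0}" by (intro closed_Collect_le continuous_intros)
  moreover have "\<Theta> \<subseteq> {z. snd z \<le> 0}" using assms(1) less_imp_le by blast
  ultimately show ?thesis using assms(2) closure_minimal by blast
qed

lemma thin_domain_closure:
  fixes \<Theta> :: "((real^'n) \<times> real) set"
  assumes \<Theta>: "\<Theta> = {(x, t). norm x < \<zeta> t \<and> t0 < t \<and> t < 0}" and p: "p > 0"
    and \<epsilon>: "\<And>t. s < t \<Longrightarrow> t < 0 \<Longrightarrow> \<zeta> t \<le> \<epsilon> * (- t) powr (1/p)"
    and z: "z \<in> closure \<Theta>" "s < snd z"
  shows "norm (fst z) \<le> \<epsilon> * (- snd z) powr (1/p)"
proof -
  have z0: "snd z \<le> 0" by (rule nonpositive_time_on_closure[OF _ z(1)]) (auto simp: \<Theta>)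
  let ?g = "\<lambda>z :: (real^'n) \<times> real. \<epsilon> * (max 0 (- snd z)) powr (1/p)"
  have "continuous_on UNIV ?g" using p by (intro continuous_intros continuous_on_powr') auto
  then have "closed {z. norm (fst z) \<le> ?g z}"
    by (rule closed_Collect_le[OF continuous_on_norm[OF continuous_on_fst[OF continuous_on_id]]])
  moreover have "closed {z :: (real^'n) \<times> real. snd z \<le> s}" by (intro closed_Collect_le continuous_intros)
  ultimately have "closed ({z. snd z \<le> s} \<union> {z. norm (fst z) \<le> ?g z})" by (intro closed_Un)
  moreover have "\<Theta> \<subseteq> {z. snd z \<le> s} \<union> {z. norm (fst z) \<le> ?g z}"
  proof
    fix z assume "z \<in> \<Theta>"
    then obtain x t where z: "z = (x, t)" "norm x < \<zeta> t" "t < 0" unfolding \<Theta> by auto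
    show "z \<in> {z. snd z \<le> s} \<union> {z. norm (fst z) \<le> ?g z}"
    proof (cases "t \<le> s")
      case False
      then have "norm x \<le> \<epsilon> * (- t) powr (1/p)" using \<epsilon>[of t] z by simp
      then show ?thesis using z by (simp add: max_def)
    qed (use z in simp)
  qed
  ultimately have "z \<in> {z. snd z \<le> s} \<union> {z. norm (fst z) \<le> ?g z}" using z(1) closure_minimal by blast
  then show ?thesis using z0 z(2) by (auto simp: max_def)
qed

section \<open>The bound from below\<close>

lemma scaled_norm_powr_bounds:
  assumes "c \<ge> 0" "norm x \<le> \<rho>" "q > 0" "\<rho> \<ge> 0"
  shows "0 \<le> c * norm (x :: real^'n) powr q" "c * norm x powr q \<le> c * \<rho> powr q"
  using assms by (auto intro!: mult_left_mono powr_mono2)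

text \<open>A constant is no strict subsolution, but \<open>c \<bar>x\<bar>\<^sup>q + B - 2\<close> with a small \<open>c\<close> is one, and on a bounded domain it
  stays below \<open>B\<close>. This gives a bound that does not depend on the member of the upper class.\<close>

lemma upper_class_global_bound:
  fixes \<Theta> :: "((real^'n) \<times> real) set"
  assumes p: "p > 2" and \<Theta>: "open \<Theta>" "bounded \<Theta>"
    and u: "u \<in> upper_class p \<Theta> f" and f: "\<And>\<xi>. \<xi> \<in> frontier \<Theta> \<Longrightarrow> B \<le> f \<xi>"
    and z: "z \<in> \<Theta>"
  shows "ereal (B - 2) \<le> u z"
proof -
  define q where "q = p / (p - 1)"
  have q: "q > 0" using p by (simp add: q_def)
  obtain R where R: "R > 0" "\<And>z. z \<in> closure \<Theta> \<Longrightarrow> norm z \<le> R"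
    using bounded_closure[OF \<Theta>(2)] unfolding bounded_pos by blast
  define c where "c = 1 / R powr q"
  have c: "c > 0" "c * R powr q = 1" using R by (auto simp: c_def)
  let ?v = "profile 1 c q 0 0 (B - 2) :: (real^'n) \<times> real \<Rightarrow> real"
  obtain m where m: "\<And>z. z \<in> \<Theta> \<Longrightarrow> ereal m \<le> u z" and us: "p_superparabolic p \<Theta> u"
    and ub: "\<And>\<xi>. \<xi> \<in> frontier \<Theta> \<Longrightarrow> ereal (f \<xi>) \<le> Liminf (at \<xi> within \<Theta>) u"
    using u unfolding upper_class_def by blast
  obtain T where T: "\<And>z. z \<in> closure \<Theta> \<Longrightarrow> \<bar>snd z\<bar> \<le> T"
    using R(2) norm_snd_le by (metis order_trans real_norm_def prod.collapse)
  have zc: "z \<in> closure \<Theta>" using z closure_subset by blast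
  have "ereal (?v z) \<le> u z"
  proof (rule superparabolic_comparison[OF p q_def c(1) _ \<Theta> us m, where \<tau> = "- T - 1" and \<sigma> = T])
    show "0 < real CARD('n) * (c * q) powr (p - 1)" using c q by simp
    show "ereal (?v z) \<le> u z" if "z \<in> \<Theta>" "snd z = - T - 1" for z
      using T[of z] that closure_subset[of \<Theta>] by force
    show "ereal (?v \<xi>) < Liminf (at \<xi> within \<Theta>) u" if \<xi>: "\<xi> \<in> frontier \<Theta>" for \<xi>
    proof -
      have "norm (fst \<xi>) \<le> R" using R(2)[of \<xi>] \<xi> norm_fst_le[of "fst \<xi>" "snd \<xi>"] by (auto simp: frontier_def)
      then have "c * norm (fst \<xi>) powr q \<le> 1" using scaled_norm_powr_bounds(2)[of c "fst \<xi>" R q] c q R by simp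
      then have "?v \<xi> < f \<xi>" using f[OF \<xi>] by (simp add: profile_def)
      then show ?thesis using ub[OF \<xi>] by (meson less_ereal.simps(1) less_le_trans)
    qed
  qed (use z T[OF zc] in auto)
  moreover have "B - 2 \<le> ?v z" using c by (simp add: profile_def)
  ultimately show ?thesis by (meson ereal_less_eq(3) order_trans)
qed

text \<open>For a point at time \<open>t\<close>, the explicit subsolution starts at the time \<open>2 t\<close> below the known bound
  \<open>L - M\<close>, stays below \<open>L - M/2\<close> in the thin domain, and reaches at least \<open>L - 3M/4\<close> at time \<open>t\<close>.\<close>

lemma upper_class_bound_step:
  fixes \<Theta> :: "((real^'n) \<times> real) set"
  assumes p: "p > 2" and q: "q = p / (p - 1)" and \<Theta>: "open \<Theta>" "bounded \<Theta>"
    and neg: "\<And>z. z \<in> \<Theta> \<Longrightarrow> snd z < 0" and \<epsilon>: "\<epsilon> > 0"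
    and thin: "\<And>z. z \<in> closure \<Theta> \<Longrightarrow> s0 \<le> snd z \<Longrightarrow> norm (fst z) \<le> \<epsilon> * (- snd z) powr (1/p)"
    and coeff: "\<And>M \<sigma>. \<eta> \<le> M \<Longrightarrow> 0 < \<sigma> \<Longrightarrow> \<exists>c>0. c * (\<epsilon> * \<sigma> powr (1/p)) powr q = M / 4 \<and> M / \<sigma> < (c * q) powr (p - 1)"
    and \<eta>: "\<eta> > 0"
    and u: "u \<in> upper_class p \<Theta> f" and f: "\<And>\<xi>. \<xi> \<in> frontier \<Theta> \<Longrightarrow> s0 \<le> snd \<xi> \<Longrightarrow> L \<le> f \<xi>"
    and M: "\<eta> \<le> M" and s: "s0 \<le> s" "s < 0"
    and bound: "\<And>z. z \<in> \<Theta> \<Longrightarrow> s \<le> snd z \<Longrightarrow> ereal (L - M) \<le> u z"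
    and z: "z \<in> \<Theta>" "s / 2 \<le> snd z"
  shows "ereal (L - 3/4 * M) \<le> u z"
proof -
  have q0: "q > 0" using p q by simp
  define t where "t = snd z"
  have t: "t < 0" "s \<le> 2 * t" using neg[OF z(1)] z(2) by (auto simp: t_def)
  define \<sigma> where "\<sigma> = - (2 * t)"
  have \<sigma>: "\<sigma> > 0" using t by (simp add: \<sigma>_def)
  define \<rho> where "\<rho> = \<epsilon> * \<sigma> powr (1/p)"
  have \<rho>: "\<rho> > 0" using \<epsilon> \<sigma> by (simp add: \<rho>_def)
  obtain c where c: "c > 0" "c * \<rho> powr q = M / 4" "M / \<sigma> < (c * q) powr (p - 1)"
    using coeff[OF M \<sigma>] unfolding \<rho>_def by blast
  let ?d = "L - M - M / 4 - M / \<sigma> * (2 * t)"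
  let ?v = "profile 1 c q 0 (M / \<sigma>) ?d :: (real^'n) \<times> real \<Rightarrow> real"
  have v: "?v w = L - M - M / 4 + c * norm (fst w) powr q + M / \<sigma> * (snd w - 2 * t)" for w
    by (simp add: profile_def algebra_simps)
  have M0: "M > 0" using M \<eta> by linarith
  obtain m where m: "\<And>z. z \<in> \<Theta> \<Longrightarrow> ereal m \<le> u z" and us: "p_superparabolic p \<Theta> u"
    and ub: "\<And>\<xi>. \<xi> \<in> frontier \<Theta> \<Longrightarrow> ereal (f \<xi>) \<le> Liminf (at \<xi> within \<Theta>) u"
    using u unfolding upper_class_def by blast
  have cpow: "0 \<le> c * norm (fst w) powr q" "c * norm (fst w) powr q \<le> M / 4"
    if "w \<in> closure \<Theta>" "2 * t \<le> snd w" "snd w \<le> 0" for w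
  proof -
    have "norm (fst w) \<le> \<epsilon> * (- snd w) powr (1/p)" using that s t by (intro thin) auto
    also have "\<dots> \<le> \<rho>" unfolding \<rho>_def \<sigma>_def using that \<epsilon> p by (intro mult_left_mono powr_mono2) auto
    finally have "norm (fst w) \<le> \<rho>" .
    from scaled_norm_powr_bounds[OF _ this q0, of c] c \<rho>
    show "0 \<le> c * norm (fst w) powr q" "c * norm (fst w) powr q \<le> M / 4" by auto
  qed
  have "ereal (?v z) \<le> u z"
  proof (rule superparabolic_comparison[OF p q c(1) _ \<Theta> us m, where \<tau> = "2 * t" and \<sigma> = t])
    have "1 * (c * q) powr (p - 1) \<le> real CARD('n) * (c * q) powr (p - 1)" by (intro mult_right_mono) auto
    then show "M / \<sigma> < real CARD('n) * (c * q) powr (p - 1)" using c(3) by linarith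
    show "ereal (?v w) \<le> u w" if w: "w \<in> \<Theta>" "snd w = 2 * t" for w
    proof -
      have "w \<in> closure \<Theta>" using w closure_subset by blast
      then have "?v w \<le> L - M" unfolding v using cpow(2)[of w] w t by simp
      moreover have "ereal (L - M) \<le> u w" using w t by (intro bound) auto
      ultimately show ?thesis by (meson ereal_less_eq(3) order_trans)
    qed
    show "ereal (?v \<xi>) < Liminf (at \<xi> within \<Theta>) u" if \<xi>: "\<xi> \<in> frontier \<Theta>" "2 * t \<le> snd \<xi>" "snd \<xi> \<le> t" for \<xi>
    proof -
      have "c * norm (fst \<xi>) powr q \<le> M / 4" using \<xi> t by (intro cpow(2)) (auto simp: frontier_def)
      moreover have "M / \<sigma> * (snd \<xi> - 2 * t) \<le> M / \<sigma> * (\<sigma> / 2)" by (intro mult_left_mono) (use \<xi> in \<open>simp add: \<sigma>_def\<close>, use M0 \<sigma> in simp)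
      then have "M / \<sigma> * (snd \<xi> - 2 * t) \<le> M / 2" using \<sigma> by simp
      ultimately have "?v \<xi> < L" unfolding v using M0 by linarith
      also have "L \<le> f \<xi>" using \<xi> s t by (intro f) auto
      finally show ?thesis using ub[OF \<xi>(1)] by (meson less_ereal.simps(1) less_le_trans)
    qed
  qed (use z t in \<open>auto simp: t_def\<close>)
  moreover have "L - 3/4 * M \<le> ?v z"
  proof -
    have "M / \<sigma> * (snd z - 2 * t) = M / \<sigma> * (\<sigma> / 2)" by (simp add: t_def \<sigma>_def)
    then have "M / \<sigma> * (snd z - 2 * t) = M / 2" using \<sigma> by simp
    moreover have "c * norm (fst z) powr q \<ge> 0" using c by simp
    ultimately show ?thesis unfolding v by linarith
  qed
  ultimately show ?thesis by (meson ereal_less_eq(3) order_trans)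
qed

section \<open>Construction of members of the upper class\<close>

text \<open>The mirror image of the preceding step. The explicit supersolution starts at the time \<open>s/2\<close> above the
  constant \<open>L + M\<close> and has fallen to at most \<open>L + 3M/4\<close> at the time \<open>s/4\<close>, when the constant takes over. Both
  transitions go upwards.\<close>

lemma upper_function_step:
  fixes \<Theta> :: "((real^'n) \<times> real) set" and f :: "(real^'n) \<times> real \<Rightarrow> real"
  assumes p: "p > 2" and q: "q = p / (p - 1)" and \<Theta>: "open \<Theta>" and \<epsilon>: "\<epsilon> > 0"
    and thin: "\<And>z. z \<in> \<Theta> \<Longrightarrow> s0 \<le> snd z \<Longrightarrow> norm (fst z) \<le> \<epsilon> * (- snd z) powr (1/p)"
    and neg: "\<And>z. z \<in> \<Theta> \<Longrightarrow> snd z < 0"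
    and coeff: "\<And>M \<sigma>. \<eta> \<le> M \<Longrightarrow> 0 < \<sigma> \<Longrightarrow> \<exists>c>0. c * (\<epsilon> * \<sigma> powr (1/p)) powr q = M / 4 \<and> M / \<sigma> < (c * q) powr (p - 1)"
    and \<eta>: "\<eta> > 0" and M: "\<eta> \<le> M" and s: "s0 \<le> s" "s < 0"
    and f: "p_superparabolic p \<Theta> (\<lambda>z. ereal (f z))" "\<And>z. z \<in> \<Theta> \<Longrightarrow> L \<le> f z"
      "\<And>z. z \<in> \<Theta> \<Longrightarrow> s < snd z \<Longrightarrow> f z = L + M"
  shows "\<exists>f'. p_superparabolic p \<Theta> (\<lambda>z. ereal (f' z)) \<and> (\<forall>z\<in>\<Theta>. L \<le> f' z) \<and>
     (\<forall>z\<in>\<Theta>. snd z \<le> s \<longrightarrow> f' z = f z) \<and> (\<forall>z\<in>\<Theta>. s / 4 < snd z \<longrightarrow> f' z = L + 3/4 * M)"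
proof -
  have q0: "q > 0" using p q by simp
  define \<sigma> where "\<sigma> = - (s / 2)"
  have \<sigma>: "\<sigma> > 0" using s by (simp add: \<sigma>_def)
  define \<rho> where "\<rho> = \<epsilon> * \<sigma> powr (1/p)"
  have \<rho>: "\<rho> > 0" using \<epsilon> \<sigma> by (simp add: \<rho>_def)
  obtain c where c: "c > 0" "c * \<rho> powr q = M / 4" "M / \<sigma> < (c * q) powr (p - 1)"
    using coeff[OF M \<sigma>] unfolding \<rho>_def by blast
  have "1 * (c * q) powr (p - 1) \<le> real CARD('n) * (c * q) powr (p - 1)" by (intro mult_right_mono) auto
  then have l: "M / \<sigma> \<le> real CARD('n) * (c * q) powr (p - 1)" using c(3) by linarith
  have M0: "M > 0" using M \<eta> by linarith
  let ?d = "L + M + M / 4 + M / \<sigma> * (s / 2)"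
  let ?w = "profile (-1) c q 0 (M / \<sigma>) ?d :: (real^'n) \<times> real \<Rightarrow> real"
  have w: "?w z = L + M + (M / 4 - c * norm (fst z) powr q) - M / \<sigma> * (snd z - s / 2)" for z
    by (simp add: profile_def algebra_simps)
  have cpow: "0 \<le> c * norm (fst z) powr q" "c * norm (fst z) powr q \<le> M / 4"
    if z: "z \<in> \<Theta>" "s / 2 \<le> snd z" for z
  proof -
    have "norm (fst z) \<le> \<epsilon> * (- snd z) powr (1/p)" using z s by (intro thin) auto
    also have "\<dots> \<le> \<rho>" unfolding \<rho>_def \<sigma>_def using z \<epsilon> p neg[OF z(1)] by (intro mult_left_mono powr_mono2) auto
    finally have "norm (fst z) \<le> \<rho>" .
    from scaled_norm_powr_bounds[OF _ this q0, of c] c \<rho>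
    show "0 \<le> c * norm (fst z) powr q" "c * norm (fst z) powr q \<le> M / 4" by auto
  qed
  have slope: "M / \<sigma> * (s / 4 - s / 2) = M / 2" using \<sigma> by (simp add: \<sigma>_def)
  have cw: "continuous_on UNIV ?w" by (rule profile_continuous[OF q0])
  define f1 where "f1 z = (if snd z \<le> s / 2 then f z else ?w z)" for z
  have f1: "p_superparabolic p \<Theta> (\<lambda>z. ereal (f1 z))"
    unfolding f1_def
  proof (rule superparabolic_paste[OF p q less_imp_le[OF c(1)] l \<Theta> f(1), where k = "\<lambda>_. L + M" and r = s])
    show "L + M \<le> ?w z" if "z \<in> \<Theta>" "snd z = s / 2" for z 
    proof -
      have "M / \<sigma> * (snd z - s / 2) = 0" using that by simp
      moreover have "c * norm (fst z) powr q \<le> M / 4" using that by (intro cpow(2)) auto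
      ultimately show ?thesis unfolding w by linarith
    qed
  qed (use s f(3) in \<open>auto intro: continuous_intros\<close>)
  let ?k = "profile (-1) 0 q 0 0 (L + 3/4 * M) :: (real^'n) \<times> real \<Rightarrow> real"
  define f2 where "f2 z = (if snd z \<le> s / 4 then f1 z else ?k z)" for z
  have f2: "p_superparabolic p \<Theta> (\<lambda>z. ereal (f2 z))"
    unfolding f2_def
  proof (rule superparabolic_paste[OF p q _ _ \<Theta> f1, where k = ?w and r = "s / 2"])
    show "f1 z = ?w z" if "s / 2 < snd z" for z using that by (simp add: f1_def)
    show "?w z \<le> ?k z" if z: "z \<in> \<Theta>" "snd z = s / 4" for z
    proof -
      have "0 \<le> c * norm (fst z) powr q" using z s by (intro cpow(1)) auto
      then have "?w z \<le> L + M + M / 4 - M / 2" unfolding w z(2) slope by linarith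
      then show ?thesis by (simp add: profile_def)
    qed
  qed (use s cw in auto)
  have "L \<le> f2 z" if z: "z \<in> \<Theta>" for z
  proof -
    consider "snd z \<le> s / 2" | "s / 2 < snd z" "snd z \<le> s / 4" | "s / 4 < snd z" by linarith
    then show ?thesis
    proof cases
      case 1
      then show ?thesis using f(2)[OF z] s by (simp add: f2_def f1_def)
    next
      case 2
      have "M / \<sigma> * (snd z - s / 2) \<le> M / \<sigma> * (s / 4 - s / 2)" using 2 M0 \<sigma> by (intro mult_left_mono) auto
      then have "L \<le> ?w z" unfolding w slope using cpow(2)[OF z less_imp_le[OF 2(1)]] M0 by linarith
      then show ?thesis using 2 by (simp add: f2_def f1_def)
    next
      case 3
      then show ?thesis using M0 by (simp add: f2_def profile_def)
    qed
  qed
  moreover have "f2 z = f z" if "snd z \<le> s" for z using that s by (simp add: f2_def f1_def)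
  moreover have "f2 z = L + 3/4 * M" if "s / 4 < snd z" for z using that by (simp add: f2_def profile_def)
  ultimately show ?thesis using f2 by blast
qed

section \<open>Regularity of the origin\<close>

theorem theorem6p1:
  fixes p t0 :: real
    and \<zeta> :: "real \<Rightarrow> real"
    and \<Theta> :: "((real^'n) \<times> real) set"
  assumes "p > 2"
    and "t0 < 0"
    and "\<Theta> = {(x, t). norm x < \<zeta> t \<and> t0 < t \<and> t < 0}"
    and "\<forall>t\<in>{t0<..<0}. \<zeta> t > 0"
    and "continuous_on {t0<..<0} \<zeta>"
    and "bounded \<Theta>"
    and "((\<lambda>t. (-t) powr (-1/p) * \<zeta> t) \<longlongrightarrow> 0) (at_left 0)"
  shows "regular_point p \<Theta> (0, 0)"
proof -
  note p = assms(1) and t0 = assms(2) and \<Theta> = assms(3)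
  define q where "q = p / (p - 1)"
  have o\<Theta>: "open \<Theta>" by (rule thin_domain_open[OF \<Theta> assms(5)])
  have b\<Theta>: "bounded \<Theta>" by fact
  have neg: "snd z < 0" if "z \<in> \<Theta>" for z using that unfolding \<Theta> by auto
  have fr_cl: "\<xi> \<in> closure \<Theta>" if "\<xi> \<in> frontier \<Theta>" for \<xi> using that by (simp add: frontier_def)
  have origin: "(0, 0) \<in> frontier \<Theta>" by (rule thin_domain_origin_frontier[OF t0 \<Theta> assms(4)])
  have thin: "\<exists>s<0. \<forall>z\<in>closure \<Theta>. s < snd z \<longrightarrow> norm (fst z) \<le> \<epsilon> * (- snd z) powr (1/p)" if \<epsilon>: "\<epsilon> > 0" for \<epsilon>
  proof -
    have "\<forall>\<^sub>F t in at_left 0. (-t) powr (-1/p) * \<zeta> t < \<epsilon>" using assms(7) \<epsilon> by (rule order_tendstoD)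
    then obtain s where s: "s < 0" "\<And>t. s < t \<Longrightarrow> t < 0 \<Longrightarrow> (-t) powr (-1/p) * \<zeta> t < \<epsilon>"
      unfolding eventually_at_left_field by blast
    have "\<zeta> t \<le> \<epsilon> * (- t) powr (1/p)" if t: "s < t" "t < 0" for t
    proof -
      have "\<zeta> t = ((-t) powr (-1/p) * \<zeta> t) * (- t) powr (1/p)" using t by (simp add: powr_minus field_simps)
      also have "\<dots> \<le> \<epsilon> * (- t) powr (1/p)" using s(2)[OF t] by (intro mult_right_mono) auto
      finally show ?thesis .
    qed
    from thin_domain_closure[OF \<Theta> _ this] p s(1) show ?thesis by (intro exI[of _ s]) auto
  qed
  have cl_neg: "snd z \<le> 0" if "z \<in> closure \<Theta>" for z
    by (rule nonpositive_time_on_closure[OF neg that])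
  have "(upper_Perron p \<Theta> f \<longlongrightarrow> ereal (f (0, 0))) (at (0, 0) within \<Theta>)"
    if cf: "continuous_on (frontier \<Theta>) f" for f
  proof -
    have "compact (frontier \<Theta>)" using b\<Theta> by (rule compact_frontier_bounded)
    from compact_imp_bounded[OF compact_continuous_image[OF cf this]]
    obtain B where B: "\<And>\<xi>. \<xi> \<in> frontier \<Theta> \<Longrightarrow> \<bar>f \<xi>\<bar> \<le> B" unfolding bounded_iff by auto
    have B0: "\<bar>f (0, 0)\<bar> \<le> B" by (rule B[OF origin])
    have key: "\<exists>s<0. \<forall>z\<in>\<Theta>. s < snd z \<longrightarrow>
        ereal (f (0, 0) - \<eta> - \<eta>) \<le> upper_Perron p \<Theta> f z \<and> upper_Perron p \<Theta> f z \<le> ereal (f (0, 0) + \<eta> + \<eta>)"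
      if \<eta>: "\<eta> > 0" for \<eta>
    proof -
      obtain \<epsilon> where \<epsilon>: "\<epsilon> > 0" and coeff: "\<And>M \<sigma>. \<eta> \<le> M \<Longrightarrow> 0 < \<sigma> \<Longrightarrow>
          \<exists>c>0. c * (\<epsilon> * \<sigma> powr (1/p)) powr q = M / 4 \<and> M / \<sigma> < (c * q) powr (p - 1)"
        using barrier_coefficient[OF p q_def \<eta>] by blast
      obtain s1 where s1: "s1 < 0" "\<And>z. z \<in> closure \<Theta> \<Longrightarrow> s1 < snd z \<Longrightarrow> norm (fst z) \<le> \<epsilon> * (- snd z) powr (1/p)"
        using thin[OF \<epsilon>] by blast
      \<comment> \<open>boundary points at late times are close to the origin\<close>
      obtain d where d: "d > 0" "\<And>\<xi>. \<xi> \<in> frontier \<Theta> \<Longrightarrow> dist \<xi> (0, 0) < d \<Longrightarrow> \<bar>f \<xi> - f (0, 0)\<bar> < \<eta>"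
        using cf origin \<eta> unfolding continuous_on_iff dist_real_def by blast
      have "\<forall>\<^sub>F t in at_left 0. \<epsilon> * (- t) powr (1/p) < d / 2"
      proof (rule order_tendstoD)
        have "((\<lambda>t::real. \<epsilon> * (- t) powr (1/p)) \<longlongrightarrow> \<epsilon> * (- 0) powr (1/p)) (at_left 0)"
          using p by (intro tendsto_intros) (auto simp: eventually_at_filter)
        then show "((\<lambda>t::real. \<epsilon> * (- t) powr (1/p)) \<longlongrightarrow> 0) (at_left 0)" by simp
      qed (use d in simp)
      then obtain s2 where s2: "s2 < 0" "\<And>t. s2 < t \<Longrightarrow> t < 0 \<Longrightarrow> \<epsilon> * (- t) powr (1/p) < d / 2"
        unfolding eventually_at_left_field by blast
      define s0 where "s0 = Max {s1 / 2, s2 / 2, - d / 4}"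
      have s0: "s0 < 0" "s1 < s0" "s2 < s0" "- d / 2 < s0" using s1 s2 d by (auto simp: s0_def)
      have th: "norm (fst z) \<le> \<epsilon> * (- snd z) powr (1/p)" if "z \<in> closure \<Theta>" "s0 \<le> snd z" for z
        using s1(2)[of z] that s0 by simp
      have f_near: "\<bar>f \<xi> - f (0, 0)\<bar> \<le> \<eta>" if \<xi>: "\<xi> \<in> frontier \<Theta>" "s0 \<le> snd \<xi>" for \<xi>
      proof -
        have n1: "norm (fst \<xi>) < d / 2"
        proof (cases "snd \<xi> = 0")
          case True
          then show ?thesis using th[OF fr_cl[OF \<xi>(1)] \<xi>(2)] d(1) p by simp
        next
          case False
          then have "snd \<xi> < 0" using cl_neg[OF fr_cl[OF \<xi>(1)]] by simp
          then show ?thesis using th[OF fr_cl[OF \<xi>(1)] \<xi>(2)] s2(2)[of "snd \<xi>"] \<xi>(2) s0 by simp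
        qed
        have n2: "\<bar>snd \<xi>\<bar> < d / 2" using cl_neg[OF fr_cl[OF \<xi>(1)]] \<xi>(2) s0 by simp
        have "dist \<xi> (0, 0) \<le> norm (fst \<xi>) + norm (snd \<xi>)"
          using norm_Pair_le[of "fst \<xi>" "snd \<xi>"] by (simp add: dist_norm flip: zero_prod_def)
        then have "dist \<xi> (0, 0) < d" using n1 n2 by simp
        then show ?thesis using d(2)[OF \<xi>(1)] by simp
      qed
      define L1 where "L1 = f (0, 0) - \<eta>"
      define L2 where "L2 = f (0, 0) + \<eta>"
      \<comment> \<open>bound from below, uniform over the upper class\<close>
      define R where "R M s \<longleftrightarrow> (\<forall>u\<in>upper_class p \<Theta> f. \<forall>z\<in>\<Theta>. s \<le> snd z \<longrightarrow> ereal (L1 - M) \<le> u z)" for M s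
      have R0: "R (L1 + B + 2) s0"
        unfolding R_def
      proof (intro ballI impI)
        fix u z assume u: "u \<in> upper_class p \<Theta> f" and z: "z \<in> \<Theta>"
        have "ereal (- B - 2) \<le> u z"
          by (rule upper_class_global_bound[OF p o\<Theta> b\<Theta> u _ z]) (use B in force)
        then show "ereal (L1 - (L1 + B + 2)) \<le> u z" by (simp add: algebra_simps)
      qed
      have "R (3/4 * M) (s/4)" if "R M s" "\<eta> \<le> M" "s0 \<le> s" "s < 0" for M s
        unfolding R_def
      proof (intro ballI impI)
        fix u z assume u: "u \<in> upper_class p \<Theta> f" and z: "z \<in> \<Theta>" "s / 4 \<le> snd z"
        show "ereal (L1 - 3/4 * M) \<le> u z"
        proof (rule upper_class_bound_step[OF p q_def o\<Theta> b\<Theta> neg \<epsilon> th coeff \<eta> u _ that(2-4) _ z(1)])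
          show "L1 \<le> f \<xi>" if "\<xi> \<in> frontier \<Theta>" "s0 \<le> snd \<xi>" for \<xi> using f_near[OF that] by (simp add: L1_def)
          show "ereal (L1 - M) \<le> u w" if "w \<in> \<Theta>" "s \<le> snd w" for w using \<open>R M s\<close> u that unfolding R_def by blast
          show "s / 2 \<le> snd z" using z \<open>s < 0\<close> by simp
        qed
      qed
      from geometric_decay[of R, OF R0 s0(1) \<eta> this]
      obtain M s where Ms: "M < \<eta>" "s < 0" "R M s" by blast
      \<comment> \<open>one member of the upper class close to \<open>f (0, 0)\<close> at late times\<close>
      define Q where "Q M s \<longleftrightarrow> (\<exists>g. p_superparabolic p \<Theta> (\<lambda>z. ereal (g z)) \<and> (\<forall>z\<in>\<Theta>. L2 \<le> g z) \<and>
         (\<forall>z\<in>\<Theta>. snd z \<le> s0 \<longrightarrow> B \<le> g z) \<and> (\<forall>z\<in>\<Theta>. s < snd z \<longrightarrow> g z = L2 + M))" for M s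
      have "Q (2 * B) s0"
      proof -
        have sp: "p_superparabolic p \<Theta> (\<lambda>z. ereal (profile (-1) 0 q 0 0 (L2 + 2 * B) z))"
          by (rule profile_superparabolic[OF p q_def _ _ o\<Theta>]) auto
        have pr: "profile (-1) 0 q 0 0 (L2 + 2 * B) z = L2 + 2 * B" for z :: "(real^'n) \<times> real" by (simp add: profile_def)
        show ?thesis unfolding Q_def
          by (rule exI[of _ "\<lambda>_. L2 + 2 * B"]) (use sp[unfolded pr] B0 \<eta> in \<open>auto simp: L2_def\<close>)
      qed
      moreover have "Q (3/4 * M) (s/4)" if Q: "Q M s" "\<eta> \<le> M" "s0 \<le> s" "s < 0" for M s
      proof -
        obtain g where g: "p_superparabolic p \<Theta> (\<lambda>z. ereal (g z))" "\<And>z. z \<in> \<Theta> \<Longrightarrow> L2 \<le> g z"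
          "\<And>z. z \<in> \<Theta> \<Longrightarrow> snd z \<le> s0 \<Longrightarrow> B \<le> g z" "\<And>z. z \<in> \<Theta> \<Longrightarrow> s < snd z \<Longrightarrow> g z = L2 + M"
          using Q(1) unfolding Q_def by blast
        have th': "norm (fst z) \<le> \<epsilon> * (- snd z) powr (1/p)" if "z \<in> \<Theta>" "s0 \<le> snd z" for z
          using th that closure_subset by blast
        obtain g' where g': "p_superparabolic p \<Theta> (\<lambda>z. ereal (g' z))" "\<forall>z\<in>\<Theta>. L2 \<le> g' z"
          "\<forall>z\<in>\<Theta>. snd z \<le> s \<longrightarrow> g' z = g z" "\<forall>z\<in>\<Theta>. s / 4 < snd z \<longrightarrow> g' z = L2 + 3/4 * M"
          using upper_function_step[OF p q_def o\<Theta> \<epsilon> th' neg coeff \<eta> Q(2-4) g(1,2,4)] by blast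
        have "\<forall>z\<in>\<Theta>. snd z \<le> s0 \<longrightarrow> B \<le> g' z" using g'(3) g(3) Q(3) by (metis order_trans)
        then show ?thesis unfolding Q_def using g' by blast
      qed
      ultimately obtain M' s' where Ms': "M' < \<eta>" "s' < 0" "Q M' s'"
        using geometric_decay[of Q, OF _ s0(1) \<eta>] by blast
      then obtain g where g: "p_superparabolic p \<Theta> (\<lambda>z. ereal (g z))" "\<And>z. z \<in> \<Theta> \<Longrightarrow> L2 \<le> g z"
          "\<And>z. z \<in> \<Theta> \<Longrightarrow> snd z \<le> s0 \<Longrightarrow> B \<le> g z" "\<And>z. z \<in> \<Theta> \<Longrightarrow> s' < snd z \<Longrightarrow> g z = L2 + M'"
        unfolding Q_def by blast
      have gU: "(\<lambda>z. ereal (g z)) \<in> upper_class p \<Theta> f"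
        unfolding upper_class_def
      proof (intro CollectI conjI ballI)
        show "\<exists>m::real. \<forall>z\<in>\<Theta>. ereal m \<le> ereal (g z)" using g(2) by (intro exI[of _ L2]) simp
        fix \<xi> assume \<xi>: "\<xi> \<in> frontier \<Theta>"
        show "ereal (f \<xi>) \<le> Liminf (at \<xi> within \<Theta>) (\<lambda>z. ereal (g z))"
        proof (rule Liminf_bounded)
          show "\<forall>\<^sub>F z in at \<xi> within \<Theta>. ereal (f \<xi>) \<le> ereal (g z)"
          proof (cases "s0 \<le> snd \<xi>")
            case True
            then have "f \<xi> \<le> L2" using f_near[OF \<xi> True] by (simp add: L2_def)
            then show ?thesis using g(2) by (auto simp: eventually_at_filter intro!: eventuallyI intro: order_trans)
          next
            case False
            have "((\<lambda>z. snd z) \<longlongrightarrow> snd \<xi>) (at \<xi> within \<Theta>)" by (intro tendsto_intros)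
            then have "\<forall>\<^sub>F z in at \<xi> within \<Theta>. snd z < s0" using False by (intro order_tendstoD) auto
            moreover have "\<forall>\<^sub>F z in at \<xi> within \<Theta>. z \<in> \<Theta>" by (simp add: eventually_at_filter)
            ultimately show ?thesis
            proof eventually_elim
              fix z assume "snd z < s0" "z \<in> \<Theta>"
              then have "B \<le> g z" by (intro g(3)) auto
              then show "ereal (f \<xi>) \<le> ereal (g z)" using B[OF \<xi>] by simp
            qed
          qed
        qed
      qed (rule g(1))
      show ?thesis
      proof (intro exI[of _ "max s s'"] conjI ballI impI)
        show "max s s' < 0" using Ms(2) Ms'(2) by simp
        fix z assume z: "z \<in> \<Theta>" "max s s' < snd z"
        have "ereal (L1 - M) \<le> u z" if "u \<in> upper_class p \<Theta> f" for u
          using Ms(3) that z unfolding R_def by auto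
        then have "ereal (L1 - M) \<le> upper_Perron p \<Theta> f z" unfolding upper_Perron_def by (intro INF_greatest)
        moreover have "ereal (f (0, 0) - \<eta> - \<eta>) \<le> ereal (L1 - M)" using Ms(1) by (simp add: L1_def)
        ultimately show "ereal (f (0, 0) - \<eta> - \<eta>) \<le> upper_Perron p \<Theta> f z" by (rule order_trans[rotated])
        have "upper_Perron p \<Theta> f z \<le> ereal (g z)" unfolding upper_Perron_def by (rule INF_lower2[OF gU]) simp
        also have "g z = L2 + M'" using z by (intro g(4)) auto
        also have "ereal (L2 + M') \<le> ereal (f (0, 0) + \<eta> + \<eta>)" using Ms'(1) by (simp add: L2_def)
        finally show "upper_Perron p \<Theta> f z \<le> ereal (f (0, 0) + \<eta> + \<eta>)" .
      qed
    qed
    have ev: "\<forall>\<^sub>F z in at (0, 0) within \<Theta>. z \<in> \<Theta> \<and> s < snd z" if "s < 0" for s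
    proof -
      have "((\<lambda>z. snd z) \<longlongrightarrow> snd ((0, 0) :: (real^'n) \<times> real)) (at (0, 0) within \<Theta>)" by (intro tendsto_intros)
      then have "\<forall>\<^sub>F z in at (0, 0) within \<Theta>. s < snd z" using that by (intro order_tendstoD) auto
      moreover have "\<forall>\<^sub>F z in at (0, 0) within \<Theta>. z \<in> \<Theta>" by (simp add: eventually_at_filter)
      ultimately show ?thesis by eventually_elim simp
    qed
    show ?thesis
    proof (rule order_tendstoI)
      fix a assume "a < ereal (f (0, 0))"
      then obtain r where r: "a < ereal r" "r < f (0, 0)" using ereal_dense2 by force
      obtain s where s: "s < 0" "\<And>z. z \<in> \<Theta> \<Longrightarrow> s < snd z \<Longrightarrow>
          ereal (f (0, 0) - (f (0, 0) - r) / 2 - (f (0, 0) - r) / 2) \<le> upper_Perron p \<Theta> f z"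
        using key[of "(f (0, 0) - r) / 2"] r by auto
      show "\<forall>\<^sub>F z in at (0, 0) within \<Theta>. a < upper_Perron p \<Theta> f z"
        using ev[OF s(1)]
      proof eventually_elim
        fix z assume z: "z \<in> \<Theta> \<and> s < snd z"
        have "ereal r \<le> upper_Perron p \<Theta> f z" using s(2)[of z] z by (simp add: field_simps)
        with r(1) show "a < upper_Perron p \<Theta> f z" by (rule less_le_trans)
      qed
    next
      fix a assume "ereal (f (0, 0)) < a"
      then obtain r where r: "ereal r < a" "f (0, 0) < r" using ereal_dense2 by force
      obtain s where s: "s < 0" "\<And>z. z \<in> \<Theta> \<Longrightarrow> s < snd z \<Longrightarrow>
          upper_Perron p \<Theta> f z \<le> ereal (f (0, 0) + (r - f (0, 0)) / 2 + (r - f (0, 0)) / 2)"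
        using key[of "(r - f (0, 0)) / 2"] r by auto
      show "\<forall>\<^sub>F z in at (0, 0) within \<Theta>. upper_Perron p \<Theta> f z < a"
        using ev[OF s(1)]
      proof eventually_elim
        fix z assume z: "z \<in> \<Theta> \<and> s < snd z"
        have "upper_Perron p \<Theta> f z \<le> ereal r" using s(2)[of z] z by (simp add: field_simps)
        then show "upper_Perron p \<Theta> f z < a" using r(1) by (rule le_less_trans)
      qed
    qed
  qed
  then show ?thesis unfolding regular_point_def using origin by blast
qed

end
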